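(* Let $d\ge 1$, $N\ge 0$, and let $p\in\mathbb{C}[z_1,\dots,z_d]$ have total degree at most $N$. Write $p(z)=\sum_{|\alpha|\le N}p_\alpha z^\alpha$. The following are equivalent: \begin{enumerate} \item For every simple $N$-nilpotent $d$-tuple $T$ of contractions we have $\|p(T)\|\le 1$. \item There exist positive semi-definite complex matrices $A^1,\dots,A^d$, with rows and columns indexed by $[N]=\{\alpha\in\mathbb{N}_0^d:|\alpha|\le N\}$, such that for all $\alpha,\beta\in[N]$ \[ \delta_{0,\alpha,\beta}-\overline{p_\alpha}\,p_\beta=\sum_{j=1}^d\left(A^j_{\alpha,\beta}-A^j_{\alpha-e_j,\beta-e_j}\right), \] where $A^j_{\alpha,\beta}=0$ if an index is out of bounds (i.e. not in $[N]$), and $\delta_{0,\alpha,\beta}=1$ exactly when $\alpha=\beta=0$ and $0$ otherwise. \item There exist vector polynomials $A^1(z),\dots,A^d(z)$ of degree at most $N$ such that \[ 1-|p(z)|^2=\sum_{j=1}^d(1-|z_j|^2)\,|A^j(z)|^2 \quad \text{mod } \left((z)^{N+1},(\bar z)^{N+1}\right). \] \item There exists a rational inner function $\phi:\mathbb{D}^d\to\mathbb{D}$ such that $p(z)-\phi(z)$ vanishes to order at least $N+1$ (at the origin) and such that there exist positive semi-definite kernels $K_1,\dots,K_d:\mathbb{D}^d\times\mathbb{D}^d\to\mathbb{C}$ so that for all $z,w\in\mathbb{D}^d$ \[ 1-\overline{\phi(w)}\phi(z)=\sum_{j=1}^d(1-\bar w_jz_j)K_j(z,w). \] \end{enumerat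e}
   Context: Notation: $\mathbb{D}$ is the open unit disk in $\mathbb{C}$, $\mathbb{T}$ the unit circle; for $\alpha\in\mathbb{N}_0^d$, $|\alpha|=\sum_j\alpha_j$ and $z^\alpha=z_1^{\alpha_1}\cdots z_d^{\alpha_d}$; $e_j$ is the multi-index with $1$ in position $j$ and $0$ elsewhere. Simple $N$-nilpotent $d$-tuple: a $d$-tuple $T=(T_1,\dots,T_d)$ of commuting $n\times n$ complex matrices (any $n$) is a simple $N$-nilpotent $d$-tuple if $\mathbb{C}^n$ has a spanning set (not necessarily linearly independent) indexed as $\{\vec b_\alpha:\alpha\in\mathbb{N}_0^d,\ |\alpha|\le N\}$ such that for each $j$, $T_j\vec b_\alpha=\vec b_{\alpha+e_j}$ if $|\alpha|\le N-1$ and $T_j\vec b_\alpha=0$ if $|\alpha|=N$. It is a tuple of contractions if $\|T_j\|\le1$ for each $j$, where $\|\cdot\|$ is the operator norm for the Euclidean norm on $\mathbb{C}^n$. In (3): $(z)^{N+1}$ is the ideal of $\mathbb{C}[z_1,\dots,z_d]$ generated by $\{z^\alpha:|\alpha|=N+1\}$, and $((z)^{N+1},(\bar z)^{N+1})$ is the ideal of $\mathbb{C}[z_1,\dots,z_d,\bar z_1,\dots,\bar z_d]$ (with $z_j$ and $\bar z_j$ treated as independent variables) generated by $\{z^\alpha,\bar z^\alpha:|\alpha|=N+1\}$. The equation in (3) says that the two sides, as elements of this polynomial ring, differ by an element of the ideal. A vector polynomial is a $\mathbb{C}^m$-valued polynomial in $z$ for some $m$, and $|A^j(z)|^2$ is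 its squared Euclidean norm, $\sum_i \overline{A^j_i(z)}A^j_i(z)$. A rational inner function is a rational function $\phi=Q/R$ with $Q,R\in\mathbb{C}[z_1,\dots,z_d]$, $R(z)\ne0$ for $z\in\mathbb{D}^d$, and $|R(z)|=|Q(z)|$ on $\mathbb{T}^d$. A kernel $K:\mathbb{D}^d\times\mathbb{D}^d\to\mathbb{C}$ is positive semi-definite if for all finite sets of points $z^{(1)},\dots,z^{(m)}\in\mathbb{D}^d$ the matrix $(K(z^{(i)},z^{(k)}))_{i,k}$ is positive semi-definite. Vanishing to order at least $N+1$ at the origin means all Taylor coefficients of $z^\alpha$ with $|\alpha|\le N$ are zero.
   Formalization: In (4), φ is allowed to be a unimodular constant as well as a map into the open disk 𝔻; otherwise p = 1 satisfies (1)–(3) but (4) fails, since φ(0) = 1 is not in 𝔻. For p not a unimodular constant, (4) is unchanged. *)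

theory Defs
  imports
    "HOL-Analysis.Analysis"
    "HOL-Library.Poly_Mapping"
    "HOL-Algebra.Ideal"
    "Jordan_Normal_Form.VS_Connect"
begin

text \<open>
  The \<open>d\<close> coordinates are indexed by a finite type \<open>'d\<close> with \<open>CARD('d) = d\<close> (so \<open>d \<ge> 1\<close> holds
  automatically). A multi-index in \<open>\<nat>\<^sub>0\<^sup>d\<close> has type \<open>'d \<Rightarrow>\<^sub>0 nat\<close>, a polynomial is its finitely
  supported coefficient function (the ring structure is the one of \<^theory>\<open>HOL-Library.Poly_Mapping\<close>),
  and points of \<open>\<complex>\<^sup>d\<close> are functions \<open>'d \<Rightarrow> complex\<close>.
\<close>

type_synonym 'v mindex = "'v \<Rightarrow>\<^sub>0 nat"
type_synonym 'v cpoly = "('v \<Rightarrow>\<^sub>0 nat) \<Rightarrow>\<^sub>0 complex"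

definition msize :: "'v::finite mindex \<Rightarrow> nat" where
  "msize \<alpha> = (\<Sum>j\<in>UNIV. Poly_Mapping.lookup \<alpha> j)"

definition unit_index :: "'v \<Rightarrow> 'v mindex" where
  "unit_index j = Poly_Mapping.single j 1"

definition index_set :: "nat \<Rightarrow> 'v::finite mindex set" where
  "index_set N = {\<alpha>. msize \<alpha> \<le> N}"

definition deg_le :: "'v::finite cpoly \<Rightarrow> nat \<Rightarrow> bool" where
  "deg_le p N \<longleftrightarrow> Poly_Mapping.keys p \<subseteq> index_set N"

definition monom_at :: "('v::finite \<Rightarrow> 'r::comm_monoid_mult) \<Rightarrow> 'v mindex \<Rightarrow> 'r" where
  "monom_at x \<alpha> = (\<Prod>j\<in>UNIV. x j ^ Poly_Mapping.lookup \<alpha> j)"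

text \<open>Substitute \<open>x\<close> for the variables and apply \<open>h\<close> to the coefficients.\<close>

definition subst_poly :: "(complex \<Rightarrow> 'r::comm_semiring_1) \<Rightarrow> ('v::finite \<Rightarrow> 'r) \<Rightarrow> 'v cpoly \<Rightarrow> 'r" where
  "subst_poly h x p = (\<Sum>\<alpha>\<in>Poly_Mapping.keys p. h (Poly_Mapping.lookup p \<alpha>) * monom_at x \<alpha>)"

abbreviation eval_poly :: "'v::finite cpoly \<Rightarrow> ('v \<Rightarrow> complex) \<Rightarrow> complex" where
  "eval_poly p z \<equiv> subst_poly (\<lambda>c. c) z p"


subsection \<open>Matrices and simple \<open>N\<close>-nilpotent tuples\<close>

definition vec_norm :: "complex vec \<Rightarrow> real" where
  "vec_norm v = L2_set (\<lambda>i. norm (vec_index v i)) {..<dim_vec v}"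

definition op_norm :: "complex mat \<Rightarrow> real" where
  "op_norm A = (SUP v\<in>{v \<in> carrier_vec (dim_col A). vec_norm v \<le> 1}. vec_norm (A *\<^sub>v v))"

text \<open>
  \<open>T\<^sup>\<alpha>\<close> is a product over \<open>'d\<close> in a fixed but unspecified order. It is only used for commuting
  tuples, where the order is immaterial.
\<close>

definition mat_monom :: "nat \<Rightarrow> ('d::finite \<Rightarrow> complex mat) \<Rightarrow> 'd mindex \<Rightarrow> complex mat" where
  "mat_monom n T \<alpha> =
     foldr (\<lambda>j M. (T j ^\<^sub>m Poly_Mapping.lookup \<alpha> j) * M) (SOME js. distinct js \<and> set js = UNIV) (1\<^sub>m n)"

definition mat_poly :: "nat \<Rightarrow> 'd::finite cpoly \<Rightarrow> ('d \<Rightarrow> complex mat) \<Rightarrow> complex mat" where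
  "mat_poly n p T =
     mat n n (\<lambda>ik. \<Sum>\<alpha>\<in>Poly_Mapping.keys p. Poly_Mapping.lookup p \<alpha> * (mat_monom n T \<alpha> $$ ik))"

definition simple_nilpotent :: "nat \<Rightarrow> nat \<Rightarrow> ('d::finite \<Rightarrow> complex mat) \<Rightarrow> bool" where
  "simple_nilpotent N n T \<longleftrightarrow>
     (\<forall>j. T j \<in> carrier_mat n n) \<and>
     (\<forall>i j. T i * T j = T j * T i) \<and>
     (\<exists>b :: 'd mindex \<Rightarrow> complex vec.
        b ` index_set N \<subseteq> carrier_vec n \<and>
        LinearCombinations.module.span class_ring (module_vec TYPE(complex) n) (b ` index_set N)
          = carrier_vec n \<and>
        (\<forall>j \<alpha>. msize \<alpha> < N \<longrightarrow> T j *\<^sub>v b \<alpha> = b (\<alpha> + unit_index j)) \<and>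
        (\<forall>j \<alpha>. msize \<alpha> = N \<longrightarrow> T j *\<^sub>v b \<alpha> = 0\<^sub>v n))"

definition contractions :: "('d \<Rightarrow> complex mat) \<Rightarrow> bool" where
  "contractions T \<longleftrightarrow> (\<forall>j. op_norm (T j) \<le> 1)"


subsection \<open>Positive semi-definite matrices and kernels\<close>

text \<open>
  Matrices with rows and columns indexed by a finite set \<open>I\<close>; entries outside \<open>I \<times> I\<close> play no role.
  Membership in \<open>\<real>\<^sub>\<ge>\<^sub>0\<close> includes that the form is real-valued, that is, that the matrix is Hermitian.
\<close>

definition psd_matrix :: "'i set \<Rightarrow> ('i \<Rightarrow> 'i \<Rightarrow> complex) \<Rightarrow> bool" where
  "psd_matrix I A \<longleftrightarrow> (\<forall>c. (\<Sum>x\<in>I. \<Sum>y\<in>I. cnj (c x) * A x y * c y) \<in> \<real>\<^sub>\<ge>\<^sub>0)"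

definition psd_kernel :: "'x set \<Rightarrow> ('x \<Rightarrow> 'x \<Rightarrow> complex) \<Rightarrow> bool" where
  "psd_kernel D K \<longleftrightarrow> (\<forall>F. finite F \<and> F \<subseteq> D \<longrightarrow> psd_matrix F K)"

text \<open>
  \<open>A\<^bsub>\<alpha>-e,\<beta>-e\<^esub>\<close> with \<open>e = e\<^sub>j\<close>, read as \<open>0\<close> when an index is out of bounds. Subtraction of
  multi-indices truncates, hence the test. For \<open>\<alpha>, \<beta>\<close> in \<open>index_set N\<close> the only way of leaving
  \<open>index_set N\<close> is through a zero \<open>j\<close>-th coordinate.
\<close>

definition shifted_entry ::
    "'v \<Rightarrow> ('v mindex \<Rightarrow> 'v mindex \<Rightarrow> complex) \<Rightarrow> 'v mindex \<Rightarrow> 'v mindex \<Rightarrow> complex" where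
  "shifted_entry j A \<alpha> \<beta> =
     (if Poly_Mapping.lookup \<alpha> j > 0 \<and> Poly_Mapping.lookup \<beta> j > 0
      then A (\<alpha> - unit_index j) (\<beta> - unit_index j) else 0)"


subsection \<open>The ring of polynomials in \<open>z\<close> and its formal conjugate\<close>

text \<open>
  The ring \<open>\<complex>[z\<^sub>j, zbar\<^sub>j]\<close> is \<open>('d + 'd) cpoly\<close>: the variable indexed by \<open>Inl j\<close> is \<open>z\<^sub>j\<close>, the one indexed by
  \<open>Inr j\<close> is its formal conjugate.
\<close>

definition Var :: "'v \<Rightarrow> 'v cpoly" where
  "Var v = Poly_Mapping.single (unit_index v) 1"

definition Const :: "complex \<Rightarrow> 'v cpoly" where
  "Const c = Poly_Mapping.single 0 c"

definition zvar :: "'d \<Rightarrow> ('d + 'd) cpoly" where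
  "zvar j = Var (Inl j)"

definition zbar :: "'d \<Rightarrow> ('d + 'd) cpoly" where
  "zbar j = Var (Inr j)"

definition poly_z :: "'d::finite cpoly \<Rightarrow> ('d + 'd) cpoly" where
  "poly_z q = subst_poly Const zvar q"

definition poly_conj :: "'d::finite cpoly \<Rightarrow> ('d + 'd) cpoly" where
  "poly_conj q = subst_poly (\<lambda>c. Const (cnj c)) zbar q"

text \<open>The squared norm of a vector polynomial, given as the list of its component polynomials.\<close>

definition vpoly_sq_norm :: "'d::finite cpoly list \<Rightarrow> ('d + 'd) cpoly" where
  "vpoly_sq_norm qs = (\<Sum>q\<leftarrow>qs. poly_conj q * poly_z q)"

definition trunc_ideal :: "nat \<Rightarrow> ('d::finite + 'd) cpoly set" where
  "trunc_ideal N =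
     genideal class_ring
       ({monom_at zvar \<alpha> | \<alpha>. msize \<alpha> = N + 1} \<union> {monom_at zbar \<alpha> | \<alpha>. msize \<alpha> = N + 1})"


subsection \<open>Functions on the polydisk\<close>

definition polydisk :: "('d \<Rightarrow> complex) set" where
  "polydisk = {z. \<forall>j. norm (z j) < 1}"

definition polytorus :: "('d \<Rightarrow> complex) set" where
  "polytorus = {z. \<forall>j. norm (z j) = 1}"

text \<open>
  With this definition unimodular constants are rational inner. Only the values of \<open>\<phi>\<close> on the
  polydisk matter.
\<close>

definition rational_inner :: "(('d::finite \<Rightarrow> complex) \<Rightarrow> complex) \<Rightarrow> bool" where
  "rational_inner \<phi> \<longleftrightarrow>
     (\<exists>Q R :: 'd cpoly.
        (\<forall>z\<in>polydisk. eval_poly R z \<noteq> 0 \<and> \<phi> z = eval_poly Q z / eval_poly R z) \<and>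
        (\<forall>z\<in>polytorus. norm (eval_poly R z) = norm (eval_poly Q z)))"

text \<open>
  \<open>c\<close> is the family of Taylor coefficients of \<open>f\<close> at the origin: the power series with coefficients \<open>c\<close>
  converges absolutely to \<open>f\<close> on a neighbourhood of the origin.
\<close>

definition taylor_coeffs :: "(('d::finite \<Rightarrow> complex) \<Rightarrow> complex) \<Rightarrow> ('d mindex \<Rightarrow> complex) \<Rightarrow> bool" where
  "taylor_coeffs f c \<longleftrightarrow>
     (\<exists>r>0. \<forall>z. (\<forall>j. norm (z j) < r) \<longrightarrow> ((\<lambda>\<alpha>. c \<alpha> * monom_at z \<alpha>) has_sum f z) UNIV)"

definition vanishes_to_order :: "(('d::finite \<Rightarrow> complex) \<Rightarrow> complex) \<Rightarrow> nat \<Rightarrow> bool" where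
  "vanishes_to_order f k \<longleftrightarrow> (\<exists>c. taylor_coeffs f c \<and> (\<forall>\<alpha>. msize \<alpha> < k \<longrightarrow> c \<alpha> = 0))"


subsection \<open>The four conditions\<close>

definition nilpotent_contractive :: "nat \<Rightarrow> 'd::finite cpoly \<Rightarrow> bool" where
  "nilpotent_contractive N p \<longleftrightarrow>
     (\<forall>n (T :: 'd \<Rightarrow> complex mat).
        simple_nilpotent N n T \<and> contractions T \<longrightarrow> op_norm (mat_poly n p T) \<le> 1)"

definition matrix_decomposition :: "nat \<Rightarrow> 'd::finite cpoly \<Rightarrow> bool" where
  "matrix_decomposition N p \<longleftrightarrow>
     (\<exists>A :: 'd \<Rightarrow> 'd mindex \<Rightarrow> 'd mindex \<Rightarrow> complex.
        (\<forall>j. psd_matrix (index_set N) (A j)) \<and>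
        (\<forall>\<alpha>\<in>index_set N. \<forall>\<beta>\<in>index_set N.
           (if \<alpha> = 0 \<and> \<beta> = 0 then 1 else 0) - cnj (Poly_Mapping.lookup p \<alpha>) * Poly_Mapping.lookup p \<beta>
             = (\<Sum>j\<in>UNIV. A j \<alpha> \<beta> - shifted_entry j (A j) \<alpha> \<beta>)))"

definition sos_decomposition :: "nat \<Rightarrow> 'd::finite cpoly \<Rightarrow> bool" where
  "sos_decomposition N p \<longleftrightarrow>
     (\<exists>A :: 'd \<Rightarrow> 'd cpoly list.
        (\<forall>j. \<forall>q\<in>set (A j). deg_le q N) \<and>
        (1 - poly_conj p * poly_z p)
          - (\<Sum>j\<in>UNIV. (1 - zbar j * zvar j) * vpoly_sq_norm (A j)) \<in> trunc_ideal N)"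

text \<open>
  The disjunction allows for unimodular constants, which are rational inner but do not map into the
  open disk (for \<open>p = 1\<close>, for instance, \<open>\<phi> = 1\<close> is the only possible interpolant).
\<close>

definition inner_interpolation :: "nat \<Rightarrow> 'd::finite cpoly \<Rightarrow> bool" where
  "inner_interpolation N p \<longleftrightarrow>
     (\<exists>\<phi> :: ('d \<Rightarrow> complex) \<Rightarrow> complex.
        rational_inner \<phi> \<and>
        (\<phi> ` polydisk \<subseteq> ball 0 1 \<or> (\<exists>u. norm u = 1 \<and> (\<forall>z\<in>polydisk. \<phi> z = u))) \<and>
        vanishes_to_order (\<lambda>z. eval_poly p z - \<phi> z) (N + 1) \<and>
        (\<exists>K :: 'd \<Rightarrow> ('d \<Rightarrow> complex) \<Rightarrow> ('d \<Rightarrow> complex) \<Rightarrow> complex.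
           (\<forall>j. psd_kernel polydisk (K j)) \<and>
           (\<forall>z\<in>polydisk. \<forall>w\<in>polydisk.
              1 - cnj (\<phi> w) * \<phi> z = (\<Sum>j\<in>UNIV. (1 - cnj (w j) * z j) * K j z w))))"

end

(*
  Both (1) <=> (2) and (4) => (2) rest on the cone of matrices sum_j (A^j - S_j A^j), where S_j is the shift by e_j
  in both indices and the A^j are positive semi-definite. Pairing with the weights N + 1 - |alpha| recovers the total
  trace, so the cone is closed. If the matrix in (2) is not in the cone, a separating functional G satisfies
  G >= S_j^* G for all j; perturbed to be positive definite, G is the Gram matrix of a basis b_alpha on which the
  shifts T_j b_alpha = b_(alpha + e_j) are contractions with ||p(T) b_0|| > ||b_0||. For (2) => (4), the identity
  in (2) says that two finite families of vectors have equal Gram matrices; a unitary matrix taking one to the other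
  defines a transfer function, which is rational inner, has an explicit kernel decomposition and has the prescribed
  Taylor coefficients. The kernels in (4) are not assumed to be analytic. For (4) => (2) they are sampled on a grid of
  roots of unity; their discrete Fourier coefficients solve the equation in (2) up to wrap-around terms, which decay
  exponentially as the grid is refined, and closedness of the cone gives an exact solution. Finally, (2) and (3) are
  the same equation, coefficient by coefficient, once A^j is written as a Gram matrix.
*)

theory Submission
  imports Defs
begin

unbundle no vec_syntax

text \<open>Functionals are paired with matrices bilinearly, as the sum of
  \<open>G \<alpha> \<beta> * H \<alpha> \<beta>\<close>. A rank one matrix
  \<open>cnj (c \<alpha>) * c \<beta>\<close> then returns the quadratic form of \<open>G\<close> at
  \<open>c\<close>, the shift \<open>S_j\<close> has raising of both indices as its adjoint, and the
  left side of (2) returns |b_0|^2 - |p(T) b_0|^2 when \<open>G\<close> is the Gram matrix of the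
  \<open>b \<alpha>\<close>. In (4) the kernels have no Taylor coefficients to compare, so the
  identity can only be evaluated at points. On a finite group of sample points it stays algebraic:
  positivity passes to the Fourier coefficients by congruence, and multiplication by a coordinate is
  a cyclic shift of frequencies times the radius r < 1. The resulting factor r^2 leaves a surplus 1
  - r^2 of the diagonal at each frequency, which bounds all coefficients without any regularity of
  the kernels. A weight that grows geometrically along one coordinate improves the bound to order
  r^(2L) at the last frequency \<open>L\<close>, exactly where a cyclic shift differs from a
  truncated one. The radius stays fixed while \<open>L\<close> grows, so dividing by powers of r
  costs only a constant.\<close>

abbreviation "lookup \<equiv> Poly_Mapping.lookup"
abbreviation "keys \<equiv> Poly_Mapping.keys"
abbreviation "single \<equiv> Poly_Mapping.single"

subsection \<open>Positive semi-definite matrices\<close>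

definition hform :: "'i set \<Rightarrow> ('i \<Rightarrow> 'i \<Rightarrow> complex) \<Rightarrow> ('i \<Rightarrow> complex) \<Rightarrow> complex" where
  "hform I A c = (\<Sum>x\<in>I. \<Sum>y\<in>I. cnj (c x) * A x y * c y)"

lemma psd_matrix_iff: "psd_matrix I A \<longleftrightarrow> (\<forall>c. hform I A c \<in> \<real>\<^sub>\<ge>\<^sub>0)"
  by (simp add: psd_matrix_def hform_def)

lemma nonneg_Reals_sum: "(\<And>x. x \<in> I \<Longrightarrow> f x \<in> \<real>\<^sub>\<ge>\<^sub>0) \<Longrightarrow> (\<Sum>x\<in>I. f x :: complex) \<in> \<real>\<^sub>\<ge>\<^sub>0"
  by (induction I rule: infinite_finite_induct) auto

lemma cnj_mult_self_nonneg: "cnj z * z \<in> \<real>\<^sub>\<ge>\<^sub>0"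
  by (simp add: complex_nonneg_Reals_iff)

lemma psd_matrix_cong:
  "(\<And>x y. x \<in> I \<Longrightarrow> y \<in> I \<Longrightarrow> A x y = B x y) \<Longrightarrow> psd_matrix I A \<longleftrightarrow> psd_matrix I B"
  by (simp add: psd_matrix_def)

lemma hform_two:
  assumes "finite I" "x \<in> I" "y \<in> I" "x \<noteq> y"
  shows "hform I A (\<lambda>i. if i = x then s else if i = y then t else 0)
    = cnj s * A x x * s + cnj s * A x y * t + cnj t * A y x * s + cnj t * A y y * t"
proof -
  let ?c = "\<lambda>i. if i = x then s else if i = y then t else 0"
  have "hform I A ?c = (\<Sum>a\<in>{x,y}. \<Sum>b\<in>{x,y}. cnj (?c a) * A a b * ?c b)"
    unfolding hform_def using assms
    by (intro sum.mono_neutral_cong_right) (auto intro!: sum.mono_neutral_cong_right)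
  also have "\<dots> = cnj s * A x x * s + cnj s * A x y * t + cnj t * A y x * s + cnj t * A y y * t"
    using assms by simp
  finally show ?thesis .
qed

lemma hform_single:
  assumes "finite I" "x \<in> I"
  shows "hform I A (\<lambda>i. if i = x then s else 0) = cnj s * A x x * s"
proof -
  let ?c = "\<lambda>i. if i = x then s else 0"
  have "hform I A ?c = (\<Sum>a\<in>{x}. \<Sum>b\<in>{x}. cnj (?c a) * A a b * ?c b)"
    unfolding hform_def using assms
    by (intro sum.mono_neutral_cong_right) (auto intro!: sum.mono_neutral_cong_right)
  then show ?thesis by simp
qed

lemma psd_matrix_diag:
  assumes "finite I" "psd_matrix I A" "x \<in> I"
  shows "A x x \<in> \<real>\<^sub>\<ge>\<^sub>0"
proof -
  have "hform I A (\<lambda>i. if i = x then 1 else 0) \<in> \<real>\<^sub>\<ge>\<^sub>0"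
    using assms by (simp add: psd_matrix_iff)
  then show ?thesis using assms by (simp add: hform_single)
qed

text \<open>Realness of the form at the vectors with entries (1, 1) and (1, i) at \<open>x\<close>
  and \<open>y\<close> gives, respectively, opposite imaginary parts and equal real parts.\<close>

lemma psd_matrix_hermitian:
  assumes "finite I" "psd_matrix I A" "x \<in> I" "y \<in> I"
  shows "A y x = cnj (A x y)"
proof (cases "x = y")
  case True
  then show ?thesis using psd_matrix_diag[OF assms(1-3)]
    by (auto simp: complex_nonneg_Reals_iff complex_eq_iff)
next
  case False
  have h: "hform I A (\<lambda>i. if i = x then s else if i = y then t else 0) \<in> \<real>\<^sub>\<ge>\<^sub>0" for s t
    using assms by (simp add: psd_matrix_iff)
  have d: "Im (A x x) = 0" "Im (A y y) = 0"
    using psd_matrix_diag[OF assms(1,2)] assms(3,4) by (auto simp: complex_nonneg_Reals_iff)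
  show ?thesis
    using h[of 1 1] h[of 1 \<i>] d unfolding hform_two[OF assms(1,3,4) False]
    by (auto simp: complex_nonneg_Reals_iff complex_eq_iff)
qed

text \<open>On the vector with entries \<open>- t * a\<close> at \<open>x\<close> and 1 at
  \<open>y\<close>, where \<open>a = A x y\<close>, the form is the real quadratic
  \<open>X * t^2 * n - 2 * t * n + Y\<close> with \<open>n = |a|^2\<close>. Its value at
  \<open>t = 1 / X\<close> is \<open>Y - n / X\<close>; for \<open>X = 0\<close> it is linear in
  \<open>t\<close> and stays nonnegative only if \<open>n = 0\<close>.\<close>

lemma psd_matrix_Cauchy_Schwarz:
  assumes "finite I" "psd_matrix I A" "x \<in> I" "y \<in> I"
  shows "(norm (A x y))\<^sup>2 \<le> Re (A x x) * Re (A y y)"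
proof (cases "x = y")
  case True
  then show ?thesis using psd_matrix_diag[OF assms(1-3)]
    by (auto simp: complex_nonneg_Reals_iff cmod_power2) (simp add: power2_eq_square)
next
  case False
  define a where "a = A x y"
  have yx: "A y x = cnj a" unfolding a_def using psd_matrix_hermitian[OF assms] .
  have d: "A x x = of_real (Re (A x x))" "A y y = of_real (Re (A y y))" "Re (A x x) \<ge> 0" "Re (A y y) \<ge> 0"
    using psd_matrix_diag[OF assms(1,2)] assms(3,4) by (auto simp: complex_nonneg_Reals_iff complex_eq_iff)
  define X Y where "X = Re (A x x)" and "Y = Re (A y y)"
  define n where "n = (norm a)\<^sup>2"
  have aa: "a * cnj a = of_real n" "cnj a * a = of_real n"
    using complex_norm_square[of a] by (simp_all add: n_def mult.commute)
  have h: "0 \<le> X * t\<^sup>2 * n - 2 * t * n + Y" for t :: real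
  proof -
    have "hform I A (\<lambda>i. if i = x then - of_real t * a else if i = y then 1 else 0) \<in> \<real>\<^sub>\<ge>\<^sub>0"
      using assms by (simp add: psd_matrix_iff)
    moreover have "hform I A (\<lambda>i. if i = x then - of_real t * a else if i = y then 1 else 0)
      = of_real (X * t\<^sup>2 * n - 2 * t * n + Y)"
    proof -
      have "hform I A (\<lambda>i. if i = x then - of_real t * a else if i = y then 1 else 0)
        = of_real (t^2) * of_real X * (a * cnj a) - 2 * of_real t * (a * cnj a) + of_real Y"
        unfolding hform_two[OF assms(1,3,4) False] yx a_def[symmetric] X_def Y_def d(1)[symmetric] d(2)[symmetric]
        by (simp add: algebra_simps power2_eq_square del: of_real_power)
      then show ?thesis by (simp add: aa)
    qed
    ultimately show ?thesis by (metis nonneg_Reals_of_real_iff)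
  qed
  have "n \<le> X * Y"
  proof (cases "X = 0")
    case True
    have "n = 0"
    proof (rule ccontr)
      assume "n \<noteq> 0"
      then have "n > 0" by (simp add: n_def)
      then have "0 \<le> - 2 * (Y + 1) + Y" using h[of "(Y + 1) / n"] True by simp
      then show False using d(4) Y_def by simp
    qed
    then show ?thesis using True by simp
  next
    case False
    then have "X > 0" using d X_def by simp
    then show ?thesis using h[of "1 / X"] by (simp add: field_simps power2_eq_square)
  qed
  then show ?thesis by (simp add: n_def a_def X_def Y_def)
qed

lemma hform_gram:
  assumes "finite I"
    and "\<And>x y. x \<in> I \<Longrightarrow> y \<in> I \<Longrightarrow> A x y = (\<Sum>k\<in>K. cnj (q k x) * q k y)"
  shows "hform I A c = of_real (\<Sum>k\<in>K. (norm (\<Sum>y\<in>I. q k y * c y))\<^sup>2)"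
proof -
  have "hform I A c = (\<Sum>x\<in>I. \<Sum>y\<in>I. \<Sum>k\<in>K. cnj (q k x * c x) * (q k y * c y))"
    unfolding hform_def using assms(2)
    by (intro sum.cong) (auto simp: sum_distrib_left sum_distrib_right mult_ac)
  also have "\<dots> = (\<Sum>k\<in>K. \<Sum>x\<in>I. \<Sum>y\<in>I. cnj (q k x * c x) * (q k y * c y))"
  proof -
    have "(\<Sum>x\<in>I. \<Sum>y\<in>I. \<Sum>k\<in>K. cnj (q k x * c x) * (q k y * c y))
      = (\<Sum>x\<in>I. \<Sum>k\<in>K. \<Sum>y\<in>I. cnj (q k x * c x) * (q k y * c y))"
      by (intro sum.cong refl sum.swap)
    then show ?thesis by (rule trans) (rule sum.swap)
  qed
  also have "\<dots> = (\<Sum>k\<in>K. cnj (\<Sum>y\<in>I. q k y * c y) * (\<Sum>y\<in>I. q k y * c y))"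
    by (simp only: cnj_sum sum_product)
  also have "\<dots> = of_real (\<Sum>k\<in>K. (norm (\<Sum>y\<in>I. q k y * c y))\<^sup>2)"
    by (simp only: of_real_sum complex_norm_square mult.commute)
  finally show ?thesis .
qed

lemma psd_matrix_gram:
  assumes "finite I"
    and "\<And>x y. x \<in> I \<Longrightarrow> y \<in> I \<Longrightarrow> A x y = (\<Sum>k\<in>K. cnj (q k x) * q k y)"
  shows "psd_matrix I A"
  unfolding psd_matrix_iff
proof
  fix c
  have "hform I A c = of_real (\<Sum>k\<in>K. (norm (\<Sum>y\<in>I. q k y * c y))\<^sup>2)"
    by (rule hform_gram) (use assms in auto)
  then show "hform I A c \<in> \<real>\<^sub>\<ge>\<^sub>0"
    by (simp add: sum_nonneg del: of_real_sum of_real_power)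
qed

lemma hform_insert:
  assumes "finite I" "a \<notin> I"
  shows "hform (insert a I) A c = cnj (c a) * A a a * c a + cnj (c a) * (\<Sum>y\<in>I. A a y * c y)
    + (\<Sum>x\<in>I. cnj (c x) * A x a) * c a + hform I A c"
  using assms by (simp add: hform_def sum.distrib sum_distrib_left sum_distrib_right mult_ac)

text \<open>Elimination of one row and column at a time: subtracting a rank one matrix leaves the Schur
  complement, which is again positive semi-definite.\<close>

lemma psd_matrix_factor:
  assumes "finite I" "psd_matrix I A"
  shows "\<exists>q. \<forall>x\<in>I. \<forall>y\<in>I. A x y = (\<Sum>k\<in>I. cnj (q k x) * q k y)"
  using assms
proof (induction I arbitrary: A rule: finite_induct)
  case empty
  then show ?case by simp
next
  case (insert a I)
  let ?J = "insert a I"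
  have fJ: "finite ?J" using insert by simp
  note psd = insert.prems
  define t where "t = Re (A a a)"
  have t: "A a a = of_real t" "t \<ge> 0"
    using psd_matrix_diag[OF fJ psd, of a] by (auto simp: t_def complex_nonneg_Reals_iff complex_eq_iff)
  \<comment> \<open>The pivot row, scaled so that \<open>cnj (u x) * u y\<close> reproduces row and
    column \<open>a\<close>. A zero pivot forces the whole row to vanish by Cauchy-Schwarz, and then
    \<open>u = 0\<close> serves.\<close>
  define u where "u = (\<lambda>y. if t = 0 then 0 else A a y / of_real (sqrt t))"
  have herm: "A x y = cnj (A y x)" if "x \<in> ?J" "y \<in> ?J" for x y
    using psd_matrix_hermitian[OF fJ psd that(2,1)] .
  have row0: "A a y = 0" if "t = 0" "y \<in> ?J" for y
    using psd_matrix_Cauchy_Schwarz[OF fJ psd, of a y] that t_def by simp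
  have sq: "complex_of_real (sqrt t) * complex_of_real (sqrt t) = of_real t"
    using t by (simp flip: of_real_mult)
  have ua: "A a y = cnj (u a) * u y" "A y a = cnj (u y) * u a" if "y \<in> ?J" for y
  proof -
    show *: "A a y = cnj (u a) * u y"
      using that row0 sq t by (cases "t = 0") (auto simp: u_def divide_simps)
    show "A y a = cnj (u y) * u a"
      using herm[OF that, of a] * by (simp add: mult.commute)
  qed
  define B where "B = (\<lambda>x y. A x y - cnj (u x) * u y)"
  have "psd_matrix I B"
    unfolding psd_matrix_iff
  proof
    fix c
    define s where "s = (\<Sum>y\<in>I. u y * c y)"
    \<comment> \<open>Completing the square: with \<open>u a * w = - s\<close> the terms containing
      \<open>w\<close> add up to \<open>- cnj s * s\<close>, so the form of \<open>A\<close> at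
      \<open>d\<close> equals the form of \<open>B\<close> at \<open>c\<close>.\<close>
    define w where "w = (if t = 0 then 0 else - s / u a)"
    have uw: "t \<noteq> 0 \<Longrightarrow> u a * w = - s" using t sq by (auto simp: w_def u_def)
    have u0: "t = 0 \<Longrightarrow> u a = 0" by (simp add: u_def)
    have s0: "t = 0 \<Longrightarrow> s = 0" by (simp add: u_def s_def)
    define d where "d = c(a := w)"
    have dI: "\<And>x. x \<in> I \<Longrightarrow> d x = c x" "d a = w" using insert.hyps by (auto simp: d_def)
    have cs: "(\<Sum>x\<in>I. cnj (c x) * cnj (u x)) = cnj s" by (simp add: s_def mult.commute)
    have BI: "hform I B c = hform I A c - cnj s * s"
      unfolding hform_def B_def by (simp add: algebra_simps sum_subtractf flip: sum_product cs)
         (simp add: s_def sum_product mult_ac sum_distrib_left sum_distrib_right)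
    have "hform ?J A d = cnj w * A a a * w + cnj w * (\<Sum>y\<in>I. A a y * c y)
      + (\<Sum>x\<in>I. cnj (c x) * A x a) * w + hform I A c"
      using insert.hyps dI
      by (simp add: hform_insert hform_def sum_distrib_left sum_distrib_right mult_ac add_ac)
    also have "\<dots> = cnj (u a * w) * (u a * w) + cnj (u a * w) * s + cnj s * (u a * w) + hform I A c"
      using ua by (simp add: s_def sum_distrib_left sum_distrib_right mult_ac)
    also have "\<dots> = hform I B c" using uw u0 s0 BI by (cases "t = 0") (auto simp: algebra_simps)
    finally show "hform I B c \<in> \<real>\<^sub>\<ge>\<^sub>0" using psd by (metis psd_matrix_iff)
  qed
  then obtain q where q: "\<And>x y. x \<in> I \<Longrightarrow> y \<in> I \<Longrightarrow> B x y = (\<Sum>k\<in>I. cnj (q k x) * q k y)"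
    using insert.IH by blast
  define r where "r = (\<lambda>k x. if k = a then u x else if x = a then 0 else q k x)"
  have "A x y = (\<Sum>k\<in>?J. cnj (r k x) * r k y)" if "x \<in> ?J" "y \<in> ?J" for x y
  proof -
    have "(\<Sum>k\<in>?J. cnj (r k x) * r k y) = cnj (u x) * u y + (\<Sum>k\<in>I. cnj (r k x) * r k y)"
      using insert.hyps by (simp add: r_def)
    also have "(\<Sum>k\<in>I. cnj (r k x) * r k y) = (if x = a \<or> y = a then 0 else B x y)"
    proof (cases "x = a \<or> y = a")
      case True
      then show ?thesis using insert.hyps by (auto simp: r_def intro!: sum.neutral)
    next
      case False
      then have "(\<Sum>k\<in>I. cnj (r k x) * r k y) = (\<Sum>k\<in>I. cnj (q k x) * q k y)"
        using insert.hyps by (intro sum.cong) (auto simp: r_def)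
      then show ?thesis using False that q by auto
    qed
    finally show ?thesis using ua that by (auto simp: B_def)
  qed
  then show ?case by blast
qed

subsection \<open>Multi-indices\<close>

lemma msize_add [simp]: "msize (\<alpha> + \<beta>) = msize \<alpha> + msize \<beta>"
  by (simp add: msize_def lookup_add sum.distrib)

lemma msize_zero [simp]: "msize 0 = 0"
  by (simp add: msize_def)

lemma lookup_unit_index: "lookup (unit_index j) i = (if i = j then 1 else 0)"
  by (simp add: unit_index_def lookup_single when_def)

lemma msize_unit_index [simp]: "msize (unit_index j) = 1"
  by (simp add: msize_def lookup_unit_index)

lemma lookup_le_msize: "lookup \<alpha> j \<le> msize \<alpha>"
  unfolding msize_def by (rule member_le_sum) auto

lemma msize_eq_0_iff [simp]: "msize \<alpha> = 0 \<longleftrightarrow> \<alpha> = 0"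
  by (auto simp: msize_def intro: poly_mapping_eqI)

lemma minus_unit_index_add: "lookup \<alpha> j > 0 \<Longrightarrow> \<alpha> - unit_index j + unit_index j = \<alpha>"
  by (rule poly_mapping_eqI) (auto simp: lookup_add lookup_minus lookup_unit_index)

lemma msize_minus_unit_index: "lookup \<alpha> j > 0 \<Longrightarrow> Suc (msize (\<alpha> - unit_index j)) = msize \<alpha>"
  using arg_cong[OF minus_unit_index_add, of \<alpha> j msize] by simp

lemma msize_minus_less: "lookup \<alpha> j > 0 \<Longrightarrow> msize (\<alpha> - unit_index j) < msize \<alpha>"
  using msize_minus_unit_index[of \<alpha> j] by simp

lemma finite_index_set [simp]: "finite (index_set N :: 'v::finite mindex set)"
proof (rule finite_imageD)
  have "lookup ` (index_set N :: 'v mindex set) \<subseteq> PiE UNIV (\<lambda>_. {..N})"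
    using lookup_le_msize order_trans by (fastforce simp: index_set_def PiE_iff)
  then show "finite (lookup ` (index_set N :: 'v mindex set))"
    by (rule finite_subset) (simp add: finite_PiE)
  show "inj_on lookup (index_set N :: 'v mindex set)"
    by (simp add: inj_on_def poly_mapping.lookup_inject)
qed

lemma zero_in_index_set [simp]: "0 \<in> index_set N"
  by (simp add: index_set_def)

lemma minus_unit_in_index_set:
  "\<alpha> \<in> index_set N \<Longrightarrow> lookup \<alpha> j > 0 \<Longrightarrow> \<alpha> - unit_index j \<in> index_set N"
  using msize_minus_unit_index[of \<alpha> j] by (simp add: index_set_def)

subsection \<open>The cone of defects\<close>

definition shift_defect :: "('v::finite \<Rightarrow> 'v mindex \<Rightarrow> 'v mindex \<Rightarrow> complex) \<Rightarrow> 'v mindex \<Rightarrow> 'v mindex \<Rightarrow> complex" where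
  "shift_defect A \<alpha> \<beta> = (\<Sum>j\<in>UNIV. A j \<alpha> \<beta> - shifted_entry j (A j) \<alpha> \<beta>)"

text \<open>The adjoint of \<open>shifted_entry\<close> for the bilinear pairing over
  \<open>index_set N\<close>; it is zero where a raised index would leave the index set.\<close>

definition up_entry ::
    "nat \<Rightarrow> 'v::finite \<Rightarrow> ('v mindex \<Rightarrow> 'v mindex \<Rightarrow> complex) \<Rightarrow> 'v mindex \<Rightarrow> 'v mindex \<Rightarrow> complex" where
  "up_entry N j B \<alpha> \<beta> =
     (if msize \<alpha> < N \<and> msize \<beta> < N then B (\<alpha> + unit_index j) (\<beta> + unit_index j) else 0)"

text \<open>Raising both indices is a bijection from the pairs of size below \<open>N\<close> onto
  the pairs with positive \<open>j\<close>-th coordinates; outside these sets the summands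
  vanish.\<close>

lemma sum_shifted_entry:
  fixes A B :: "'v::finite mindex \<Rightarrow> 'v mindex \<Rightarrow> complex"
  shows "(\<Sum>\<alpha>\<in>index_set N. \<Sum>\<beta>\<in>index_set N. B \<alpha> \<beta> * shifted_entry j A \<alpha> \<beta>)
    = (\<Sum>\<alpha>\<in>index_set N. \<Sum>\<beta>\<in>index_set N. up_entry N j B \<alpha> \<beta> * A \<alpha> \<beta>)"
proof -
  let ?I = "index_set N :: 'v mindex set" and ?e = "unit_index j"
  have "(\<Sum>\<alpha>\<in>?I. \<Sum>\<beta>\<in>?I. B \<alpha> \<beta> * shifted_entry j A \<alpha> \<beta>)
    = (\<Sum>(\<alpha>,\<beta>)\<in>?I \<times> ?I. B \<alpha> \<beta> * shifted_entry j A \<alpha> \<beta>)"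
    by (rule sum.cartesian_product)
  also have "\<dots> = (\<Sum>(\<alpha>,\<beta>)\<in>{(\<alpha>,\<beta>) \<in> ?I \<times> ?I. lookup \<alpha> j > 0 \<and> lookup \<beta> j > 0}.
      B \<alpha> \<beta> * A (\<alpha> - ?e) (\<beta> - ?e))"
    by (rule sum.mono_neutral_cong_right) (auto simp: shifted_entry_def split: if_splits)
  also have "\<dots> = (\<Sum>(\<alpha>,\<beta>)\<in>{(\<alpha>,\<beta>) \<in> ?I \<times> ?I. msize \<alpha> < N \<and> msize \<beta> < N}. B (\<alpha> + ?e) (\<beta> + ?e) * A \<alpha> \<beta>)"
    by (rule sum.reindex_bij_witness[where i = "\<lambda>(\<alpha>,\<beta>). (\<alpha> + ?e, \<beta> + ?e)"
          and j = "\<lambda>(\<alpha>,\<beta>). (\<alpha> - ?e, \<beta> - ?e)"])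
      (auto simp: minus_unit_index_add minus_unit_in_index_set index_set_def lookup_add lookup_unit_index
         intro: less_le_trans[OF msize_minus_less] order_trans[OF less_imp_le[OF msize_minus_less]])
  also have "\<dots> = (\<Sum>(\<alpha>,\<beta>)\<in>?I \<times> ?I. up_entry N j B \<alpha> \<beta> * A \<alpha> \<beta>)"
    by (rule sum.mono_neutral_cong_left) (auto simp: up_entry_def split: if_splits)
  also have "\<dots> = (\<Sum>\<alpha>\<in>?I. \<Sum>\<beta>\<in>?I. up_entry N j B \<alpha> \<beta> * A \<alpha> \<beta>)"
    by (rule sum.cartesian_product[symmetric])
  finally show ?thesis .
qed

text \<open>Dual form: nonnegativity of the functional \<open>B\<close> on the cone is read off from
  the matrices \<open>B - up_entry N j B\<close>, one for each \<open>j\<close>.\<close>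

lemma sum_shift_defect:
  fixes A :: "'v::finite \<Rightarrow> 'v mindex \<Rightarrow> 'v mindex \<Rightarrow> complex"
  shows "(\<Sum>\<alpha>\<in>index_set N. \<Sum>\<beta>\<in>index_set N. B \<alpha> \<beta> * shift_defect A \<alpha> \<beta>)
    = (\<Sum>j\<in>UNIV. \<Sum>\<alpha>\<in>index_set N. \<Sum>\<beta>\<in>index_set N. (B \<alpha> \<beta> - up_entry N j B \<alpha> \<beta>) * A j \<alpha> \<beta>)"
proof -
  let ?I = "index_set N :: 'v mindex set"
  have "(\<Sum>\<alpha>\<in>?I. \<Sum>\<beta>\<in>?I. B \<alpha> \<beta> * shift_defect A \<alpha> \<beta>)
    = (\<Sum>\<alpha>\<in>?I. \<Sum>\<beta>\<in>?I. \<Sum>j\<in>UNIV. B \<alpha> \<beta> * (A j \<alpha> \<beta> - shifted_entry j (A j) \<alpha> \<beta>))"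
    by (simp add: shift_defect_def sum_distrib_left)
  also have "\<dots> = (\<Sum>\<alpha>\<in>?I. \<Sum>j\<in>UNIV. \<Sum>\<beta>\<in>?I. B \<alpha> \<beta> * (A j \<alpha> \<beta> - shifted_entry j (A j) \<alpha> \<beta>))"
    by (intro sum.cong refl sum.swap)
  also have "\<dots> = (\<Sum>j\<in>UNIV. \<Sum>\<alpha>\<in>?I. \<Sum>\<beta>\<in>?I. B \<alpha> \<beta> * (A j \<alpha> \<beta> - shifted_entry j (A j) \<alpha> \<beta>))"
    by (rule sum.swap)
  also have "\<dots> = (\<Sum>j\<in>UNIV. \<Sum>\<alpha>\<in>?I. \<Sum>\<beta>\<in>?I. (B \<alpha> \<beta> - up_entry N j B \<alpha> \<beta>) * A j \<alpha> \<beta>)"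
    by (rule sum.cong) (simp_all add: algebra_simps sum_subtractf sum_shifted_entry)
  finally show ?thesis .
qed

text \<open>The weight \<open>N + 1 - |\<alpha>|\<close> drops by one under each shift, so pairing with it recovers the trace.\<close>

lemma trace_shift_defect:
  fixes A :: "'v::finite \<Rightarrow> 'v mindex \<Rightarrow> 'v mindex \<Rightarrow> complex"
  shows "(\<Sum>\<alpha>\<in>index_set N. of_nat (N + 1 - msize \<alpha>) * shift_defect A \<alpha> \<alpha>)
    = (\<Sum>j\<in>UNIV. \<Sum>\<alpha>\<in>index_set N. A j \<alpha> \<alpha>)"
proof -
  let ?I = "index_set N :: 'v mindex set"
  define B where "B = (\<lambda>\<alpha> \<beta> :: 'v mindex. if \<alpha> = \<beta> then complex_of_nat (N + 1 - msize \<alpha>) else 0)"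
  have 1: "(\<Sum>\<beta>\<in>?I. B \<alpha> \<beta> * f \<beta>) = of_nat (N + 1 - msize \<alpha>) * f \<alpha>" if "\<alpha> \<in> ?I" for \<alpha> f
    using that by (simp add: B_def if_distrib[of "\<lambda>x. x * _"] cong: if_cong)
  \<comment> \<open>The offset \<open>N + 1\<close> gives weight 1 on the top level, where
    \<open>up_entry\<close> is zero, so the difference is the identity matrix there as well.\<close>
  have 2: "B \<alpha> \<beta> - up_entry N j B \<alpha> \<beta> = (if \<alpha> = \<beta> then 1 else 0)" if "\<alpha> \<in> ?I" "\<beta> \<in> ?I" for \<alpha> \<beta> j
    using that by (auto simp: B_def up_entry_def index_set_def of_nat_diff)
  have 3: "(\<Sum>\<beta>\<in>?I. (B \<alpha> \<beta> - up_entry N j B \<alpha> \<beta>) * A j \<alpha> \<beta>) = A j \<alpha> \<alpha>" if "\<alpha> \<in> ?I" for \<alpha> j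
    using that by (simp add: 2 if_distrib[of "\<lambda>x. x * _"] cong: if_cong)
  show ?thesis using sum_shift_defect[where B = B and N = N and A = A] by (simp add: 1 3)
qed

lemma shifted_entry_linear:
  "shifted_entry j (\<lambda>\<alpha> \<beta>. A \<alpha> \<beta> + t * B \<alpha> \<beta>) \<alpha> \<beta> = shifted_entry j A \<alpha> \<beta> + t * shifted_entry j B \<alpha> \<beta>"
  by (simp add: shifted_entry_def)

lemma shift_defect_linear:
  "shift_defect (\<lambda>j \<alpha> \<beta>. A j \<alpha> \<beta> + t * B j \<alpha> \<beta>) \<alpha> \<beta> = shift_defect A \<alpha> \<beta> + t * shift_defect B \<alpha> \<beta>"
  by (simp add: shift_defect_def shifted_entry_linear sum_distrib_left sum_subtractf sum.distrib algebra_simps)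

section \<open>Compactness and closedness of the cone\<close>

lemma tendsto_shift_defect:
  fixes A :: "nat \<Rightarrow> 'v::finite \<Rightarrow> 'v mindex \<Rightarrow> 'v mindex \<Rightarrow> complex"
  assumes "\<And>j \<alpha> \<beta>. \<alpha> \<in> index_set N \<Longrightarrow> \<beta> \<in> index_set N \<Longrightarrow> (\<lambda>n. A n j \<alpha> \<beta>) \<longlonglongrightarrow> B j \<alpha> \<beta>"
    and "\<alpha> \<in> index_set N" "\<beta> \<in> index_set N"
  shows "(\<lambda>n. shift_defect (A n) \<alpha> \<beta>) \<longlonglongrightarrow> shift_defect B \<alpha> \<beta>"
  unfolding shift_defect_def shifted_entry_def using assms(2,3)
  by (intro tendsto_intros) (auto intro!: assms(1) minus_unit_in_index_set)

text \<open>Bolzano-Weierstrass in one coordinate after another, each time along a further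
  subsequence.\<close>

lemma bounded_family_subseq:
  fixes f :: "nat \<Rightarrow> 'a \<Rightarrow> complex"
  assumes "finite S" "\<And>n i. i \<in> S \<Longrightarrow> norm (f n i) \<le> R"
  shows "\<exists>r l. strict_mono (r :: nat \<Rightarrow> nat) \<and> (\<forall>i\<in>S. (\<lambda>n. f (r n) i) \<longlonglongrightarrow> l i)"
  using assms
proof (induction S rule: finite_induct)
  case empty
  then show ?case using strict_mono_id by auto
next
  case (insert a S)
  have "\<And>n i. i \<in> S \<Longrightarrow> norm (f n i) \<le> R" using insert.prems by simp
  from insert.IH[OF this]
  obtain r l where r: "strict_mono (r :: nat \<Rightarrow> nat)" "\<And>i. i \<in> S \<Longrightarrow> (\<lambda>n. f (r n) i) \<longlonglongrightarrow> l i"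
    by blast
  have "bounded (range (\<lambda>n. f (r n) a))"
    using insert.prems by (auto intro!: boundedI)
  from bounded_imp_convergent_subsequence[OF this]
  obtain m s where s: "strict_mono (s :: nat \<Rightarrow> nat)" "((\<lambda>n. f (r n) a) \<circ> s) \<longlonglongrightarrow> m" by blast
  have "(\<lambda>n. f ((r \<circ> s) n) i) \<longlonglongrightarrow> (l(a := m)) i" if "i \<in> insert a S" for i
  proof (cases "i = a")
    case True
    then show ?thesis using s by (simp add: o_def)
  next
    case False
    then have "((\<lambda>n. f (r n) i) \<circ> s) \<longlonglongrightarrow> l i"
      using that r s by (intro LIMSEQ_subseq_LIMSEQ) auto
    then show ?thesis using False by (simp add: o_def)
  qed
  then show ?case using strict_mono_o[OF r(1) s(1)] by blast
qed

lemma psd_matrix_limit: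
  assumes "\<And>x y. x \<in> I \<Longrightarrow> y \<in> I \<Longrightarrow> (\<lambda>n. A n x y) \<longlonglongrightarrow> B x y" "\<And>n. psd_matrix I (A n)"
  shows "psd_matrix I B"
  unfolding psd_matrix_iff
proof
  fix c
  have "(\<lambda>n. hform I (A n) c) \<longlonglongrightarrow> hform I B c"
    unfolding hform_def using assms(1) by (intro tendsto_intros) auto
  then show "hform I B c \<in> \<real>\<^sub>\<ge>\<^sub>0"
    using assms(2) closed_sequentially[OF closed_nonneg_Reals_complex, of "\<lambda>n. hform I (A n) c"]
    by (auto simp: psd_matrix_iff)
qed

text \<open>Only the diagonal of the defect has to be bounded: the weighted trace then bounds every
  diagonal entry of every \<open>A n j\<close>, since these are nonnegative, and Cauchy-Schwarz
  bounds the remaining entries.\<close>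

lemma psd_family_subseq:
  fixes A :: "nat \<Rightarrow> 'v::finite \<Rightarrow> 'v mindex \<Rightarrow> 'v mindex \<Rightarrow> complex"
  assumes psd: "\<And>n j. psd_matrix (index_set N) (A n j)"
    and bdd: "\<And>n \<alpha>. \<alpha> \<in> index_set N \<Longrightarrow> norm (shift_defect (A n) \<alpha> \<alpha>) \<le> R"
  shows "\<exists>r B. strict_mono (r :: nat \<Rightarrow> nat) \<and> (\<forall>j. psd_matrix (index_set N) (B j)) \<and>
    (\<forall>j. \<forall>\<alpha>\<in>index_set N. \<forall>\<beta>\<in>index_set N. (\<lambda>n. A (r n) j \<alpha> \<beta>) \<longlonglongrightarrow> B j \<alpha> \<beta>)"
proof -
  let ?I = "index_set N :: 'v mindex set"
  define C where "C = (\<Sum>\<alpha>\<in>?I. real (N + 1 - msize \<alpha>) * R)"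
  have diag: "0 \<le> Re (A n j \<alpha> \<alpha>)" if "\<alpha> \<in> ?I" for n j \<alpha>
    using psd_matrix_diag[OF finite_index_set psd that] by (simp add: complex_nonneg_Reals_iff)
  have diagC: "Re (A n j \<alpha> \<alpha>) \<le> C" if "\<alpha> \<in> ?I" for n j \<alpha>
  proof -
    have "Re (A n j \<alpha> \<alpha>) \<le> (\<Sum>\<alpha>\<in>?I. Re (A n j \<alpha> \<alpha>))"
      using that diag by (intro member_le_sum) auto
    also have "\<dots> \<le> (\<Sum>j\<in>UNIV. \<Sum>\<alpha>\<in>?I. Re (A n j \<alpha> \<alpha>))"
      using diag by (intro member_le_sum[of j UNIV "\<lambda>j. \<Sum>\<alpha>\<in>?I. Re (A n j \<alpha> \<alpha>)"] sum_nonneg) auto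
    also have "\<dots> = Re (\<Sum>\<alpha>\<in>?I. of_nat (N + 1 - msize \<alpha>) * shift_defect (A n) \<alpha> \<alpha>)"
      unfolding trace_shift_defect by simp
    also have "\<dots> \<le> norm (\<Sum>\<alpha>\<in>?I. of_nat (N + 1 - msize \<alpha>) * shift_defect (A n) \<alpha> \<alpha>)"
      by (rule complex_Re_le_cmod)
    also have "\<dots> \<le> C"
      unfolding C_def using bdd by (intro sum_norm_le) (simp add: norm_mult mult_left_mono del: of_nat_diff)
    finally show ?thesis .
  qed
  have entry: "norm (A n j \<alpha> \<beta>) \<le> \<bar>C\<bar>" if "\<alpha> \<in> ?I" "\<beta> \<in> ?I" for n j \<alpha> \<beta>
  proof -
    have "(norm (A n j \<alpha> \<beta>))\<^sup>2 \<le> Re (A n j \<alpha> \<alpha>) * Re (A n j \<beta> \<beta>)"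
      by (rule psd_matrix_Cauchy_Schwarz[OF finite_index_set psd that])
    also have "\<dots> \<le> C * C"
      using that diag diagC order_trans[OF diag[OF that(1)] diagC[OF that(1)]] by (intro mult_mono) simp_all
    finally have "\<bar>norm (A n j \<alpha> \<beta>)\<bar> \<le> \<bar>C\<bar>"
      by (simp only: abs_le_square_iff power2_eq_square)
    then show ?thesis by simp
  qed
  have "\<exists>r l. strict_mono (r :: nat \<Rightarrow> nat) \<and>
      (\<forall>i\<in>UNIV \<times> ?I \<times> ?I. (\<lambda>n. (\<lambda>(j,\<alpha>,\<beta>). A (r n) j \<alpha> \<beta>) i) \<longlonglongrightarrow> l i)"
    by (rule bounded_family_subseq[where R = "\<bar>C\<bar>"]) (auto simp: entry)
  then obtain r l where r: "strict_mono (r :: nat \<Rightarrow> nat)"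
    "\<And>i. i \<in> UNIV \<times> ?I \<times> ?I \<Longrightarrow> (\<lambda>n. (\<lambda>(j,\<alpha>,\<beta>). A (r n) j \<alpha> \<beta>) i) \<longlonglongrightarrow> l i" by blast
  define B where "B = (\<lambda>j \<alpha> \<beta>. l (j,\<alpha>,\<beta>))"
  have lim: "(\<lambda>n. A (r n) j \<alpha> \<beta>) \<longlonglongrightarrow> B j \<alpha> \<beta>" if "\<alpha> \<in> ?I" "\<beta> \<in> ?I" for j \<alpha> \<beta>
    using r(2)[of "(j,\<alpha>,\<beta>)"] that by (simp add: B_def)
  moreover have "psd_matrix ?I (B j)" for j
    by (rule psd_matrix_limit[of _ "\<lambda>n. A (r n) j"]) (auto simp: lim psd)
  ultimately show ?thesis using r(1) by blast
qed

text \<open>The convergent diagonal entries are bounded, so a subsequence of the \<open>A n\<close>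
  themselves converges, and its limit is a preimage of \<open>H\<close> by continuity.\<close>

lemma shift_defect_closed:
  fixes A :: "nat \<Rightarrow> 'v::finite \<Rightarrow> 'v mindex \<Rightarrow> 'v mindex \<Rightarrow> complex"
  assumes psd: "\<And>n j. psd_matrix (index_set N) (A n j)"
    and lim: "\<And>\<alpha> \<beta>. \<alpha> \<in> index_set N \<Longrightarrow> \<beta> \<in> index_set N \<Longrightarrow> (\<lambda>n. shift_defect (A n) \<alpha> \<beta>) \<longlonglongrightarrow> H \<alpha> \<beta>"
  shows "\<exists>B. (\<forall>j. psd_matrix (index_set N) (B j)) \<and>
    (\<forall>\<alpha>\<in>index_set N. \<forall>\<beta>\<in>index_set N. H \<alpha> \<beta> = shift_defect B \<alpha> \<beta>)"
proof -
  let ?I = "index_set N :: 'v mindex set"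
  have "\<exists>K. \<forall>n. norm (shift_defect (A n) \<alpha> \<alpha>) \<le> K" if "\<alpha> \<in> ?I" for \<alpha>
    using convergent_imp_Bseq[OF convergentI[OF lim[OF that that]]] by (auto simp: Bseq_def)
  then obtain K where K: "\<And>n \<alpha>. \<alpha> \<in> ?I \<Longrightarrow> norm (shift_defect (A n) \<alpha> \<alpha>) \<le> K \<alpha>" by metis
  have "norm (shift_defect (A n) \<alpha> \<alpha>) \<le> (\<Sum>\<alpha>\<in>?I. \<bar>K \<alpha>\<bar>)" if "\<alpha> \<in> ?I" for n \<alpha>
    using K[OF that, of n] member_le_sum[of \<alpha> ?I "\<lambda>\<alpha>. \<bar>K \<alpha>\<bar>"] that by force
  from psd_family_subseq[where A = A and N = N, OF psd this] obtain r B where rB: "strict_mono (r :: nat \<Rightarrow> nat)" "\<And>j. psd_matrix ?I (B j)"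
    "\<And>j \<alpha> \<beta>. \<alpha> \<in> ?I \<Longrightarrow> \<beta> \<in> ?I \<Longrightarrow> (\<lambda>n. A (r n) j \<alpha> \<beta>) \<longlonglongrightarrow> B j \<alpha> \<beta>"
    by blast
  have "H \<alpha> \<beta> = shift_defect B \<alpha> \<beta>" if "\<alpha> \<in> ?I" "\<beta> \<in> ?I" for \<alpha> \<beta>
  proof (rule LIMSEQ_unique)
    show "(\<lambda>n. shift_defect (A (r n)) \<alpha> \<beta>) \<longlonglongrightarrow> H \<alpha> \<beta>"
      using LIMSEQ_subseq_LIMSEQ[OF lim[OF that] rB(1)] by (simp add: o_def)
    show "(\<lambda>n. shift_defect (A (r n)) \<alpha> \<beta>) \<longlonglongrightarrow> shift_defect B \<alpha> \<beta>"
      by (rule tendsto_shift_defect[OF rB(3)]) (use that in auto)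
  qed
  then show ?thesis using rB(2) by blast
qed

section \<open>Separation of a point from the cone\<close>

lemma psd_matrix_add_scaled:
  assumes "psd_matrix I A" "psd_matrix I B" "t \<in> \<real>\<^sub>\<ge>\<^sub>0"
  shows "psd_matrix I (\<lambda>x y. A x y + t * B x y)"
proof -
  have "hform I (\<lambda>x y. A x y + t * B x y) c = hform I A c + t * hform I B c" for c
    by (simp add: hform_def sum.distrib sum_distrib_left algebra_simps)
  then show ?thesis using assms by (simp add: psd_matrix_iff)
qed

text \<open>The cone is unbounded, but along a minimizing sequence the distance to \<open>H\<close>
  is at most \<open>sqrt (m + 1)\<close>. This bounds the diagonal of the defects, hence the
  matrices themselves, and a subsequence converges to a minimizer.\<close>

lemma shift_defect_minimizer:
  fixes H :: "'v::finite mindex \<Rightarrow> 'v mindex \<Rightarrow> complex"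
  shows "\<exists>B. (\<forall>j. psd_matrix (index_set N) (B j)) \<and>
    (\<forall>A. (\<forall>j. psd_matrix (index_set N) (A j)) \<longrightarrow>
      (\<Sum>\<alpha>\<in>index_set N. \<Sum>\<beta>\<in>index_set N. (norm (H \<alpha> \<beta> - shift_defect B \<alpha> \<beta>))\<^sup>2)
      \<le> (\<Sum>\<alpha>\<in>index_set N. \<Sum>\<beta>\<in>index_set N. (norm (H \<alpha> \<beta> - shift_defect A \<alpha> \<beta>))\<^sup>2))"
proof -
  let ?I = "index_set N :: 'v mindex set"
  define psd where "psd = (\<lambda>A :: 'v \<Rightarrow> 'v mindex \<Rightarrow> 'v mindex \<Rightarrow> complex. \<forall>j. psd_matrix ?I (A j))"
  define f where "f = (\<lambda>A. \<Sum>\<alpha>\<in>?I. \<Sum>\<beta>\<in>?I. (norm (H \<alpha> \<beta> - shift_defect A \<alpha> \<beta>))\<^sup>2)"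
  define m where "m = (INF A\<in>Collect psd. f A)"
  have ne: "f ` Collect psd \<noteq> {}"
  proof -
    have "psd (\<lambda>_ _ _. 0)" by (simp add: psd_def psd_matrix_def)
    then show ?thesis by blast
  qed
  have f0: "0 \<le> f A" for A unfolding f_def by (intro sum_nonneg) simp
  have m_le: "m \<le> f A" if "psd A" for A
    unfolding m_def using that f0 by (intro cINF_lower) (auto intro!: bdd_belowI[of _ 0])
  have "\<exists>A. psd A \<and> f A < m + 1 / real (Suc n)" for n
    using cInf_lessD[OF ne, of "m + 1 / real (Suc n)"] by (auto simp: m_def)
  then obtain A where A: "\<And>n. psd (A n)" "\<And>n. f (A n) < m + 1 / real (Suc n)" by metis
  have bdd: "norm (shift_defect (A n) \<alpha> \<alpha>) \<le> sqrt (m + 1) + (\<Sum>\<alpha>\<in>?I. norm (H \<alpha> \<alpha>))"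
    if \<alpha>: "\<alpha> \<in> ?I" for n \<alpha>
  proof -
    have "(norm (H \<alpha> \<alpha> - shift_defect (A n) \<alpha> \<alpha>))\<^sup>2
        \<le> (\<Sum>\<beta>\<in>?I. (norm (H \<alpha> \<beta> - shift_defect (A n) \<alpha> \<beta>))\<^sup>2)"
      using \<alpha> by (intro member_le_sum[of \<alpha> ?I "\<lambda>\<beta>. (norm (H \<alpha> \<beta> - shift_defect (A n) \<alpha> \<beta>))\<^sup>2"]) auto
    also have "\<dots> \<le> f (A n)"
      unfolding f_def using \<alpha>
      by (intro member_le_sum[of \<alpha> ?I "\<lambda>\<alpha>. \<Sum>\<beta>\<in>?I. (norm (H \<alpha> \<beta> - shift_defect (A n) \<alpha> \<beta>))\<^sup>2"] sum_nonneg) auto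
    also have "f (A n) \<le> m + 1" using A(2)[of n] by (smt (verit) divide_le_eq_1_pos of_nat_0_less_iff of_nat_1 of_nat_le_iff le_simps(2) zero_less_Suc Suc_le_mono le0 One_nat_def)
    finally have "norm (H \<alpha> \<alpha> - shift_defect (A n) \<alpha> \<alpha>) \<le> sqrt (m + 1)"
      by (rule real_le_rsqrt)
    moreover have "norm (H \<alpha> \<alpha>) \<le> (\<Sum>\<alpha>\<in>?I. norm (H \<alpha> \<alpha>))"
      using \<alpha> by (intro member_le_sum[of \<alpha> ?I "\<lambda>\<alpha>. norm (H \<alpha> \<alpha>)"]) auto
    moreover have "norm (shift_defect (A n) \<alpha> \<alpha>) \<le> norm (H \<alpha> \<alpha>) + norm (H \<alpha> \<alpha> - shift_defect (A n) \<alpha> \<alpha>)"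
      by (metis norm_triangle_sub norm_minus_commute add.commute)
    ultimately show ?thesis by linarith
  qed
  have "\<And>n j. psd_matrix ?I (A n j)" using A(1) by (simp add: psd_def)
  from psd_family_subseq[where A = A and N = N, OF this bdd] obtain r B where rB: "strict_mono (r :: nat \<Rightarrow> nat)"
    "\<And>j. psd_matrix ?I (B j)"
    "\<And>j \<alpha> \<beta>. \<alpha> \<in> ?I \<Longrightarrow> \<beta> \<in> ?I \<Longrightarrow> (\<lambda>n. A (r n) j \<alpha> \<beta>) \<longlonglongrightarrow> B j \<alpha> \<beta>"
    by blast
  have "(\<lambda>n. f (A (r n))) \<longlonglongrightarrow> f B"
    unfolding f_def using tendsto_shift_defect[OF rB(3)]
    by (intro tendsto_intros)
  moreover have "(\<lambda>n. m + 1 / real (Suc (r n))) \<longlonglongrightarrow> m + 0"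
    using LIMSEQ_subseq_LIMSEQ[OF LIMSEQ_inverse_real_of_nat rB(1)]
    by (intro tendsto_intros) (simp add: o_def inverse_eq_divide)
  ultimately have "f B \<le> m + 0"
    by (rule LIMSEQ_le) (use A(2) less_imp_le in blast)
  then have "\<forall>A. psd A \<longrightarrow> f B \<le> f A" using m_le by force
  then show ?thesis using rB(2) unfolding psd_def f_def by blast
qed

lemma hform_rank_one:
  "(\<Sum>x\<in>I. \<Sum>y\<in>I. A x y * (cnj (c x) * c y)) = hform I A c"
  by (simp add: hform_def mult_ac)

lemma psd_matrix_rank_one: "psd_matrix I (\<lambda>x y. cnj (c x) * c y)"
proof -
  have "hform I (\<lambda>x y. cnj (c x) * c y) d = cnj (\<Sum>x\<in>I. c x * d x) * (\<Sum>x\<in>I. c x * d x)" for d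
    by (simp only: hform_def cnj_sum sum_product) (simp add: mult_ac)
  then show ?thesis by (simp only: psd_matrix_iff cnj_mult_self_nonneg) simp
qed

lemma cnj_hform:
  assumes "\<And>x y. x \<in> I \<Longrightarrow> y \<in> I \<Longrightarrow> A y x = cnj (A x y)"
  shows "cnj (hform I A c) = hform I A c"
proof -
  have "cnj (hform I A c) = (\<Sum>x\<in>I. \<Sum>y\<in>I. cnj (c y) * A y x * c x)"
    unfolding hform_def cnj_sum
  proof (intro sum.cong refl)
    fix x y assume "x \<in> I" "y \<in> I"
    then show "cnj (cnj (c x) * A x y * c y) = cnj (c y) * A y x * c x"
      using assms[of x y] by (simp add: mult_ac)
  qed
  also have "\<dots> = hform I A c" unfolding hform_def by (rule sum.swap)
  finally show ?thesis .
qed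

text \<open>The one-sided first-order condition at a minimum. The parameter is confined to
  \<open>t \<le> 1\<close> because subtracting \<open>t\<close> times a positive semi-definite
  matrix from itself keeps it in the cone only in that range.\<close>

lemma quadratic_nonneg_imp:
  fixes a b :: real
  assumes "\<And>t. 0 < t \<Longrightarrow> t \<le> 1 \<Longrightarrow> 0 \<le> a * t + b * t\<^sup>2"
  shows "0 \<le> a"
proof (rule ccontr)
  assume "\<not> 0 \<le> a"
  then have a: "a < 0" by simp
  \<comment> \<open>Small enough for \<open>b * t \<le> - a / 2\<close>, so that the linear term
    wins; \<open>\<bar>b\<bar> + 1\<close> avoids division by zero.\<close>
  define t where "t = min 1 (- a / (2 * (\<bar>b\<bar> + 1)))"
  have t: "0 < t" "t \<le> 1" using a by (auto simp: t_def intro!: divide_neg_pos)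
  have "b * t \<le> (\<bar>b\<bar> + 1) * t" using t by (intro mult_right_mono) auto
  also have "\<dots> \<le> (\<bar>b\<bar> + 1) * (- a / (2 * (\<bar>b\<bar> + 1)))"
    by (intro mult_left_mono) (auto simp: t_def)
  also have "\<dots> = - a / 2"
  proof -
    have "\<bar>b\<bar> + 1 \<noteq> 0" by linarith
    then show ?thesis by (simp add: field_simps)
  qed
  finally have "a + b * t < 0" using a by linarith
  then have "(a + b * t) * t < 0" using t by (simp add: mult_neg_pos)
  then show False using assms[OF t] by (simp add: algebra_simps power2_eq_square)
qed

text \<open>Nearest point separation: the residual at a minimizer is a functional that is nonnegative on the cone and
  negative at \<open>H\<close>.\<close>

lemma shift_defect_separation:
  fixes H :: "'v::finite mindex \<Rightarrow> 'v mindex \<Rightarrow> complex"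
  assumes herm: "\<And>\<alpha> \<beta>. \<alpha> \<in> index_set N \<Longrightarrow> \<beta> \<in> index_set N \<Longrightarrow> H \<beta> \<alpha> = cnj (H \<alpha> \<beta>)"
    and notin: "\<not> (\<exists>A. (\<forall>j. psd_matrix (index_set N) (A j)) \<and>
      (\<forall>\<alpha>\<in>index_set N. \<forall>\<beta>\<in>index_set N. H \<alpha> \<beta> = shift_defect A \<alpha> \<beta>))"
  shows "\<exists>G. (\<forall>j. psd_matrix (index_set N) (\<lambda>\<alpha> \<beta>. G \<alpha> \<beta> - up_entry N j G \<alpha> \<beta>)) \<and>
    Re (\<Sum>\<alpha>\<in>index_set N. \<Sum>\<beta>\<in>index_set N. G \<alpha> \<beta> * H \<alpha> \<beta>) < 0"
proof -
  let ?I = "index_set N :: 'v mindex set"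
  define psd where "psd = (\<lambda>A :: 'v \<Rightarrow> 'v mindex \<Rightarrow> 'v mindex \<Rightarrow> complex. \<forall>j. psd_matrix ?I (A j))"
  define f where "f = (\<lambda>A. \<Sum>\<alpha>\<in>?I. \<Sum>\<beta>\<in>?I. (norm (H \<alpha> \<beta> - shift_defect A \<alpha> \<beta>))\<^sup>2)"
  obtain B where B: "psd B" "\<And>A. psd A \<Longrightarrow> f B \<le> f A"
    using shift_defect_minimizer[of N H] unfolding psd_def f_def by blast
  define D where "D = (\<lambda>\<alpha> \<beta>. H \<alpha> \<beta> - shift_defect B \<alpha> \<beta>)"
  \<comment> \<open>The conjugate turns the real inner product with the residual \<open>D\<close>
    into the real part of the bilinear pairing. The sign makes the derivative of \<open>f\<close> at
    the minimizer, in a direction \<open>A\<close> of the cone, equal to twice the pairing with the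
    defect of \<open>A\<close>.\<close>
  define G where "G = (\<lambda>\<alpha> \<beta>. - cnj (D \<alpha> \<beta>))"
  define pair where "pair = (\<lambda>Y. Re (\<Sum>\<alpha>\<in>?I. \<Sum>\<beta>\<in>?I. G \<alpha> \<beta> * Y \<alpha> \<beta>))"
  have expand: "f (\<lambda>j \<alpha> \<beta>. B j \<alpha> \<beta> + of_real t * A j \<alpha> \<beta>)
      = f B + (2 * pair (shift_defect A)) * t + (\<Sum>\<alpha>\<in>?I. \<Sum>\<beta>\<in>?I. (norm (shift_defect A \<alpha> \<beta>))\<^sup>2) * t\<^sup>2" for A t
  proof -
    have "(norm (x - of_real t * y))\<^sup>2 = (norm x)\<^sup>2 + 2 * Re (- cnj x * y) * t + (norm y)\<^sup>2 * t\<^sup>2" for x y :: complex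
      unfolding cmod_power2 by (simp add: power2_eq_square algebra_simps)
    from this[of "D _ _" "shift_defect A _ _"] have "(norm (H \<alpha> \<beta> - shift_defect (\<lambda>j \<alpha> \<beta>. B j \<alpha> \<beta> + of_real t * A j \<alpha> \<beta>) \<alpha> \<beta>))\<^sup>2
      = (norm (H \<alpha> \<beta> - shift_defect B \<alpha> \<beta>))\<^sup>2 + 2 * Re (G \<alpha> \<beta> * shift_defect A \<alpha> \<beta>) * t
        + (norm (shift_defect A \<alpha> \<beta>))\<^sup>2 * t\<^sup>2" for \<alpha> \<beta>
      by (simp only: shift_defect_linear D_def G_def diff_diff_add)
    then show ?thesis
      unfolding f_def pair_def by (simp add: sum.distrib sum_distrib_left sum_distrib_right del: times_complex.simps)
  qed
  have pos: "0 \<le> pair (shift_defect A)" if "psd A" for A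
  proof -
    have "0 \<le> (2 * pair (shift_defect A)) * t + (\<Sum>\<alpha>\<in>?I. \<Sum>\<beta>\<in>?I. (norm (shift_defect A \<alpha> \<beta>))\<^sup>2) * t\<^sup>2" if "0 < t" for t
    proof -
      have "psd (\<lambda>j \<alpha> \<beta>. B j \<alpha> \<beta> + of_real t * A j \<alpha> \<beta>)"
        using B(1) \<open>psd A\<close> \<open>0 < t\<close> by (auto simp: psd_def intro!: psd_matrix_add_scaled)
      from B(2)[OF this] show ?thesis unfolding expand by simp
    qed
    then have "0 \<le> 2 * pair (shift_defect A)" by (rule quadratic_nonneg_imp)
    then show ?thesis by simp
  qed
  \<comment> \<open>Moving from \<open>B\<close> towards 0 also stays in the cone. Together with
    \<open>pos\<close> for \<open>B\<close> itself, the residual is orthogonal to the defect of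
    \<open>B\<close>, which leaves \<open>pair H = - f B\<close>.\<close>
  have "0 \<le> - 2 * pair (shift_defect B)"
  proof (rule quadratic_nonneg_imp)
    fix t :: real assume t: "0 < t" "t \<le> 1"
    have "psd (\<lambda>j \<alpha> \<beta>. B j \<alpha> \<beta> + of_real (- t) * B j \<alpha> \<beta>)"
    proof -
      have "psd (\<lambda>j \<alpha> \<beta>. 0 + of_real (1 - t) * B j \<alpha> \<beta>)"
        unfolding psd_def
      proof
        fix j
        show "psd_matrix ?I (\<lambda>\<alpha> \<beta>. 0 + of_real (1 - t) * B j \<alpha> \<beta>)"
        proof (rule psd_matrix_add_scaled)
          show "complex_of_real (1 - t) \<in> \<real>\<^sub>\<ge>\<^sub>0" using t by (simp only: nonneg_Reals_of_real_iff)
        qed (use B(1) in \<open>simp_all add: psd_def psd_matrix_def\<close>)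
      qed
      then show ?thesis by (simp add: algebra_simps)
    qed
    from B(2)[OF this] show "0 \<le> - 2 * pair (shift_defect B) * t
        + (\<Sum>\<alpha>\<in>?I. \<Sum>\<beta>\<in>?I. (norm (shift_defect B \<alpha> \<beta>))\<^sup>2) * t\<^sup>2"
      unfolding expand by simp
  qed
  with pos[OF B(1)] have orth: "pair (shift_defect B) = 0" by simp
  have "pair H = pair (\<lambda>\<alpha> \<beta>. D \<alpha> \<beta> + shift_defect B \<alpha> \<beta>)" by (simp add: D_def)
  also have "\<dots> = pair D + pair (shift_defect B)"
    by (simp add: pair_def algebra_simps sum.distrib del: Re_sum)
  also have "\<dots> = - f B"
  proof -
    have "f B = (\<Sum>\<alpha>\<in>?I. \<Sum>\<beta>\<in>?I. (norm (D \<alpha> \<beta>))\<^sup>2)" by (simp add: f_def D_def)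
    then show ?thesis
      unfolding cmod_power2 by (simp add: orth) (simp add: pair_def G_def power2_eq_square sum_negf sum.distrib sum_subtractf)
  qed
  finally have pairH: "pair H = - f B" .
  have "f B > 0"
  proof (rule ccontr)
    assume "\<not> f B > 0"
    moreover have "f B \<ge> 0" unfolding f_def by (intro sum_nonneg) simp
    ultimately have "f B = 0" by simp
    then have "\<forall>\<alpha>\<in>?I. \<forall>\<beta>\<in>?I. H \<alpha> \<beta> = shift_defect B \<alpha> \<beta>"
      by (simp add: f_def sum_nonneg_eq_0_iff sum_nonneg)
    then show False using notin B(1) by (auto simp: psd_def)
  qed
  with pairH have neg: "pair H < 0" by simp
  have hermB: "B j \<beta> \<alpha> = cnj (B j \<alpha> \<beta>)" if "\<alpha> \<in> ?I" "\<beta> \<in> ?I" for j \<alpha> \<beta>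
    by (rule psd_matrix_hermitian[OF finite_index_set _ that]) (use B(1) in \<open>simp add: psd_def\<close>)
  have hermG: "G \<beta> \<alpha> = cnj (G \<alpha> \<beta>)" if "\<alpha> \<in> ?I" "\<beta> \<in> ?I" for \<alpha> \<beta>
  proof -
    have "shifted_entry j (B j) \<beta> \<alpha> = cnj (shifted_entry j (B j) \<alpha> \<beta>)" for j
      using that by (auto simp: shifted_entry_def intro!: hermB minus_unit_in_index_set)
    then have "shift_defect B \<beta> \<alpha> = cnj (shift_defect B \<alpha> \<beta>)"
      by (simp add: shift_defect_def hermB[OF that])
    then show ?thesis using herm[OF that] by (simp add: G_def D_def)
  qed
  have "psd_matrix ?I (\<lambda>\<alpha> \<beta>. G \<alpha> \<beta> - up_entry N j G \<alpha> \<beta>)" for j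
    unfolding psd_matrix_iff
  proof
    fix c :: "'v mindex \<Rightarrow> complex"
    let ?W = "\<lambda>\<alpha> \<beta>. G \<alpha> \<beta> - up_entry N j G \<alpha> \<beta>"
    have "?W \<beta> \<alpha> = cnj (?W \<alpha> \<beta>)" if "\<alpha> \<in> ?I" "\<beta> \<in> ?I" for \<alpha> \<beta>
    proof -
      have "up_entry N j G \<beta> \<alpha> = cnj (up_entry N j G \<alpha> \<beta>)"
        by (auto simp: up_entry_def index_set_def intro!: hermG)
      then show ?thesis using hermG[OF that] by simp
    qed
    then have real: "cnj (hform ?I ?W c) = hform ?I ?W c" by (rule cnj_hform)
    \<comment> \<open>A rank one matrix in slot \<open>j\<close> and zero in the other slots: the
      functional evaluated there is the form of the \<open>j\<close>-th dual matrix at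
      \<open>c\<close>.\<close>
    define A where "A = (\<lambda>i \<alpha> \<beta>. if i = j then cnj (c \<alpha>) * c \<beta> else 0)"
    have "psd A" unfolding psd_def
    proof
      fix i
      show "psd_matrix ?I (A i)"
        using psd_matrix_rank_one[of ?I c] by (cases "i = j") (simp_all add: A_def psd_matrix_def)
    qed
    then have "0 \<le> pair (shift_defect A)" by (rule pos)
    also have "pair (shift_defect A) = Re (hform ?I ?W c)"
    proof -
      have "(\<Sum>\<alpha>\<in>?I. \<Sum>\<beta>\<in>?I. (G \<alpha> \<beta> - up_entry N i G \<alpha> \<beta>) * A i \<alpha> \<beta>) = (if i = j then hform ?I ?W c else 0)" for i
        by (simp add: A_def hform_rank_one)
      then show ?thesis unfolding pair_def sum_shift_defect by simp
    qed
    finally show "hform ?I ?W c \<in> \<real>\<^sub>\<ge>\<^sub>0"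
      using real by (simp add: complex_nonneg_Reals_iff complex_eq_iff)
  qed
  then show ?thesis using neg unfolding pair_def by blast
qed

text \<open>\<open>up_entry N j G\<close> is the form of \<open>G\<close> pulled back by the
  truncated shift. Positivity of \<open>G - up_entry N j G\<close> therefore says that this shift
  does not increase lengths measured by \<open>G\<close>.\<close>

lemma hform_up_entry:
  fixes G :: "'v::finite mindex \<Rightarrow> 'v mindex \<Rightarrow> complex"
  shows "hform (index_set N) (up_entry N j G) c
    = hform (index_set N) G (\<lambda>\<alpha>. if lookup \<alpha> j > 0 then c (\<alpha> - unit_index j) else 0)"
proof -
  let ?c = "\<lambda>\<alpha>. if lookup \<alpha> j > 0 then c (\<alpha> - unit_index j) else 0"
  have "hform (index_set N) (up_entry N j G) c
    = (\<Sum>\<alpha>\<in>index_set N. \<Sum>\<beta>\<in>index_set N. up_entry N j G \<alpha> \<beta> * (cnj (c \<alpha>) * c \<beta>))"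
    by (rule hform_rank_one[symmetric])
  also have "\<dots> = (\<Sum>\<alpha>\<in>index_set N. \<Sum>\<beta>\<in>index_set N. G \<alpha> \<beta> * shifted_entry j (\<lambda>\<alpha> \<beta>. cnj (c \<alpha>) * c \<beta>) \<alpha> \<beta>)"
    by (rule sum_shifted_entry[symmetric])
  also have "\<dots> = (\<Sum>\<alpha>\<in>index_set N. \<Sum>\<beta>\<in>index_set N. G \<alpha> \<beta> * (cnj (?c \<alpha>) * ?c \<beta>))"
    by (intro sum.cong refl) (auto simp: shifted_entry_def)
  finally show ?thesis by (simp only: hform_rank_one)
qed

text \<open>The form at \<open>c\<close> is at least the form at the shifted \<open>c\<close>, and a
  shift moves the support up by one level. Hence the induction on the number \<open>k\<close> of top
  levels on which \<open>c\<close> may be nonzero; after \<open>N + 1\<close> shifts nothing is left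
  inside the index set.\<close>

lemma psd_matrix_of_up_entry:
  fixes G :: "'v::finite mindex \<Rightarrow> 'v mindex \<Rightarrow> complex"
  assumes "psd_matrix (index_set N) (\<lambda>\<alpha> \<beta>. G \<alpha> \<beta> - up_entry N j G \<alpha> \<beta>)"
  shows "psd_matrix (index_set N) G"
proof -
  let ?I = "index_set N :: 'v mindex set"
  have vanish: "hform ?I G c \<in> \<real>\<^sub>\<ge>\<^sub>0" if "\<And>\<alpha>. msize \<alpha> + k \<le> N \<Longrightarrow> c \<alpha> = 0" for k c
    using that
  proof (induction k arbitrary: c)
    case 0
    then have "hform ?I G c = 0" by (simp add: hform_def index_set_def)
    then show ?case by simp
  next
    case (Suc k)
    let ?c = "\<lambda>\<alpha>. if lookup \<alpha> j > 0 then c (\<alpha> - unit_index j) else 0"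
    have "hform ?I G c = hform ?I (\<lambda>\<alpha> \<beta>. G \<alpha> \<beta> - up_entry N j G \<alpha> \<beta>) c + hform ?I (up_entry N j G) c"
      by (simp add: hform_def algebra_simps sum_subtractf)
    moreover have "hform ?I G ?c \<in> \<real>\<^sub>\<ge>\<^sub>0"
    proof (rule Suc.IH)
      fix \<alpha> :: "'v mindex" assume "msize \<alpha> + k \<le> N"
      then show "?c \<alpha> = 0"
        using Suc.prems[of "\<alpha> - unit_index j"] msize_minus_unit_index[of \<alpha> j] by auto
    qed
    ultimately show ?case using assms by (simp add: psd_matrix_iff hform_up_entry)
  qed
  show ?thesis unfolding psd_matrix_iff
    using vanish[of "Suc N"] by simp
qed

subsection \<open>Polynomials in \<open>z\<close> and its formal conjugate\<close>

text \<open>\<open>bi_index \<alpha> \<beta>\<close> is the exponent of \<open>zbar\<^sup>\<alpha> z\<^sup>\<beta>\<close>.\<close>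

definition bi_index :: "'d::finite mindex \<Rightarrow> 'd mindex \<Rightarrow> ('d + 'd) mindex" where
  "bi_index \<alpha> \<beta> = Abs_poly_mapping (case_sum (lookup \<beta>) (lookup \<alpha>))"

lemma lookup_Abs_finite [simp]: "lookup (Abs_poly_mapping (f :: 'd::finite \<Rightarrow> nat)) = f"
  by (rule lookup_Abs_poly_mapping) simp

lemma lookup_bi_index [simp]:
  "lookup (bi_index \<alpha> \<beta>) (Inl j) = lookup \<beta> j"
  "lookup (bi_index \<alpha> \<beta>) (Inr j) = lookup \<alpha> j"
  by (simp_all add: bi_index_def)

lemma bi_index_eqI:
  assumes "\<And>j. lookup \<gamma> (Inl j) = lookup \<beta> j"
    and "\<And>j. lookup \<gamma> (Inr j) = lookup \<alpha> j"
  shows "\<gamma> = bi_index \<alpha> \<beta>"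
proof (rule poly_mapping_eqI)
  fix v show "lookup \<gamma> v = lookup (bi_index \<alpha> \<beta>) v"
    using assms by (cases v) auto
qed

lemma bi_index_inject [simp]: "bi_index \<alpha> \<beta> = bi_index \<alpha>' \<beta>' \<longleftrightarrow> \<alpha> = \<alpha>' \<and> \<beta> = \<beta>'"
  by (metis lookup_bi_index poly_mapping_eqI)

lemma bi_index_add: "bi_index \<alpha> \<beta> + bi_index \<alpha>' \<beta>' = bi_index (\<alpha> + \<alpha>') (\<beta> + \<beta>')"
  by (rule bi_index_eqI) (simp_all add: lookup_add)

lemma bi_index_zero [simp]: "bi_index 0 0 = 0"
  by (rule bi_index_eqI[symmetric]) simp_all

lemma bi_index_surj: "\<exists>\<alpha> \<beta>. \<gamma> = bi_index \<alpha> \<beta>"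
proof (intro exI)
  show "\<gamma> = bi_index (Abs_poly_mapping (\<lambda>j. lookup \<gamma> (Inr j)))
      (Abs_poly_mapping (\<lambda>j. lookup \<gamma> (Inl j)))"
    by (rule bi_index_eqI) simp_all
qed

lemma Var_power: "Var v ^ n = single (single v n) 1"
proof (induction n)
  case 0
  then show ?case by (simp flip: single_one)
next
  case (Suc n)
  then show ?case by (simp add: Var_def unit_index_def mult_single flip: single_add)
qed

lemma prod_single_one:
  "(\<Prod>j\<in>S. single (k j) (1 :: complex)) = single (\<Sum>j\<in>S. k j) 1"
  by (induction S rule: infinite_finite_induct) (simp_all add: mult_single)

lemma sum_eq_single_summand:
  fixes f :: "'d::finite \<Rightarrow> nat"
  shows "(\<Sum>i\<in>UNIV. (f i when i = j)) = f j" "(\<Sum>i\<in>UNIV. (f i when j = i)) = f j"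
  by (simp_all add: when_def)

lemma monom_at_zvar: "monom_at zvar \<alpha> = single (bi_index 0 \<alpha>) 1"
proof -
  have "(\<Sum>j\<in>UNIV. single (Inl j) (lookup \<alpha> j)) = bi_index 0 \<alpha>"
    by (rule bi_index_eqI) (simp_all add: lookup_sum lookup_single sum_eq_single_summand)
  then show ?thesis by (simp add: monom_at_def zvar_def Var_power prod_single_one)
qed

lemma monom_at_zbar: "monom_at zbar \<alpha> = single (bi_index \<alpha> 0) 1"
proof -
  have "(\<Sum>j\<in>UNIV. single (Inr j) (lookup \<alpha> j)) = bi_index \<alpha> 0"
    by (rule bi_index_eqI) (simp_all add: lookup_sum lookup_single sum_eq_single_summand)
  then show ?thesis by (simp add: monom_at_def zbar_def Var_power prod_single_one)
qed

lemma poly_z_eq: "poly_z q = (\<Sum>\<alpha>\<in>keys q. single (bi_index 0 \<alpha>) (lookup q \<alpha>))"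
  by (simp add: poly_z_def subst_poly_def Const_def monom_at_zvar mult_single)

lemma poly_conj_eq: "poly_conj q = (\<Sum>\<alpha>\<in>keys q. single (bi_index \<alpha> 0) (cnj (lookup q \<alpha>)))"
  by (simp add: poly_conj_def subst_poly_def Const_def monom_at_zbar mult_single)

text \<open>The variables of the two factors are independent, so different pairs of exponents never
  collide and each coefficient is a single product.\<close>

lemma lookup_poly_conj_mult_poly_z:
  "lookup (poly_conj q * poly_z q') (bi_index \<alpha> \<beta>)
    = cnj (lookup q \<alpha>) * lookup q' \<beta>"
proof -
  let ?c = "\<lambda>\<alpha> \<beta>. cnj (lookup q \<alpha>) * lookup q' \<beta>"
  have "poly_conj q * poly_z q' = (\<Sum>\<alpha>'\<in>keys q. \<Sum>\<beta>'\<in>keys q'.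
      single (bi_index \<alpha>' \<beta>') (?c \<alpha>' \<beta>'))"
    by (simp add: poly_conj_eq poly_z_eq sum_product mult_single bi_index_add)
  then have "lookup (poly_conj q * poly_z q') (bi_index \<alpha> \<beta>)
    = (\<Sum>\<alpha>'\<in>keys q. \<Sum>\<beta>'\<in>keys q'. if \<alpha>' = \<alpha> \<and> \<beta>' = \<beta> then ?c \<alpha>' \<beta>' else 0)"
    by (simp add: lookup_sum lookup_single when_def)
  also have "\<dots> = (\<Sum>\<alpha>'\<in>keys q. if \<alpha>' = \<alpha> then \<Sum>\<beta>'\<in>keys q'. if \<beta>' = \<beta> then ?c \<alpha>' \<beta>' else 0 else 0)"
    by (intro sum.cong) auto
  also have "\<dots> = ?c \<alpha> \<beta>"
    by (auto simp: in_keys_iff)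
  finally show ?thesis .
qed

lemma poly_mapping_sum_single:
  fixes f :: "'a \<Rightarrow>\<^sub>0 'b::comm_monoid_add"
  shows "f = (\<Sum>k\<in>keys f. single k (lookup f k))"
  by (rule poly_mapping_eqI) (auto simp: lookup_sum lookup_single when_def in_keys_iff)

lemma lookup_single_mult:
  fixes f :: "'v mindex \<Rightarrow>\<^sub>0 complex"
  shows "lookup (single k c * f) (k + \<gamma>) = c * lookup f \<gamma>"
    and "(\<And>\<gamma>. \<eta> \<noteq> k + \<gamma>) \<Longrightarrow> lookup (single k c * f) \<eta> = 0"
proof -
  have "single k c * f
    = single k c * (\<Sum>\<gamma>\<in>keys f. single \<gamma> (lookup f \<gamma>))"
    by (subst poly_mapping_sum_single[symmetric]) simp
  also have "\<dots> = (\<Sum>\<gamma>\<in>keys f. single (k + \<gamma>) (c * lookup f \<gamma>))"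
    by (simp add: sum_distrib_left mult_single)
  finally have *: "lookup (single k c * f) \<eta>
      = (\<Sum>\<gamma>\<in>keys f. if k + \<gamma> = \<eta> then c * lookup f \<gamma> else 0)" for \<eta>
    by (simp add: lookup_sum lookup_single when_def)
  show "lookup (single k c * f) (k + \<gamma>) = c * lookup f \<gamma>"
    by (auto simp: * in_keys_iff)
  show "lookup (single k c * f) \<eta> = 0" if "\<And>\<gamma>. \<eta> \<noteq> k + \<gamma>"
    unfolding * using that by (intro sum.neutral) auto
qed

lemma zbar_mult_zvar: "zbar j * zvar j = single (bi_index (unit_index j) (unit_index j)) 1"
proof -
  have "unit_index (Inr j) = bi_index (unit_index j) 0" "unit_index (Inl j) = bi_index 0 (unit_index j)"
    by (rule bi_index_eqI; simp add: lookup_unit_index)+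
  then show ?thesis by (simp add: zbar_def zvar_def Var_def mult_single bi_index_add)
qed

text \<open>This is where the shift in (2) comes from: multiplication by
  \<open>zbar j * zvar j\<close> raises both exponents at \<open>j\<close> by one, and a zero
  exponent at \<open>j\<close> has no preimage.\<close>

lemma lookup_zbar_zvar_mult:
  "lookup (zbar j * zvar j * f) (bi_index \<alpha> \<beta>)
    = shifted_entry j (\<lambda>\<alpha> \<beta>. lookup f (bi_index \<alpha> \<beta>)) \<alpha> \<beta>"
proof (cases "lookup \<alpha> j > 0 \<and> lookup \<beta> j > 0")
  case True
  let ?e = "unit_index j"
  have "bi_index \<alpha> \<beta> = bi_index ?e ?e + bi_index (\<alpha> - ?e) (\<beta> - ?e)"
    using True minus_unit_index_add[of \<alpha> j] minus_unit_index_add[of \<beta> j] by (simp add: bi_index_add add.commute)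
  then have "lookup (single (bi_index ?e ?e) 1 * f) (bi_index \<alpha> \<beta>)
      = 1 * lookup f (bi_index (\<alpha> - ?e) (\<beta> - ?e))"
    by (simp only: lookup_single_mult(1))
  then show ?thesis using True by (simp add: shifted_entry_def zbar_mult_zvar)
next
  case False
  have "bi_index \<alpha> \<beta> \<noteq> bi_index (unit_index j) (unit_index j) + \<gamma>" for \<gamma>
  proof
    assume "bi_index \<alpha> \<beta> = bi_index (unit_index j) (unit_index j) + \<gamma>"
    then have "lookup (bi_index \<alpha> \<beta>) v
        = lookup (bi_index (unit_index j) (unit_index j) + \<gamma>) v" for v by simp
    from this[of "Inl j"] this[of "Inr j"] False show False
      by (simp add: lookup_add lookup_unit_index)
  qed
  then have "lookup (zbar j * zvar j * f) (bi_index \<alpha> \<beta>) = 0"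
    unfolding zbar_mult_zvar by (rule lookup_single_mult(2))
  then show ?thesis using False by (auto simp: shifted_entry_def)
qed

lemma lookup_sum_list: "lookup (\<Sum>x\<leftarrow>xs. f x) k = (\<Sum>x\<leftarrow>xs. lookup (f x) k)"
  by (induction xs) (simp_all add: lookup_add)

lemma lookup_vpoly_sq_norm:
  "lookup (vpoly_sq_norm qs) (bi_index \<alpha> \<beta>)
    = (\<Sum>q\<leftarrow>qs. cnj (lookup q \<alpha>) * lookup q \<beta>)"
  by (simp add: vpoly_sq_norm_def lookup_sum_list lookup_poly_conj_mult_poly_z)

lemma lookup_sos_difference:
  fixes p :: "'d::finite cpoly"
  shows "lookup ((1 - poly_conj p * poly_z p) - (\<Sum>j\<in>UNIV. (1 - zbar j * zvar j) * vpoly_sq_norm (A j)))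
      (bi_index \<alpha> \<beta>)
    = (if \<alpha> = 0 \<and> \<beta> = 0 then 1 else 0) - cnj (lookup p \<alpha>) * lookup p \<beta>
      - shift_defect (\<lambda>j \<alpha> \<beta>. \<Sum>q\<leftarrow>A j. cnj (lookup q \<alpha>) * lookup q \<beta>) \<alpha> \<beta>"
proof -
  have 1: "lookup (1 :: ('d + 'd) cpoly) (bi_index \<alpha> \<beta>) = (if \<alpha> = 0 \<and> \<beta> = 0 then 1 else 0)"
    using bi_index_inject[of \<alpha> \<beta> 0 0] by (simp add: lookup_one when_def)
  have "lookup ((1 - zbar j * zvar j) * vpoly_sq_norm (A j)) (bi_index \<alpha> \<beta>)
      = (\<Sum>q\<leftarrow>A j. cnj (lookup q \<alpha>) * lookup q \<beta>)
        - shifted_entry j (\<lambda>\<alpha> \<beta>. \<Sum>q\<leftarrow>A j. cnj (lookup q \<alpha>) * lookup q \<beta>) \<alpha> \<beta>" for j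
    by (simp only: left_diff_distrib mult_1_left lookup_minus lookup_zbar_zvar_mult lookup_vpoly_sq_norm)
  then show ?thesis
    by (simp only: lookup_minus lookup_sum 1 lookup_poly_conj_mult_poly_z shift_defect_def)
qed

text \<open>Serves to split off from a monomial of large degree a factor of degree exactly
  \<open>N + 1\<close>, which is a generator of the ideal.\<close>

lemma mindex_lower:
  fixes \<alpha> :: "'v::finite mindex"
  assumes "m \<le> msize \<alpha>"
  shows "\<exists>\<beta> \<gamma>. \<alpha> = \<beta> + \<gamma> \<and> msize \<beta> = m"
  using assms
proof (induction m)
  case 0
  then show ?case by (intro exI[of _ 0] exI[of _ \<alpha>]) simp
next
  case (Suc m)
  then obtain \<beta> \<gamma> where bg: "\<alpha> = \<beta> + \<gamma>" "msize \<beta> = m" by auto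
  with Suc.prems have "\<gamma> \<noteq> 0" by auto
  then obtain j where "lookup \<gamma> j > 0"
    by (metis lookup_zero neq0_conv poly_mapping_eqI)
  then have "\<gamma> = unit_index j + (\<gamma> - unit_index j)"
    by (metis minus_unit_index_add add.commute)
  with bg show ?case
    by (intro exI[of _ "\<beta> + unit_index j"] exI[of _ "\<gamma> - unit_index j"]) (simp add: add.assoc)
qed

text \<open>A monomial ideal is spanned by the monomials that it contains, here those in which the
  degree in z or the degree in zbar exceeds \<open>N\<close>. The polynomials without any other
  monomial form an ideal \<open>J\<close> containing the generators, and each of their terms is a
  multiple of a generator.\<close>

lemma trunc_ideal_iff:
  fixes f :: "('d::finite + 'd) cpoly"
  shows "f \<in> trunc_ideal N \<longleftrightarrow>
    (\<forall>\<alpha>\<in>index_set N. \<forall>\<beta>\<in>index_set N. lookup f (bi_index \<alpha> \<beta>) = 0)"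
proof
  let ?S = "{monom_at zvar \<alpha> | \<alpha> :: 'd mindex. msize \<alpha> = N + 1} \<union> {monom_at zbar \<alpha> | \<alpha> :: 'd mindex. msize \<alpha> = N + 1}"
  define J where "J = {f :: ('d + 'd) cpoly. \<forall>\<alpha>\<in>index_set N. \<forall>\<beta>\<in>index_set N. lookup f (bi_index \<alpha> \<beta>) = 0}"
  have mult: "g * f \<in> J" if f: "f \<in> J" for g f
  proof -
    have "lookup (single k c * f) (bi_index \<alpha> \<beta>) = 0"
      if "\<alpha> \<in> index_set N" "\<beta> \<in> index_set N" for k c \<alpha> \<beta>
    proof (cases "\<exists>\<gamma>. bi_index \<alpha> \<beta> = k + \<gamma>")
      case True
      then obtain k1 k2 \<gamma>1 \<gamma>2 where k: "bi_index \<alpha> \<beta> = k + bi_index \<gamma>1 \<gamma>2" "k = bi_index k1 k2"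
        using bi_index_surj by metis
      then have "\<alpha> = k1 + \<gamma>1" "\<beta> = k2 + \<gamma>2" by (simp_all add: bi_index_add)
      then have "\<gamma>1 \<in> index_set N" "\<gamma>2 \<in> index_set N" using that by (auto simp: index_set_def)
      then show ?thesis using f unfolding k(1) lookup_single_mult(1) by (simp add: J_def)
    next
      case False
      then show ?thesis using lookup_single_mult(2) by blast
    qed
    moreover have "g * f = (\<Sum>k\<in>keys g. single k (lookup g k) * f)"
      by (subst poly_mapping_sum_single[of g]) (simp add: sum_distrib_right)
    ultimately show ?thesis by (simp add: J_def lookup_sum)
  qed
  then have mult': "f * g \<in> J" if "f \<in> J" for g f
    using that by (simp add: mult.commute)
  have "ideal J class_ring"
  proof (rule idealI)
    show "subgroup J (add_monoid class_ring)"
    proof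
      fix x assume "x \<in> J"
      have "inv\<^bsub>add_monoid class_ring\<^esub> x = - x"
        using class_ring_simps by (metis a_inv_def)
      then show "inv\<^bsub>add_monoid class_ring\<^esub> x \<in> J"
        using \<open>x \<in> J\<close> by (simp add: J_def)
    qed (auto simp: J_def lookup_add)
  qed (auto simp: class_ring.ring_axioms mult mult')
  moreover have "?S \<subseteq> J"
    by (auto simp: J_def monom_at_zvar monom_at_zbar lookup_single when_def index_set_def)
  ultimately have "trunc_ideal N \<subseteq> J"
    unfolding trunc_ideal_def genideal_def by blast
  then show "f \<in> trunc_ideal N \<Longrightarrow> \<forall>\<alpha>\<in>index_set N. \<forall>\<beta>\<in>index_set N. lookup f (bi_index \<alpha> \<beta>) = 0"
    by (auto simp: J_def)
  assume f: "\<forall>\<alpha>\<in>index_set N. \<forall>\<beta>\<in>index_set N. lookup f (bi_index \<alpha> \<beta>) = 0"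
  have "f \<in> I" if "ideal I class_ring" "?S \<subseteq> I" for I
  proof -
    interpret I: ideal I "class_ring :: ('d + 'd) cpoly ring" by fact
    have add: "x + y \<in> I" if "x \<in> I" "y \<in> I" for x y using I.a_closed[OF that] by simp
    have zero: "0 \<in> I" using I.zero_closed by simp
    have lmult: "y * x \<in> I" if "x \<in> I" for x y using I.I_l_closed[OF that] by simp
    have sum: "(\<Sum>k\<in>K. g k) \<in> I" if "\<And>k. k \<in> K \<Longrightarrow> g k \<in> I" for K :: "('d + 'd) mindex set" and g
      using that by (induction K rule: infinite_finite_induct) (auto simp: zero add)
    have "single k (lookup f k) \<in> I" if "k \<in> keys f" for k
    proof -
      obtain \<alpha> \<beta> where k: "k = bi_index \<alpha> \<beta>" using bi_index_surj by metis
      with f that consider "N + 1 \<le> msize \<alpha>" | "N + 1 \<le> msize \<beta>"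
        by (force simp: in_keys_iff index_set_def)
      then show ?thesis
      proof cases
        case 1
        then obtain \<alpha>1 \<alpha>2 where a: "\<alpha> = \<alpha>1 + \<alpha>2" "msize \<alpha>1 = N + 1" using mindex_lower by blast
        have "single k (lookup f k)
          = single (bi_index \<alpha>2 \<beta>) (lookup f k) * monom_at zbar \<alpha>1"
          by (simp add: monom_at_zbar mult_single bi_index_add k a add.commute)
        also have "\<dots> \<in> I" using a \<open>?S \<subseteq> I\<close> by (intro lmult) blast
        finally show ?thesis .
      next
        case 2
        then obtain \<beta>1 \<beta>2 where a: "\<beta> = \<beta>1 + \<beta>2" "msize \<beta>1 = N + 1" using mindex_lower by blast
        have "single k (lookup f k)
          = single (bi_index \<alpha> \<beta>2) (lookup f k) * monom_at zvar \<beta>1"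
          by (simp add: monom_at_zvar mult_single bi_index_add k a add.commute)
        also have "\<dots> \<in> I" using a \<open>?S \<subseteq> I\<close> by (intro lmult) blast
        finally show ?thesis .
      qed
    qed
    then have "(\<Sum>k\<in>keys f. single k (lookup f k)) \<in> I" by (rule sum)
    then show "f \<in> I" by (simp flip: poly_mapping_sum_single)
  qed
  then show "f \<in> trunc_ideal N" unfolding trunc_ideal_def genideal_def by blast
qed

section \<open>Equivalence of (2) and (3)\<close>

lemma shift_defect_cong:
  assumes "\<And>j \<alpha> \<beta>. \<alpha> \<in> index_set N \<Longrightarrow> \<beta> \<in> index_set N \<Longrightarrow> A j \<alpha> \<beta> = B j \<alpha> \<beta>"
    and "\<alpha> \<in> index_set N" "\<beta> \<in> index_set N"
  shows "shift_defect A \<alpha> \<beta> = shift_defect B \<alpha> \<beta>"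
  unfolding shift_defect_def shifted_entry_def using assms
  by (intro sum.cong refl) (auto simp: minus_unit_in_index_set)

lemma matrix_decomposition_iff:
  "matrix_decomposition N p \<longleftrightarrow> (\<exists>A. (\<forall>j. psd_matrix (index_set N) (A j)) \<and>
    (\<forall>\<alpha>\<in>index_set N. \<forall>\<beta>\<in>index_set N.
      (if \<alpha> = 0 \<and> \<beta> = 0 then 1 else 0) - cnj (lookup p \<alpha>) * lookup p \<beta>
        = shift_defect A \<alpha> \<beta>))"
  by (simp add: matrix_decomposition_def shift_defect_def)

lemma sos_decomposition_iff:
  "sos_decomposition N p \<longleftrightarrow> (\<exists>A :: 'd::finite \<Rightarrow> 'd cpoly list. (\<forall>j. \<forall>q\<in>set (A j). deg_le q N) \<and>
    (\<forall>\<alpha>\<in>index_set N. \<forall>\<beta>\<in>index_set N.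
      (if \<alpha> = 0 \<and> \<beta> = 0 then 1 else 0) - cnj (lookup p \<alpha>) * lookup p \<beta>
        = shift_defect (\<lambda>j \<alpha> \<beta>. \<Sum>q\<leftarrow>A j. cnj (lookup q \<alpha>) * lookup q \<beta>) \<alpha> \<beta>))"
  unfolding sos_decomposition_def trunc_ideal_iff lookup_sos_difference by simp

lemma matrix_decomposition_iff_sos:
  fixes p :: "'d::finite cpoly"
  shows "matrix_decomposition N p \<longleftrightarrow> sos_decomposition N p"
proof
  let ?I = "index_set N :: 'd mindex set"
  assume "matrix_decomposition N p"
  then obtain A where A: "\<And>j. psd_matrix ?I (A j)" "\<And>\<alpha> \<beta>. \<alpha> \<in> ?I \<Longrightarrow> \<beta> \<in> ?I \<Longrightarrow>
    (if \<alpha> = 0 \<and> \<beta> = 0 then 1 else 0) - cnj (lookup p \<alpha>) * lookup p \<beta> = shift_defect A \<alpha> \<beta>"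
    unfolding matrix_decomposition_iff by blast
  obtain q where q: "\<And>j x y. x \<in> ?I \<Longrightarrow> y \<in> ?I \<Longrightarrow> A j x y = (\<Sum>k\<in>?I. cnj (q j k x) * q j k y)"
    using psd_matrix_factor[OF finite_index_set A(1)] by metis
  obtain xs where xs: "set xs = ?I" "distinct xs" using finite_distinct_list[OF finite_index_set] by blast
  \<comment> \<open>The \<open>k\<close>-th row of the Gram factor becomes the coefficient vector of
    a polynomial; cutting it off outside the index set gives the degree bound.\<close>
  define P where "P = (\<lambda>j k. \<Sum>\<alpha>\<in>?I. single \<alpha> (q j k \<alpha>))"
  have lookupP: "lookup (P j k) \<alpha> = (if \<alpha> \<in> ?I then q j k \<alpha> else 0)" for j k \<alpha>
    by (simp add: P_def lookup_sum lookup_single when_def)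
  define B where "B = (\<lambda>j. map (P j) xs)"
  have "\<forall>j. \<forall>q\<in>set (B j). deg_le q N"
    by (auto simp: B_def deg_le_def in_keys_iff lookupP split: if_splits)
  moreover have "A j \<alpha> \<beta> = (\<Sum>q\<leftarrow>B j. cnj (lookup q \<alpha>) * lookup q \<beta>)"
    if "\<alpha> \<in> ?I" "\<beta> \<in> ?I" for j \<alpha> \<beta>
    using that xs by (simp add: B_def o_def q lookupP sum_list_distinct_conv_sum_set)
  from shift_defect_cong[where A = A, OF this] have "shift_defect A \<alpha> \<beta>
      = shift_defect (\<lambda>j \<alpha> \<beta>. \<Sum>q\<leftarrow>B j. cnj (lookup q \<alpha>) * lookup q \<beta>) \<alpha> \<beta>"
    if "\<alpha> \<in> ?I" "\<beta> \<in> ?I" for \<alpha> \<beta> using that by blast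
  ultimately show "sos_decomposition N p"
    unfolding sos_decomposition_iff using A(2) by (intro exI[of _ B]) auto
next
  let ?I = "index_set N :: 'd mindex set"
  assume "sos_decomposition N p"
  then obtain A :: "'d \<Rightarrow> 'd cpoly list" where A: "\<And>\<alpha> \<beta>. \<alpha> \<in> ?I \<Longrightarrow> \<beta> \<in> ?I \<Longrightarrow>
    (if \<alpha> = 0 \<and> \<beta> = 0 then 1 else 0) - cnj (lookup p \<alpha>) * lookup p \<beta>
      = shift_defect (\<lambda>j \<alpha> \<beta>. \<Sum>q\<leftarrow>A j. cnj (lookup q \<alpha>) * lookup q \<beta>) \<alpha> \<beta>"
    unfolding sos_decomposition_iff by blast
  have "psd_matrix ?I (\<lambda>\<alpha> \<beta>. \<Sum>q\<leftarrow>A j. cnj (lookup q \<alpha>) * lookup q \<beta>)" for j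
    by (rule psd_matrix_gram[where K = "{..<length (A j)}" and q = "\<lambda>k. lookup (A j ! k)"])
      (simp_all add: sum_list_sum_nth atLeast0LessThan)
  then show "matrix_decomposition N p"
    unfolding matrix_decomposition_iff using A
    by (intro exI[of _ "\<lambda>j \<alpha> \<beta>. \<Sum>q\<leftarrow>A j. cnj (lookup q \<alpha>) * lookup q \<beta>"]) blast
qed

subsection \<open>Operator norms\<close>

lemma mult_mat_vec_index:
  "A \<in> carrier_mat n m \<Longrightarrow> v \<in> carrier_vec m \<Longrightarrow> i < n \<Longrightarrow> (A *\<^sub>v v) $ i = (\<Sum>k<m. A $$ (i, k) * v $ k)"
  by (auto simp: scalar_prod_def atLeast0LessThan)

lemma vec_norm_sq: "(vec_norm v)\<^sup>2 = (\<Sum>i<dim_vec v. (norm (v $ i))\<^sup>2)"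
  by (simp add: vec_norm_def L2_set_def sum_nonneg)

lemma vec_norm_nonneg [simp]: "0 \<le> vec_norm v"
  by (simp add: vec_norm_def)

lemma vec_norm_smult: "vec_norm (c \<cdot>\<^sub>v v) = norm c * vec_norm v"
  by (simp add: vec_norm_def norm_mult L2_set_right_distrib cong: L2_set_cong_simp)

lemma norm_entry_le_vec_norm: "i < dim_vec v \<Longrightarrow> norm (v $ i) \<le> vec_norm v"
  unfolding vec_norm_def by (rule member_le_L2_set) auto

text \<open>A crude bound whose purpose is to make the set in the supremum of \<open>op_norm\<close>
  bounded.\<close>

lemma vec_norm_mult_mat_vec_le:
  assumes "A \<in> carrier_mat n m" "v \<in> carrier_vec m" "vec_norm v \<le> 1"
  shows "vec_norm (A *\<^sub>v v) \<le> (\<Sum>i<n. \<Sum>j<m. norm (A $$ (i, j)))"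
proof -
  have "vec_norm (A *\<^sub>v v) \<le> (\<Sum>i<n. norm ((A *\<^sub>v v) $ i))"
    using assms L2_set_le_sum[of "{..<n}" "\<lambda>i. norm ((A *\<^sub>v v) $ i)"] by (simp add: vec_norm_def)
  also have "\<dots> \<le> (\<Sum>i<n. \<Sum>j<m. norm (A $$ (i, j)))"
  proof (rule sum_mono)
    fix i assume i: "i \<in> {..<n}"
    then have "(A *\<^sub>v v) $ i = (\<Sum>j<m. A $$ (i, j) * v $ j)"
      using assms by (simp add: scalar_prod_def atLeast0LessThan)
    also have "norm \<dots> \<le> (\<Sum>j<m. norm (A $$ (i, j)))"
    proof (rule sum_norm_le)
      fix j assume j: "j \<in> {..<m}"
      then have "norm (v $ j) \<le> 1" using norm_entry_le_vec_norm[of j v] assms by simp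
      then show "norm (A $$ (i, j) * v $ j) \<le> norm (A $$ (i, j))"
        by (simp add: norm_mult mult_left_le)
    qed
    finally show "norm ((A *\<^sub>v v) $ i) \<le> (\<Sum>j<m. norm (A $$ (i, j)))" .
  qed
  finally show ?thesis .
qed

lemma op_norm_le_1_iff:
  assumes A: "A \<in> carrier_mat n m"
  shows "op_norm A \<le> 1 \<longleftrightarrow> (\<forall>v\<in>carrier_vec m. vec_norm (A *\<^sub>v v) \<le> vec_norm v)"
proof
  assume le: "op_norm A \<le> 1"
  have bdd: "bdd_above ((\<lambda>v. vec_norm (A *\<^sub>v v)) ` {v \<in> carrier_vec (dim_col A). vec_norm v \<le> 1})"
    using vec_norm_mult_mat_vec_le[OF A] A by (intro bdd_aboveI[of _ "\<Sum>i<n. \<Sum>j<m. norm (A $$ (i, j))"]) auto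
  show "\<forall>v\<in>carrier_vec m. vec_norm (A *\<^sub>v v) \<le> vec_norm v"
  proof
    fix v :: "complex vec" assume v: "v \<in> carrier_vec m"
    show "vec_norm (A *\<^sub>v v) \<le> vec_norm v"
    proof (cases "vec_norm v = 0")
      case True
      then have "\<forall>i<m. v $ i = 0" using v norm_entry_le_vec_norm[of _ v] by fastforce
      then have "(A *\<^sub>v v) $ i = 0" if "i < n" for i
        using that A v by (simp add: scalar_prod_def)
      then have "vec_norm (A *\<^sub>v v) = 0" using A by (simp add: vec_norm_def L2_set_eq_0_iff)
      then show ?thesis by simp
    next
      case False
      then have pos: "vec_norm v > 0" using vec_norm_nonneg[of v] by linarith
      define w where "w = complex_of_real (1 / vec_norm v) \<cdot>\<^sub>v v"
      have w: "w \<in> carrier_vec (dim_col A)" "vec_norm w \<le> 1"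
        using v A pos by (simp_all add: w_def vec_norm_smult norm_divide)
      have "vec_norm (A *\<^sub>v w) \<le> op_norm A"
        unfolding op_norm_def using w by (intro cSUP_upper bdd) auto
      then have "vec_norm (A *\<^sub>v w) \<le> 1" using le by linarith
      moreover have "A *\<^sub>v w = complex_of_real (1 / vec_norm v) \<cdot>\<^sub>v (A *\<^sub>v v)"
        unfolding w_def using A v by (rule mult_mat_vec)
      ultimately show ?thesis using pos by (simp add: vec_norm_smult norm_divide field_simps)
    qed
  qed
next
  assume "\<forall>v\<in>carrier_vec m. vec_norm (A *\<^sub>v v) \<le> vec_norm v"
  moreover have "vec_norm (0\<^sub>v m) = 0" by (simp add: vec_norm_def L2_set_eq_0_iff)
  ultimately show "op_norm A \<le> 1"
    unfolding op_norm_def using A by (intro cSUP_least) (auto intro!: exI[of _ "0\<^sub>v m"] intro: order_trans)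
qed

subsection \<open>Simple nilpotent tuples\<close>

text \<open>With the zero tail the two rules of a simple nilpotent tuple become one shift rule,
  valid at every multi-index, so powers and monomials act without case distinctions.\<close>

definition extend_zero :: "nat \<Rightarrow> nat \<Rightarrow> ('d::finite mindex \<Rightarrow> complex vec) \<Rightarrow> 'd mindex \<Rightarrow> complex vec" where
  "extend_zero N n b \<alpha> = (if msize \<alpha> \<le> N then b \<alpha> else 0\<^sub>v n)"

text \<open>A combination in the span is indexed by distinct vectors, while several indices may
  carry the same vector. One index \<open>g x\<close> is chosen for each vector \<open>x\<close>
  that occurs, and the other coefficients are set to zero.\<close>

lemma span_index_coefficients:
  assumes b: "b ` I \<subseteq> carrier_vec n"
    and span: "LinearCombinations.module.span class_ring (module_vec TYPE(complex) n) (b ` I) = carrier_vec n"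
    and v: "v \<in> carrier_vec n" and "finite I"
  shows "\<exists>c. \<forall>i<n. v $ i = (\<Sum>\<gamma>\<in>I. c \<gamma> * b \<gamma> $ i)"
proof -
  interpret V: vec_space "TYPE(complex)" n .
  have "v \<in> V.span (b ` I)" using span v by simp
  then obtain a X where X: "v = V.lincomb a X" "finite X" "X \<subseteq> b ` I" unfolding V.span_def by auto
  then have "\<forall>x\<in>X. \<exists>\<gamma>. \<gamma> \<in> I \<and> b \<gamma> = x" by auto
  then obtain g where g: "\<And>x. x \<in> X \<Longrightarrow> g x \<in> I" "\<And>x. x \<in> X \<Longrightarrow> b (g x) = x" by metis
  have inj: "inj_on g X" using g by (metis inj_onI)
  define c where "c = (\<lambda>\<gamma>. if \<gamma> \<in> g ` X then a (b \<gamma>) else 0)"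
  have "v $ i = (\<Sum>\<gamma>\<in>I. c \<gamma> * b \<gamma> $ i)" if "i < n" for i
  proof -
    have "v $ i = (\<Sum>x\<in>X. a x * x $ i)"
      unfolding X(1) using X b that by (intro V.lincomb_index) auto
    also have "\<dots> = (\<Sum>\<gamma>\<in>g ` X. a (b \<gamma>) * b \<gamma> $ i)"
      using inj g by (simp add: sum.reindex)
    also have "\<dots> = (\<Sum>\<gamma>\<in>I. c \<gamma> * b \<gamma> $ i)"
      using g \<open>finite I\<close> by (intro sum.mono_neutral_cong_left) (auto simp: c_def)
    finally show ?thesis .
  qed
  then show ?thesis by blast
qed

locale shift_family =
  fixes n :: nat and T :: "'d::finite \<Rightarrow> complex mat" and b :: "'d mindex \<Rightarrow> complex vec"
  assumes T: "T j \<in> carrier_mat n n"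
    and b: "b \<alpha> \<in> carrier_vec n"
    and shift: "T j *\<^sub>v b \<alpha> = b (\<alpha> + unit_index j)"
begin

lemma pow_shift: "(T j ^\<^sub>m k) *\<^sub>v b \<beta> = b (\<beta> + single j k)"
proof (induction k arbitrary: \<beta>)
  case 0
  have "dim_row (T j) = n" using T[of j] by simp
  then show ?case using b[of \<beta>] by simp
next
  case (Suc k)
  have "(T j ^\<^sub>m Suc k) *\<^sub>v b \<beta> = (T j ^\<^sub>m k) *\<^sub>v (T j *\<^sub>v b \<beta>)"
    using T b by (simp add: assoc_mult_mat_vec[of _ n n _ n])
  also have "\<dots> = b (\<beta> + (unit_index j + single j k))"
    by (simp add: shift Suc.IH add.assoc)
  also have "unit_index j + single j k = single j (Suc k)"
    by (simp add: unit_index_def flip: single_add)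
  finally show ?case .
qed

lemma mat_monom_carrier: "mat_monom n T \<alpha> \<in> carrier_mat n n"
proof -
  have "foldr (\<lambda>j M. (T j ^\<^sub>m lookup \<alpha> j) * M) js (1\<^sub>m n) \<in> carrier_mat n n" for js
    by (induction js) (auto intro!: mult_carrier_mat[of _ n n] pow_carrier_mat T)
  then show ?thesis by (simp add: mat_monom_def)
qed

text \<open>Induction over an arbitrary list of distinct variables: the resulting exponent depends
  only on the set of variables, so the unspecified order in \<open>mat_monom\<close> does not affect
  the action on the family.\<close>

lemma mat_monom_shift: "mat_monom n T \<alpha> *\<^sub>v b \<beta> = b (\<beta> + \<alpha>)"
proof -
  have "foldr (\<lambda>j M. (T j ^\<^sub>m lookup \<alpha> j) * M) js (1\<^sub>m n) \<in> carrier_mat n n \<and>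
    foldr (\<lambda>j M. (T j ^\<^sub>m lookup \<alpha> j) * M) js (1\<^sub>m n) *\<^sub>v b \<beta>
      = b (\<beta> + (\<Sum>j\<in>set js. single j (lookup \<alpha> j)))" if "distinct js" for js
    using that
  proof (induction js)
    case Nil
    then show ?case using b[of \<beta>] by simp
  next
    case (Cons j js)
    let ?M = "foldr (\<lambda>j M. (T j ^\<^sub>m lookup \<alpha> j) * M) js (1\<^sub>m n)"
    let ?P = "T j ^\<^sub>m lookup \<alpha> j"
    have M: "?M \<in> carrier_mat n n" "?M *\<^sub>v b \<beta> = b (\<beta> + (\<Sum>j\<in>set js. single j (lookup \<alpha> j)))"
      using Cons by auto
    have P: "?P \<in> carrier_mat n n" using T by simp
    have "(?P * ?M) *\<^sub>v b \<beta> = ?P *\<^sub>v (?M *\<^sub>v b \<beta>)" by (rule assoc_mult_mat_vec[OF P M(1) b])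
    also have "\<dots> = b (\<beta> + (\<Sum>j\<in>set (j # js). single j (lookup \<alpha> j)))"
      using Cons.prems by (simp add: M(2) pow_shift ac_simps)
    finally show ?case using mult_carrier_mat[OF P M(1)] by simp
  qed
  moreover have "\<exists>js :: 'd list. distinct js \<and> set js = UNIV" using finite_distinct_list[OF finite[of UNIV]] by blast
  then have "distinct (SOME js :: 'd list. distinct js \<and> set js = UNIV)" "set (SOME js :: 'd list. distinct js \<and> set js = UNIV) = UNIV"
    by (rule someI2_ex; simp)+
  moreover have "(\<Sum>j\<in>UNIV. single j (lookup \<alpha> j)) = \<alpha>"
    by (rule poly_mapping_eqI) (simp add: lookup_sum lookup_single when_def)
  ultimately show ?thesis by (simp add: mat_monom_def)
qed

lemma mat_poly_carrier [simp]: "mat_poly n p T \<in> carrier_mat n n"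
  by (simp add: mat_poly_def)

lemma mat_poly_mult_vec:
  assumes v: "v \<in> carrier_vec n" and i: "i < n"
  shows "(mat_poly n p T *\<^sub>v v) $ i = (\<Sum>\<alpha>\<in>keys p. lookup p \<alpha> * (mat_monom n T \<alpha> *\<^sub>v v) $ i)"
proof -
  have M: "(mat_monom n T \<alpha> *\<^sub>v v) $ i = (\<Sum>k<n. mat_monom n T \<alpha> $$ (i, k) * v $ k)" for \<alpha>
    using mat_monom_carrier[of \<alpha>] v i by (simp add: scalar_prod_def atLeast0LessThan carrier_matD[of _ n n])
  have "(mat_poly n p T *\<^sub>v v) $ i
    = (\<Sum>k<n. (\<Sum>\<alpha>\<in>keys p. lookup p \<alpha> * mat_monom n T \<alpha> $$ (i, k)) * v $ k)"
    using v i by (simp add: mat_poly_def scalar_prod_def atLeast0LessThan)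
  also have "\<dots> = (\<Sum>\<alpha>\<in>keys p. \<Sum>k<n. lookup p \<alpha> * mat_monom n T \<alpha> $$ (i, k) * v $ k)"
    by (subst sum.swap) (simp add: sum_distrib_right)
  finally show ?thesis by (simp add: M sum_distrib_left mult.assoc)
qed

end

section \<open>From (2) to (1)\<close>

lemma simple_nilpotent_shift_family:
  assumes "simple_nilpotent N n (T :: 'd::finite \<Rightarrow> complex mat)"
  shows "\<exists>b. shift_family n T (extend_zero N n b) \<and>
    (\<forall>v\<in>carrier_vec n. \<exists>c. \<forall>i<n. v $ i = (\<Sum>\<gamma>\<in>index_set N. c \<gamma> * b \<gamma> $ i))"
proof -
  obtain b where T: "\<And>j. T j \<in> carrier_mat n n" and b: "b ` index_set N \<subseteq> carrier_vec n"
    and span: "LinearCombinations.module.span class_ring (module_vec TYPE(complex) n) (b ` index_set N) = carrier_vec n"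
    and s1: "\<And>j \<alpha>. msize \<alpha> < N \<Longrightarrow> T j *\<^sub>v b \<alpha> = b (\<alpha> + unit_index j)"
    and s2: "\<And>j \<alpha>. msize \<alpha> = N \<Longrightarrow> T j *\<^sub>v b \<alpha> = 0\<^sub>v n"
    using assms unfolding simple_nilpotent_def by blast
  have "shift_family n T (extend_zero N n b)"
  proof
    fix j and \<alpha> :: "'d mindex"
    show "T j \<in> carrier_mat n n" by (rule T)
    show "extend_zero N n b \<alpha> \<in> carrier_vec n" using b by (auto simp: extend_zero_def index_set_def)
    have z: "T j *\<^sub>v 0\<^sub>v n = 0\<^sub>v n" using T[of j] by (intro eq_vecI) (auto simp: scalar_prod_def)
    show "T j *\<^sub>v extend_zero N n b \<alpha> = extend_zero N n b (\<alpha> + unit_index j)"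
      using s1[of \<alpha> j] s2[of \<alpha> j] z by (auto simp: extend_zero_def)
  qed
  then show ?thesis using span_index_coefficients[OF b span _ finite_index_set] by blast
qed

text \<open>Explicit form of the fact that two positive semi-definite matrices have a nonnegative
  pairing.\<close>

lemma gram_pair:
  assumes "finite I"
  shows "(\<Sum>x\<in>I. \<Sum>y\<in>I. (\<Sum>i\<in>J. cnj (f i x) * f i y) * (\<Sum>k\<in>K. cnj (q k x) * q k y))
    = of_real (\<Sum>k\<in>K. \<Sum>i\<in>J. (norm (\<Sum>y\<in>I. f i y * q k y))\<^sup>2)"
proof -
  let ?F = "\<lambda>x y. \<Sum>i\<in>J. cnj (f i x) * f i y"
  have "(\<Sum>x\<in>I. \<Sum>y\<in>I. ?F x y * (\<Sum>k\<in>K. cnj (q k x) * q k y))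
    = (\<Sum>x\<in>I. \<Sum>y\<in>I. \<Sum>k\<in>K. ?F x y * (cnj (q k x) * q k y))"
    by (simp only: sum_distrib_left)
  also have "\<dots> = (\<Sum>x\<in>I. \<Sum>k\<in>K. \<Sum>y\<in>I. ?F x y * (cnj (q k x) * q k y))"
    by (intro sum.cong refl sum.swap)
  also have "\<dots> = (\<Sum>k\<in>K. \<Sum>x\<in>I. \<Sum>y\<in>I. ?F x y * (cnj (q k x) * q k y))"
    by (rule sum.swap)
  also have "\<dots> = (\<Sum>k\<in>K. hform I ?F (q k))" by (simp only: hform_rank_one)
  also have "\<dots> = (\<Sum>k\<in>K. of_real (\<Sum>i\<in>J. (norm (\<Sum>y\<in>I. f i y * q k y))\<^sup>2))"
    by (intro sum.cong refl hform_gram assms)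
  finally show ?thesis by (simp only: of_real_sum)
qed

text \<open>For a fixed vector v let \<open>B\<close> be the Gram matrix of the vectors T^\<alpha>
  v. Pairing (2) with \<open>B\<close> gives |v|^2 - |p(T) v|^2 on one side. On the other side,
  raising both indices of \<open>B\<close> amounts to applying T_j, which leaves a sum of
  differences |w|^2 - |T_j w|^2, all nonnegative for contractions.\<close>

lemma matrix_decomposition_imp_nilpotent_contractive:
  fixes p :: "'d::finite cpoly"
  assumes deg: "deg_le p N" and dec: "matrix_decomposition N p"
  shows "nilpotent_contractive N p"
  unfolding nilpotent_contractive_def
proof (intro allI impI, elim conjE)
  fix n and T :: "'d \<Rightarrow> complex mat"
  assume sn: "simple_nilpotent N n T" and con: "contractions T"
  let ?I = "index_set N :: 'd mindex set"
  obtain b where sf: "shift_family n T (extend_zero N n b)"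
    and span: "\<And>v. v \<in> carrier_vec n \<Longrightarrow> \<exists>c. \<forall>i<n. v $ i = (\<Sum>\<gamma>\<in>index_set N. c \<gamma> * b \<gamma> $ i)"
    using simple_nilpotent_shift_family[OF sn] by blast
  interpret shift_family n T "extend_zero N n b" by (rule sf)
  obtain A where A: "\<And>j. psd_matrix ?I (A j)" "\<And>\<alpha> \<beta>. \<alpha> \<in> ?I \<Longrightarrow> \<beta> \<in> ?I \<Longrightarrow>
    (if \<alpha> = 0 \<and> \<beta> = 0 then 1 else 0) - cnj (lookup p \<alpha>) * lookup p \<beta> = shift_defect A \<alpha> \<beta>"
    using dec unfolding matrix_decomposition_def shift_defect_def[symmetric] by blast
  obtain q where q: "\<And>j x y. x \<in> ?I \<Longrightarrow> y \<in> ?I \<Longrightarrow> A j x y = (\<Sum>k\<in>?I. cnj (q j k x) * q j k y)"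
    using psd_matrix_factor[OF finite_index_set A(1)] by metis
  show "op_norm (mat_poly n p T) \<le> 1"
    unfolding op_norm_le_1_iff[OF mat_poly_carrier]
  proof
    fix v :: "complex vec" assume v: "v \<in> carrier_vec n"
    obtain c where c: "\<And>i. i < n \<Longrightarrow> v $ i = (\<Sum>\<gamma>\<in>?I. c \<gamma> * b \<gamma> $ i)" using span[OF v] by blast
    \<comment> \<open>\<open>f i \<alpha>\<close> is the \<open>i\<close>-th coordinate of
      T^\<alpha> v, so \<open>V \<alpha>\<close> is this vector.\<close>
    define f where "f = (\<lambda>i \<alpha>. \<Sum>\<gamma>\<in>?I. c \<gamma> * extend_zero N n b (\<gamma> + \<alpha>) $ i)"
    define V where "V = (\<lambda>\<alpha>. vec n (\<lambda>i. f i \<alpha>))"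
    have mult_V: "(M *\<^sub>v V \<alpha>) $ i = (\<Sum>\<gamma>\<in>?I. c \<gamma> * (M *\<^sub>v extend_zero N n b (\<gamma> + \<alpha>)) $ i)"
      if "M \<in> carrier_mat n n" "i < n" for M \<alpha> i
    proof -
      have "(M *\<^sub>v V \<alpha>) $ i = (\<Sum>k<n. M $$ (i, k) * f k \<alpha>)"
        using that by (simp add: V_def scalar_prod_def atLeast0LessThan)
      also have "\<dots> = (\<Sum>\<gamma>\<in>?I. \<Sum>k<n. c \<gamma> * (M $$ (i, k) * extend_zero N n b (\<gamma> + \<alpha>) $ k))"
        unfolding f_def sum_distrib_left by (subst sum.swap) (simp add: mult_ac)
      also have "\<dots> = (\<Sum>\<gamma>\<in>?I. c \<gamma> * (M *\<^sub>v extend_zero N n b (\<gamma> + \<alpha>)) $ i)"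
        by (simp add: mult_mat_vec_index[OF that(1) b that(2)] sum_distrib_left del: index_mult_mat_vec)
      finally show ?thesis .
    qed
    have TV: "T j *\<^sub>v V \<alpha> = V (\<alpha> + unit_index j)" for j \<alpha>
    proof (rule eq_vecI)
      show "dim_vec (T j *\<^sub>v V \<alpha>) = dim_vec (V (\<alpha> + unit_index j))" using T[of j] by (simp add: V_def)
      fix i assume "i < dim_vec (V (\<alpha> + unit_index j))"
      then have i: "i < n" by (simp add: V_def)
      show "(T j *\<^sub>v V \<alpha>) $ i = V (\<alpha> + unit_index j) $ i"
        unfolding mult_V[OF T i] using i by (simp add: V_def f_def shift add.assoc)
    qed
    have V0: "V 0 = v"
    proof (rule eq_vecI)
      show "dim_vec (V 0) = dim_vec v" using v by (simp add: V_def)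
      fix i assume "i < dim_vec v"
      then have i: "i < n" using v by simp
      then show "V 0 $ i = v $ i" by (simp add: V_def f_def c extend_zero_def index_set_def)
    qed
    have f0: "f i \<alpha> = 0" if "i < n" "\<not> msize \<alpha> \<le> N" for i \<alpha>
      using that by (simp add: f_def extend_zero_def)
    have pv: "(mat_poly n p T *\<^sub>v v) $ i = (\<Sum>\<alpha>\<in>?I. f i \<alpha> * lookup p \<alpha>)" if i: "i < n" for i
    proof -
      have "(mat_monom n T \<alpha> *\<^sub>v v) $ i = f i \<alpha>" for \<alpha>
        using mult_V[OF mat_monom_carrier i, of \<alpha> 0] by (simp add: V0 mat_monom_shift f_def)
      then have "(mat_poly n p T *\<^sub>v v) $ i = (\<Sum>\<alpha>\<in>keys p. lookup p \<alpha> * f i \<alpha>)"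
        using mat_poly_mult_vec[OF v i] by simp
      also have "\<dots> = (\<Sum>\<alpha>\<in>?I. f i \<alpha> * lookup p \<alpha>)"
        using deg by (intro sum.mono_neutral_cong_left) (auto simp: deg_le_def in_keys_iff)
      finally show ?thesis .
    qed
    define B where "B = (\<lambda>\<alpha> \<beta>. \<Sum>i<n. cnj (f i \<alpha>) * f i \<beta>)"
    \<comment> \<open>The zero that \<open>up_entry\<close> inserts at the top level is the value of
      the formula itself, because \<open>f i\<close> vanishes beyond level \<open>N\<close>.\<close>
    have up: "up_entry N j B \<alpha> \<beta> = (\<Sum>i<n. cnj (f i (\<alpha> + unit_index j)) * f i (\<beta> + unit_index j))" for j \<alpha> \<beta>
      by (auto simp: up_entry_def B_def f0 intro!: sum.neutral[symmetric])
    have norm_v: "(vec_norm v)\<^sup>2 = Re (B 0 0)"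
    proof -
      have "(vec_norm v)\<^sup>2 = (\<Sum>i<n. (norm (f i 0))\<^sup>2)" using V0 v by (auto simp: vec_norm_sq V_def)
      moreover have "Re (cnj z * z) = (norm z)\<^sup>2" for z
        unfolding cmod_power2 by (simp add: power2_eq_square)
      ultimately show ?thesis by (simp only: B_def Re_sum)
    qed
    have norm_pv: "(vec_norm (mat_poly n p T *\<^sub>v v))\<^sup>2 = Re (hform ?I B (lookup p))"
    proof -
      have "hform ?I B (lookup p) = of_real (\<Sum>i<n. (norm (\<Sum>\<alpha>\<in>?I. f i \<alpha> * lookup p \<alpha>))\<^sup>2)"
        unfolding B_def by (rule hform_gram) auto
      moreover have "dim_vec (mat_poly n p T *\<^sub>v v) = n" by (simp add: mat_poly_def)
      ultimately show ?thesis by (simp only: vec_norm_sq Re_complex_of_real) (simp add: pv del: index_mult_mat_vec)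
    qed
    have "(\<Sum>\<alpha>\<in>?I. \<Sum>\<beta>\<in>?I. B \<alpha> \<beta> * shift_defect A \<alpha> \<beta>)
        = (\<Sum>\<alpha>\<in>?I. \<Sum>\<beta>\<in>?I. B \<alpha> \<beta> * (if \<alpha> = 0 \<and> \<beta> = 0 then 1 else 0))
          - (\<Sum>\<alpha>\<in>?I. \<Sum>\<beta>\<in>?I. B \<alpha> \<beta> * (cnj (lookup p \<alpha>) * lookup p \<beta>))"
      by (simp only: A(2)[symmetric] right_diff_distrib sum_subtractf cong: sum.cong)
    also have "(\<Sum>\<alpha>\<in>?I. \<Sum>\<beta>\<in>?I. B \<alpha> \<beta> * (if \<alpha> = 0 \<and> \<beta> = 0 then 1 else 0)) = (\<Sum>\<alpha>\<in>?I. if \<alpha> = 0 then B 0 0 else 0)"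
      by (intro sum.cong refl) (auto simp: if_distrib[of "\<lambda>x. _ * x"] cong: if_cong)
    also have "\<dots> = B 0 0" by simp
    finally have L: "(\<Sum>\<alpha>\<in>?I. \<Sum>\<beta>\<in>?I. B \<alpha> \<beta> * shift_defect A \<alpha> \<beta>) = B 0 0 - hform ?I B (lookup p)"
      by (simp only: hform_rank_one)
    have summand: "0 \<le> Re (\<Sum>\<alpha>\<in>?I. \<Sum>\<beta>\<in>?I. (B \<alpha> \<beta> - up_entry N j B \<alpha> \<beta>) * A j \<alpha> \<beta>)" for j
    proof -
      \<comment> \<open>The combination of the vectors \<open>V \<alpha>\<close> with the
        \<open>k\<close>-th Gram factor of \<open>A j\<close> as coefficients; applying
        \<open>T j\<close> raises every \<alpha> and gives the subtracted squares.\<close>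
      define w where "w = (\<lambda>k. vec n (\<lambda>i. \<Sum>\<alpha>\<in>?I. f i \<alpha> * q j k \<alpha>))"
      have Tw: "(T j *\<^sub>v w k) $ i = (\<Sum>\<alpha>\<in>?I. f i (\<alpha> + unit_index j) * q j k \<alpha>)" if i: "i < n" for k i
      proof -
        have "(T j *\<^sub>v w k) $ i = (\<Sum>l<n. T j $$ (i, l) * (\<Sum>\<alpha>\<in>?I. f l \<alpha> * q j k \<alpha>))"
          using T[of j] i by (simp add: w_def scalar_prod_def atLeast0LessThan)
        also have "\<dots> = (\<Sum>\<alpha>\<in>?I. (\<Sum>l<n. T j $$ (i, l) * f l \<alpha>) * q j k \<alpha>)"
          unfolding sum_distrib_left sum_distrib_right by (subst sum.swap) (simp add: mult_ac)
        also have "\<dots> = (\<Sum>\<alpha>\<in>?I. (T j *\<^sub>v V \<alpha>) $ i * q j k \<alpha>)"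
          using T[of j] i by (simp add: V_def scalar_prod_def atLeast0LessThan)
        finally show ?thesis using i by (simp add: TV) (simp add: V_def)
      qed
      have "(\<Sum>\<alpha>\<in>?I. \<Sum>\<beta>\<in>?I. (B \<alpha> \<beta> - up_entry N j B \<alpha> \<beta>) * A j \<alpha> \<beta>)
        = (\<Sum>\<alpha>\<in>?I. \<Sum>\<beta>\<in>?I. B \<alpha> \<beta> * (\<Sum>k\<in>?I. cnj (q j k \<alpha>) * q j k \<beta>))
          - (\<Sum>\<alpha>\<in>?I. \<Sum>\<beta>\<in>?I. up_entry N j B \<alpha> \<beta> * (\<Sum>k\<in>?I. cnj (q j k \<alpha>) * q j k \<beta>))"
        by (simp only: q left_diff_distrib sum_subtractf cong: sum.cong)
      also have "\<dots> = of_real ((\<Sum>k\<in>?I. \<Sum>i<n. (norm (\<Sum>\<alpha>\<in>?I. f i \<alpha> * q j k \<alpha>))\<^sup>2)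
          - (\<Sum>k\<in>?I. \<Sum>i<n. (norm (\<Sum>\<alpha>\<in>?I. f i (\<alpha> + unit_index j) * q j k \<alpha>))\<^sup>2))"
        unfolding up unfolding B_def by (simp only: gram_pair[OF finite_index_set] of_real_diff)
      also have "\<dots> = of_real (\<Sum>k\<in>?I. (vec_norm (w k))\<^sup>2 - (vec_norm (T j *\<^sub>v w k))\<^sup>2)"
      proof -
        have "(vec_norm (w k))\<^sup>2 = (\<Sum>i<n. (norm (\<Sum>\<alpha>\<in>?I. f i \<alpha> * q j k \<alpha>))\<^sup>2)" for k
          by (simp add: vec_norm_sq w_def)
        moreover have "(vec_norm (T j *\<^sub>v w k))\<^sup>2 = (\<Sum>i<n. (norm (\<Sum>\<alpha>\<in>?I. f i (\<alpha> + unit_index j) * q j k \<alpha>))\<^sup>2)" for k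
          using T[of j] by (simp add: vec_norm_sq Tw del: index_mult_mat_vec)
        ultimately show ?thesis by (simp only: sum_subtractf)
      qed
      finally have eq: "(\<Sum>\<alpha>\<in>?I. \<Sum>\<beta>\<in>?I. (B \<alpha> \<beta> - up_entry N j B \<alpha> \<beta>) * A j \<alpha> \<beta>)
        = of_real (\<Sum>k\<in>?I. (vec_norm (w k))\<^sup>2 - (vec_norm (T j *\<^sub>v w k))\<^sup>2)" .
      have "vec_norm (T j *\<^sub>v w k) \<le> vec_norm (w k)" for k
        using con op_norm_le_1_iff[OF T[of j]] by (simp add: contractions_def w_def)
      then have "0 \<le> (\<Sum>k\<in>?I. (vec_norm (w k))\<^sup>2 - (vec_norm (T j *\<^sub>v w k))\<^sup>2)"
        by (intro sum_nonneg) (simp add: power_mono)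
      then show ?thesis by (simp only: eq Re_complex_of_real)
    qed
    have "0 \<le> Re (\<Sum>j\<in>UNIV. \<Sum>\<alpha>\<in>?I. \<Sum>\<beta>\<in>?I. (B \<alpha> \<beta> - up_entry N j B \<alpha> \<beta>) * A j \<alpha> \<beta>)"
      unfolding Re_sum[of _ UNIV] by (intro sum_nonneg summand)
    then have "Re (hform ?I B (lookup p)) \<le> Re (B 0 0)"
      unfolding sum_shift_defect[symmetric] L by simp
    then have "(vec_norm (mat_poly n p T *\<^sub>v v))\<^sup>2 \<le> (vec_norm v)\<^sup>2" by (simp only: norm_v norm_pv)
    then show "vec_norm (mat_poly n p T *\<^sub>v v) \<le> vec_norm v" by (rule power2_le_imp_le) simp
  qed
qed

section \<open>From (1) to (2)\<close>

lemma mat_eq_on_vecI: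
  fixes A B :: "complex mat"
  assumes "A \<in> carrier_mat n m" "B \<in> carrier_mat n m"
    and "\<And>v. v \<in> carrier_vec m \<Longrightarrow> A *\<^sub>v v = B *\<^sub>v v"
  shows "A = B"
proof (rule eq_matI)
  fix i j assume "i < dim_row B" "j < dim_col B"
  then have ij: "i < n" "j < m" using assms by auto
  have "(M *\<^sub>v unit_vec m j) $ i = M $$ (i, j)" if "M \<in> carrier_mat n m" for M :: "complex mat"
    using that ij by (simp add: mult_mat_vec_index[OF that _ ij(1)] if_distrib[of "\<lambda>x. _ * x"] cong: if_cong)
  then show "A $$ (i, j) = B $$ (i, j)" using assms by (metis unit_vec_carrier)
qed (use assms in auto)

lemma invertible_of_injective:
  fixes A :: "complex mat"
  assumes A: "A \<in> carrier_mat n n" and inj: "\<And>v. v \<in> carrier_vec n \<Longrightarrow> A *\<^sub>v v = 0\<^sub>v n \<Longrightarrow> v = 0\<^sub>v n"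
  shows "\<exists>B\<in>carrier_mat n n. A * B = 1\<^sub>m n \<and> B * A = 1\<^sub>m n"
proof -
  have "det A \<noteq> 0" using det_0_iff_vec_prod_zero_field[OF A] inj by blast
  from det_non_zero_imp_unit[OF A this, of "()"] show ?thesis
    by (auto simp: Units_def ring_mat_def)
qed

text \<open>If \<open>x\<close> holds the coefficients of a combination of the
  \<open>b \<alpha>\<close>, then \<open>shift_fun j x\<close> holds those of its image under
  \<open>T j\<close>.\<close>

definition shift_fun :: "'v \<Rightarrow> ('v mindex \<Rightarrow> complex) \<Rightarrow> 'v mindex \<Rightarrow> complex" where
  "shift_fun j x \<alpha> = (if lookup \<alpha> j > 0 then x (\<alpha> - unit_index j) else 0)"

lemma shift_fun_commute: "shift_fun i (shift_fun j x) = shift_fun j (shift_fun i x)"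
proof -
  have "\<alpha> - unit_index i - unit_index j = \<alpha> - unit_index j - unit_index i" for \<alpha> :: "'a mindex"
    by (rule poly_mapping_eqI) (simp add: lookup_minus)
  then show ?thesis by (auto simp: shift_fun_def fun_eq_iff lookup_minus lookup_unit_index)
qed

lemma shift_fun_delta:
  "shift_fun j (\<lambda>\<gamma>. if \<gamma> = \<alpha> then 1 else 0) = (\<lambda>\<gamma>. if \<gamma> = \<alpha> + unit_index j then 1 else 0)"
proof
  fix \<gamma>
  show "shift_fun j (\<lambda>\<gamma>. if \<gamma> = \<alpha> then 1 else 0) \<gamma> = (if \<gamma> = \<alpha> + unit_index j then 1 else 0)"
    using minus_unit_index_add[of \<gamma> j] by (auto simp: shift_fun_def lookup_add lookup_unit_index)
qed

text \<open>A strictly positive functional on the cone is the Gram matrix of the basis of a simple nilpotent tuple of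
  contractions.\<close>

lemma simple_nilpotent_of_positive_functional:
  fixes G :: "'d::finite mindex \<Rightarrow> 'd mindex \<Rightarrow> complex"
  assumes psd: "psd_matrix (index_set N) G"
    and up: "\<And>j. psd_matrix (index_set N) (\<lambda>\<alpha> \<beta>. G \<alpha> \<beta> - up_entry N j G \<alpha> \<beta>)"
    and pos: "\<And>x. hform (index_set N) G x = 0 \<Longrightarrow> \<forall>\<alpha>\<in>index_set N. x \<alpha> = 0"
  shows "\<exists>n (T :: 'd \<Rightarrow> complex mat) b. simple_nilpotent N n T \<and> contractions T \<and>
    shift_family n T (extend_zero N n b) \<and>
    (\<forall>x. (\<Sum>i<n. (norm (\<Sum>\<alpha>\<in>index_set N. x \<alpha> * b \<alpha> $ i))\<^sup>2) = Re (hform (index_set N) G x))"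
proof -
  let ?I = "index_set N :: 'd mindex set"
  obtain q where q: "\<And>x y. x \<in> ?I \<Longrightarrow> y \<in> ?I \<Longrightarrow> G x y = (\<Sum>k\<in>?I. cnj (q k x) * q k y)"
    using psd_matrix_factor[OF finite_index_set psd] by blast
  define n where "n = card ?I"
  obtain e where e: "bij_betw e {..<n} ?I"
    using ex_bij_betw_nat_finite[OF finite_index_set, of N] by (auto simp: n_def atLeast0LessThan)
  define e' where "e' = the_inv_into {..<n} e"
  have e'e: "\<And>i. i < n \<Longrightarrow> e' (e i) = i" and ee': "\<And>\<alpha>. \<alpha> \<in> ?I \<Longrightarrow> e (e' \<alpha>) = \<alpha>"
    and e'n: "\<And>\<alpha>. \<alpha> \<in> ?I \<Longrightarrow> e' \<alpha> < n" and eI: "\<And>i. i < n \<Longrightarrow> e i \<in> ?I"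
    using e the_inv_into_f_f[of e "{..<n}"] f_the_inv_into_f[of e "{..<n}"] the_inv_into_into[of e "{..<n}" _ "{..<n}"]
    by (auto simp: e'_def bij_betw_def)
  have sum_e: "(\<Sum>l<n. f (e l)) = (\<Sum>\<alpha>\<in>?I. f \<alpha>)" for f :: "'d mindex \<Rightarrow> complex"
    using sum.reindex_bij_betw[OF e] .
  define vecI where "vecI = (\<lambda>x :: 'd mindex \<Rightarrow> complex. vec n (\<lambda>i. x (e i)))"
  have vecI_carrier [simp]: "vecI x \<in> carrier_vec n" for x by (simp add: vecI_def)
  have vecI_cong: "vecI x = vecI y" if "\<And>\<alpha>. \<alpha> \<in> ?I \<Longrightarrow> x \<alpha> = y \<alpha>" for x y
    using that eI by (auto simp: vecI_def)
  have vecI_surj: "v = vecI (\<lambda>\<alpha>. v $ e' \<alpha>)" if "v \<in> carrier_vec n" for v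
    using that by (auto simp: vecI_def e'e)
  \<comment> \<open>A square factor of \<open>G\<close>: its columns are the vectors b_\<alpha> in
    the enumeration \<open>e\<close>, with Gram matrix \<open>G\<close>. Strict positivity makes it
    injective, so the columns form a basis.\<close>
  define M where "M = mat n n (\<lambda>(i, l). q (e i) (e l))"
  have M [simp]: "M \<in> carrier_mat n n" by (simp add: M_def)
  have M_index: "(M *\<^sub>v vecI x) $ i = (\<Sum>\<alpha>\<in>?I. q (e i) \<alpha> * x \<alpha>)" if "i < n" for x i
    unfolding mult_mat_vec_index[OF M vecI_carrier that]
    using that by (simp add: sum_e[of "\<lambda>\<alpha>. q (e i) \<alpha> * x \<alpha>", symmetric] M_def vecI_def)
  have normM: "(\<Sum>i<n. (norm ((M *\<^sub>v vecI x) $ i))\<^sup>2) = Re (hform ?I G x)" for x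
  proof -
    have "complex_of_real (\<Sum>i<n. (norm ((M *\<^sub>v vecI x) $ i))\<^sup>2) = (\<Sum>i<n. of_real ((norm (\<Sum>\<alpha>\<in>?I. q (e i) \<alpha> * x \<alpha>))\<^sup>2))"
      by (simp add: M_index)
    also have "\<dots> = (\<Sum>k\<in>?I. of_real ((norm (\<Sum>\<alpha>\<in>?I. q k \<alpha> * x \<alpha>))\<^sup>2))"
      by (rule sum_e)
    also have "\<dots> = hform ?I G x"
      using hform_gram[OF finite_index_set q, where c = x] by simp
    finally show ?thesis by (metis Re_complex_of_real)
  qed
  have "v = 0\<^sub>v n" if v: "v \<in> carrier_vec n" and 0: "M *\<^sub>v v = 0\<^sub>v n" for v
  proof -
    define x where "x = (\<lambda>\<alpha>. v $ e' \<alpha>)"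
    have vx: "v = vecI x" using vecI_surj[OF v] by (simp add: x_def)
    have "Re (hform ?I G x) = 0" using normM[of x] 0 by (simp add: vx)
    moreover have "Im (hform ?I G x) = 0" using psd by (simp add: psd_matrix_iff complex_nonneg_Reals_iff)
    ultimately have "\<forall>\<alpha>\<in>?I. x \<alpha> = 0" by (intro pos) (simp add: complex_eq_iff)
    then show ?thesis unfolding vx by (auto simp: vecI_def eI)
  qed
  from invertible_of_injective[OF M this] obtain W where W [simp]: "W \<in> carrier_mat n n"
    and WM: "W * M = 1\<^sub>m n" and MW: "M * W = 1\<^sub>m n" by blast
  have W_M: "W *\<^sub>v (M *\<^sub>v v) = v" if "v \<in> carrier_vec n" for v
    using assoc_mult_mat_vec[OF W M that] that by (simp add: WM)
  have M_W: "M *\<^sub>v (W *\<^sub>v v) = v" if "v \<in> carrier_vec n" for v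
    using assoc_mult_mat_vec[OF M W that] that by (simp add: MW)
  have surj: "\<exists>x. v = M *\<^sub>v vecI x" if "v \<in> carrier_vec n" for v
    using M_W[OF that] vecI_surj[of "W *\<^sub>v v"] W that by (metis mult_mat_vec_carrier)
  define S where "S = (\<lambda>j :: 'd. mat n n (\<lambda>(i, l). if e i = e l + unit_index j then 1 else 0 :: complex))"
  have S [simp]: "S j \<in> carrier_mat n n" for j by (simp add: S_def)
  have S_vecI: "S j *\<^sub>v vecI x = vecI (shift_fun j x)" for j x
  proof (rule eq_vecI)
    show "dim_vec (S j *\<^sub>v vecI x) = dim_vec (vecI (shift_fun j x))" by (simp add: S_def vecI_def)
    fix i assume "i < dim_vec (vecI (shift_fun j x))"
    then have i: "i < n" by (simp add: vecI_def)
    have "(S j *\<^sub>v vecI x) $ i = (\<Sum>l<n. (if e i = e l + unit_index j then x (e l) else 0))"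
      using i by (simp add: mult_mat_vec_index[OF S] del: index_mult_mat_vec)
         (simp add: S_def vecI_def if_distrib[of "\<lambda>x. x * _"] cong: if_cong)
    also have "\<dots> = (\<Sum>\<alpha>\<in>?I. if e i = \<alpha> + unit_index j then x \<alpha> else 0)" by (rule sum_e)
    also have "\<dots> = shift_fun j x (e i)"
    proof (cases "lookup (e i) j > 0")
      case True
      then have "e i = \<alpha> + unit_index j \<longleftrightarrow> \<alpha> = e i - unit_index j" for \<alpha>
        using minus_unit_index_add[of "e i" j] by auto
      then show ?thesis using True eI[OF i] by (simp add: shift_fun_def minus_unit_in_index_set)
    next
      case False
      then have "e i \<noteq> \<alpha> + unit_index j" for \<alpha> by (auto simp: lookup_add lookup_unit_index)
      then show ?thesis using False by (simp add: shift_fun_def)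
    qed
    finally show "(S j *\<^sub>v vecI x) $ i = vecI (shift_fun j x) $ i" using i by (simp add: vecI_def)
  qed
  \<comment> \<open>The nilpotent shift transported by \<open>M\<close>: in the basis formed by the
    columns of \<open>M\<close> it is the matrix \<open>S j\<close>.\<close>
  define T where "T = (\<lambda>j. M * (S j * W))"
  have T [simp]: "T j \<in> carrier_mat n n" for j unfolding T_def by (intro mult_carrier_mat[of _ n n] M S W)
  have T_vecI: "T j *\<^sub>v (M *\<^sub>v vecI x) = M *\<^sub>v vecI (shift_fun j x)" for j x
  proof -
    have "T j *\<^sub>v (M *\<^sub>v vecI x) = M *\<^sub>v ((S j * W) *\<^sub>v (M *\<^sub>v vecI x))"
      unfolding T_def by (rule assoc_mult_mat_vec[of _ n n _ n]) (auto intro: mult_carrier_mat[of _ n n] mult_mat_vec_carrier[of _ n n])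
    also have "(S j * W) *\<^sub>v (M *\<^sub>v vecI x) = S j *\<^sub>v (W *\<^sub>v (M *\<^sub>v vecI x))"
      by (rule assoc_mult_mat_vec[of _ n n _ n]) (auto intro: mult_mat_vec_carrier[of _ n n])
    finally show ?thesis by (simp add: W_M S_vecI)
  qed
  define b where "b = (\<lambda>\<alpha>. M *\<^sub>v vecI (\<lambda>\<gamma>. if \<gamma> = \<alpha> then 1 else 0))"
  have b_carrier [simp]: "b \<alpha> \<in> carrier_vec n" for \<alpha> unfolding b_def by (rule mult_mat_vec_carrier[OF M]) simp
  have b_index: "b \<alpha> $ i = q (e i) \<alpha>" if "i < n" "\<alpha> \<in> ?I" for \<alpha> i
    using that by (simp add: b_def M_index if_distrib[of "\<lambda>x. _ * x"] cong: if_cong)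
  have b_shift: "T j *\<^sub>v b \<alpha> = b (\<alpha> + unit_index j)" for j \<alpha>
    by (simp add: b_def T_vecI shift_fun_delta)
  have b_zero: "b \<alpha> = 0\<^sub>v n" if "\<alpha> \<notin> ?I" for \<alpha>
  proof -
    have "vecI (\<lambda>\<gamma>. if \<gamma> = \<alpha> then 1 else 0) = vecI (\<lambda>_. 0)" using that by (intro vecI_cong) auto
    moreover have "vecI (\<lambda>_. 0) = 0\<^sub>v n" by (auto simp: vecI_def)
    ultimately show ?thesis by (auto simp: b_def scalar_prod_def carrier_matD[OF M])
  qed
  have Mb: "(M *\<^sub>v vecI x) $ i = (\<Sum>\<alpha>\<in>?I. x \<alpha> * b \<alpha> $ i)" if "i < n" for x i
    using that by (simp add: M_index b_index mult.commute)
  have "simple_nilpotent N n T"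
    unfolding simple_nilpotent_def
  proof (intro conjI allI exI[of _ b])
    show "T i * T j = T j * T i" for i j
    proof (rule mat_eq_on_vecI)
      fix v :: "complex vec" assume v: "v \<in> carrier_vec n"
      then obtain x where x: "v = M *\<^sub>v vecI x" using surj by blast
      have "(T i * T j) *\<^sub>v v = T i *\<^sub>v (T j *\<^sub>v v)" for i j
        by (rule assoc_mult_mat_vec[OF T T v])
      then show "(T i * T j) *\<^sub>v v = (T j * T i) *\<^sub>v v" by (simp add: x T_vecI shift_fun_commute)
    qed (auto intro: mult_carrier_mat[of _ n n])
    show "msize \<alpha> < N \<longrightarrow> T j *\<^sub>v b \<alpha> = b (\<alpha> + unit_index j)" for j \<alpha> by (simp add: b_shift)
    show "msize \<alpha> = N \<longrightarrow> T j *\<^sub>v b \<alpha> = 0\<^sub>v n" for j \<alpha>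
      using b_zero[of "\<alpha> + unit_index j"] by (simp add: b_shift index_set_def)
    show "b ` index_set N \<subseteq> carrier_vec n" by auto
    interpret V: vec_space "TYPE(complex)" n .
    \<comment> \<open>The combination runs over the image set, so the coefficients, indexed by
      multi-indices, are carried over by the inverse of \<open>b\<close>.\<close>
    have inj: "inj_on b ?I"
    proof (rule inj_onI)
      fix \<alpha> \<beta> assume ab: "\<alpha> \<in> ?I" "\<beta> \<in> ?I" "b \<alpha> = b \<beta>"
      then have "vecI (\<lambda>\<gamma>. if \<gamma> = \<alpha> then 1 else 0) = vecI (\<lambda>\<gamma>. if \<gamma> = \<beta> then 1 else 0)"
        unfolding b_def by (metis W_M vecI_carrier)
      then have "vecI (\<lambda>\<gamma>. if \<gamma> = \<alpha> then 1 else 0) $ e' \<alpha> = vecI (\<lambda>\<gamma>. if \<gamma> = \<beta> then 1 else 0) $ e' \<alpha>"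
        by simp
      then show "\<alpha> = \<beta>" using ab e'n ee' by (auto simp: vecI_def split: if_splits)
    qed
    show "V.span (b ` ?I) = carrier_vec n"
    proof
      show "V.span (b ` ?I) \<subseteq> carrier_vec n" using V.span_is_subset2[of "b ` ?I"] b_carrier unfolding module_vec_simps by (metis (no_types, lifting) image_subsetI)
      show "carrier_vec n \<subseteq> V.span (b ` ?I)"
      proof
        fix v :: "complex vec" assume v: "v \<in> carrier_vec n"
        then obtain x where x: "v = M *\<^sub>v vecI x" using surj by blast
        define a where "a = (\<lambda>w. x (the_inv_into ?I b w))"
        have bI: "finite (b ` ?I)" "b ` ?I \<subseteq> carrier_vec n" by auto
        have dim: "dim_vec (V.lincomb a (b ` ?I)) = n" by (rule V.lincomb_dim[OF bI])
        have "v = V.lincomb a (b ` ?I)"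
        proof (rule eq_vecI)
          show "dim_vec v = dim_vec (V.lincomb a (b ` ?I))"
            using v dim by auto
          fix i assume "i < dim_vec (V.lincomb a (b ` ?I))"
          then have i: "i < n" using dim by auto
          have "V.lincomb a (b ` ?I) $ i = (\<Sum>w\<in>b ` ?I. a w * w $ i)"
            using i by (intro V.lincomb_index) auto
          also have "\<dots> = (\<Sum>\<alpha>\<in>?I. x \<alpha> * b \<alpha> $ i)"
            using inj by (simp add: sum.reindex a_def the_inv_into_f_f)
          finally show "v $ i = V.lincomb a (b ` ?I) $ i" using i by (simp add: x Mb)
        qed
        then show "v \<in> V.span (b ` ?I)"
          unfolding V.span_def using bI(1) by (intro CollectI exI[of _ a] exI[of _ "b ` ?I"] conjI) auto
      qed
    qed
  qed simp
  moreover have "contractions T"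
    unfolding contractions_def
  proof
    fix j
    show "op_norm (T j) \<le> 1"
      unfolding op_norm_le_1_iff[OF T]
    proof
      fix v :: "complex vec" assume v: "v \<in> carrier_vec n"
      then obtain x where x: "v = M *\<^sub>v vecI x" using surj by blast
      have d: "dim_vec (M *\<^sub>v y) = n" for y using carrier_matD[OF M] by simp
      \<comment> \<open>Norms in the range of \<open>M\<close> are values of the form of
        \<open>G\<close>, and the form of \<open>up_entry\<close> at \<open>x\<close> is that of
        \<open>G\<close> at the shifted \<open>x\<close>. Contractivity is thus the dual inequality
        for \<open>j\<close>.\<close>
      have "hform ?I (\<lambda>\<alpha> \<beta>. G \<alpha> \<beta> - up_entry N j G \<alpha> \<beta>) x \<in> \<real>\<^sub>\<ge>\<^sub>0"
        using up by (simp add: psd_matrix_iff)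
      moreover have "hform ?I (\<lambda>\<alpha> \<beta>. G \<alpha> \<beta> - up_entry N j G \<alpha> \<beta>) x = hform ?I G x - hform ?I (up_entry N j G) x"
        by (simp add: hform_def algebra_simps sum_subtractf)
      ultimately have "Re (hform ?I (up_entry N j G) x) \<le> Re (hform ?I G x)"
        by (simp add: complex_nonneg_Reals_iff)
      then have "Re (hform ?I G (shift_fun j x)) \<le> Re (hform ?I G x)"
        unfolding hform_up_entry shift_fun_def .
      then have "(vec_norm (T j *\<^sub>v v))\<^sup>2 \<le> (vec_norm v)\<^sup>2"
        unfolding vec_norm_sq x T_vecI d normM .
      then show "vec_norm (T j *\<^sub>v v) \<le> vec_norm v" by (rule power2_le_imp_le) simp
    qed
  qed
  moreover have "shift_family n T (extend_zero N n b)"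
  proof -
    have "extend_zero N n b = b" using b_zero by (auto simp: extend_zero_def index_set_def)
    then show ?thesis by unfold_locales (simp_all add: b_shift)
  qed
  moreover have "\<forall>x. (\<Sum>i<n. (norm (\<Sum>\<alpha>\<in>?I. x \<alpha> * b \<alpha> $ i))\<^sup>2) = Re (hform ?I G x)"
    by (simp add: Mb flip: normM)
  ultimately show ?thesis by blast
qed

text \<open>The identity minus its raised version is the projection onto the top level, so adding a
  positive multiple of the identity preserves the dual inequalities.\<close>

lemma up_entry_add_delta:
  assumes "\<alpha> \<in> index_set N" "\<beta> \<in> index_set N"
  shows "(\<lambda>\<alpha> \<beta>. G \<alpha> \<beta> + t * (if \<alpha> = \<beta> then 1 else 0)) \<alpha> \<beta> - up_entry N j (\<lambda>\<alpha> \<beta>. G \<alpha> \<beta> + t * (if \<alpha> = \<beta> then 1 else 0)) \<alpha> \<beta>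
    = (G \<alpha> \<beta> - up_entry N j G \<alpha> \<beta>) + t * (if \<alpha> = \<beta> \<and> msize \<alpha> = N then 1 else 0)"
  using assms by (auto simp: up_entry_def index_set_def)

lemma psd_matrix_diagonal_indicator: "psd_matrix I (\<lambda>x y. if x = y \<and> P x then 1 else 0)"
proof (cases "finite I")
  case True
  have "hform I (\<lambda>x y. if x = y \<and> P x then 1 else 0) c \<in> \<real>\<^sub>\<ge>\<^sub>0" for c
  proof -
    have "hform I (\<lambda>x y. if x = y \<and> P x then 1 else 0) c = (\<Sum>x\<in>I. if P x then cnj (c x) * c x else 0)"
      unfolding hform_def
    proof (intro sum.cong refl)
      fix x assume "x \<in> I"
      have "(\<Sum>y\<in>I. cnj (c x) * (if x = y \<and> P x then 1 else 0) * c y)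
        = (\<Sum>y\<in>I. if x = y then (if P x then cnj (c x) * c x else 0) else 0)"
        by (intro sum.cong) auto
      then show "(\<Sum>y\<in>I. cnj (c x) * (if x = y \<and> P x then 1 else 0) * c y) = (if P x then cnj (c x) * c x else 0)"
        using True \<open>x \<in> I\<close> by simp
    qed
    also have "\<dots> \<in> \<real>\<^sub>\<ge>\<^sub>0" using cnj_mult_self_nonneg by (intro nonneg_Reals_sum) auto
    finally show ?thesis .
  qed
  then show ?thesis by (simp add: psd_matrix_iff)
qed (simp add: psd_matrix_def)

lemma nilpotent_contractive_imp_matrix_decomposition:
  fixes p :: "'d::finite cpoly"
  assumes deg: "deg_le p N" and con: "nilpotent_contractive N p"
  shows "matrix_decomposition N p"
proof (rule ccontr)
  let ?I = "index_set N :: 'd mindex set"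
  let ?p = "lookup p"
  assume neg: "\<not> matrix_decomposition N p"
  define H where "H = (\<lambda>\<alpha> \<beta>. (if \<alpha> = 0 \<and> \<beta> = 0 then 1 else 0) - cnj (?p \<alpha>) * ?p \<beta>)"
  have "H \<beta> \<alpha> = cnj (H \<alpha> \<beta>)" for \<alpha> \<beta> by (simp add: H_def mult.commute)
  moreover have "\<not> (\<exists>A. (\<forall>j. psd_matrix ?I (A j)) \<and> (\<forall>\<alpha>\<in>?I. \<forall>\<beta>\<in>?I. H \<alpha> \<beta> = shift_defect A \<alpha> \<beta>))"
    using neg unfolding matrix_decomposition_def shift_defect_def H_def .
  ultimately obtain G where G: "\<And>j. psd_matrix ?I (\<lambda>\<alpha> \<beta>. G \<alpha> \<beta> - up_entry N j G \<alpha> \<beta>)"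
    and GH: "Re (\<Sum>\<alpha>\<in>?I. \<Sum>\<beta>\<in>?I. G \<alpha> \<beta> * H \<alpha> \<beta>) < 0"
    using shift_defect_separation[of N H] by blast
  have Gpsd: "psd_matrix ?I G" using psd_matrix_of_up_entry[OF G] .
  define s where "s = Re (\<Sum>\<alpha>\<in>?I. \<Sum>\<beta>\<in>?I. G \<alpha> \<beta> * H \<alpha> \<beta>)"
  define h where "h = Re (\<Sum>\<alpha>\<in>?I. H \<alpha> \<alpha>)"
  \<comment> \<open>The perturbation changes the value at \<open>H\<close> by \<open>t * h\<close>,
    where \<open>h\<close> is the real part of the trace of \<open>H\<close>. This choice uses up at
    most half of the gap \<open>- s\<close>.\<close>
  define t where "t = - s / (2 * (\<bar>h\<bar> + 1))"
  have t: "t > 0" using GH unfolding t_def by (intro divide_pos_pos) (auto simp only: s_def[symmetric] neg_0_less_iff_less, simp)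
  have "t * h \<le> t * (\<bar>h\<bar> + 1)" using t by (intro mult_left_mono) auto
  also have "\<dots> = - s / 2"
  proof -
    have "\<bar>h\<bar> + 1 \<noteq> 0" by linarith
    then show ?thesis by (simp add: t_def field_simps)
  qed
  finally have sth: "s + t * h < 0" using GH s_def by linarith
  define G' where "G' = (\<lambda>\<alpha> \<beta>. G \<alpha> \<beta> + of_real t * (if \<alpha> = \<beta> then 1 else 0))"
  have t0: "complex_of_real t \<in> \<real>\<^sub>\<ge>\<^sub>0" using t by simp
  have psd': "psd_matrix ?I G'"
    unfolding G'_def using psd_matrix_add_scaled[OF Gpsd _ t0, of "\<lambda>x y. if x = y \<and> True then 1 else 0"]
      psd_matrix_diagonal_indicator[of ?I "\<lambda>_. True"] by simp
  have up': "psd_matrix ?I (\<lambda>\<alpha> \<beta>. G' \<alpha> \<beta> - up_entry N j G' \<alpha> \<beta>)" for j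
  proof -
    have "psd_matrix ?I (\<lambda>\<alpha> \<beta>. (G \<alpha> \<beta> - up_entry N j G \<alpha> \<beta>) + of_real t * (if \<alpha> = \<beta> \<and> msize \<alpha> = N then 1 else 0))"
      by (rule psd_matrix_add_scaled[OF G psd_matrix_diagonal_indicator t0])
    then show ?thesis
      unfolding G'_def using up_entry_add_delta[of _ N _ G "of_real t" j]
      by (subst psd_matrix_cong) auto
  qed
  have diag: "(\<Sum>\<beta>\<in>?I. (if \<alpha> = \<beta> then 1 else 0) * f \<beta>) = f \<alpha>" if "\<alpha> \<in> ?I" for \<alpha> and f :: "'d mindex \<Rightarrow> complex"
    using that by (simp add: if_distrib[of "\<lambda>x. x * _"] cong: if_cong)
  have hform': "hform ?I G' x = hform ?I G x + of_real (t * (\<Sum>\<alpha>\<in>?I. (norm (x \<alpha>))\<^sup>2))" for x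
  proof -
    have "hform ?I G' x = hform ?I G x + of_real t * (\<Sum>\<alpha>\<in>?I. cnj (x \<alpha>) * (\<Sum>\<beta>\<in>?I. (if \<alpha> = \<beta> then 1 else 0) * x \<beta>))"
      by (simp only: hform_def G'_def distrib_left distrib_right sum.distrib sum_distrib_left mult_ac)
    also have "(\<Sum>\<alpha>\<in>?I. cnj (x \<alpha>) * (\<Sum>\<beta>\<in>?I. (if \<alpha> = \<beta> then 1 else 0) * x \<beta>)) = (\<Sum>\<alpha>\<in>?I. of_real ((norm (x \<alpha>))\<^sup>2))"
      by (intro sum.cong refl) (subst diag, assumption, subst complex_norm_square, rule mult.commute)
    finally show ?thesis by simp
  qed
  have "\<forall>\<alpha>\<in>?I. x \<alpha> = 0" if "hform ?I G' x = 0" for x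
  proof -
    have "Re (hform ?I G' x) = 0" using that by simp
    then have "Re (hform ?I G x) + t * (\<Sum>\<alpha>\<in>?I. (norm (x \<alpha>))\<^sup>2) = 0" unfolding hform' by simp
    moreover have "0 \<le> Re (hform ?I G x)" using Gpsd by (simp add: psd_matrix_iff complex_nonneg_Reals_iff)
    moreover have "0 \<le> t * (\<Sum>\<alpha>\<in>?I. (norm (x \<alpha>))\<^sup>2)" using t by (simp add: sum_nonneg)
    ultimately have "t * (\<Sum>\<alpha>\<in>?I. (norm (x \<alpha>))\<^sup>2) = 0" by linarith
    then have "(\<Sum>\<alpha>\<in>?I. (norm (x \<alpha>))\<^sup>2) = 0" using t by simp
    then show ?thesis by (simp add: sum_nonneg_eq_0_iff)
  qed
  from simple_nilpotent_of_positive_functional[OF psd' up' this]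
  obtain n b and T :: "'d \<Rightarrow> complex mat" where sn: "simple_nilpotent N n T" "contractions T"
    and sf: "shift_family n T (extend_zero N n b)"
    and gram: "\<And>x. (\<Sum>i<n. (norm (\<Sum>\<alpha>\<in>?I. x \<alpha> * b \<alpha> $ i))\<^sup>2) = Re (hform ?I G' x)"
    by blast
  interpret shift_family n T "extend_zero N n b" by (rule sf)
  have ext: "extend_zero N n b \<alpha> = b \<alpha>" if "\<alpha> \<in> ?I" for \<alpha> using that by (simp add: extend_zero_def index_set_def)
  have b0: "b 0 \<in> carrier_vec n" using b[of 0] ext[of 0] by simp
  have "op_norm (mat_poly n p T) \<le> 1" using con sn unfolding nilpotent_contractive_def by blast
  then have "vec_norm (mat_poly n p T *\<^sub>v b 0) \<le> vec_norm (b 0)"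
    using op_norm_le_1_iff[OF mat_poly_carrier] b0 by blast
  then have "(vec_norm (mat_poly n p T *\<^sub>v b 0))\<^sup>2 \<le> (vec_norm (b 0))\<^sup>2" by (intro power_mono) simp_all
  moreover have "(vec_norm (b 0))\<^sup>2 = Re (G' 0 0)"
  proof -
    have "(\<Sum>\<alpha>\<in>?I. (if \<alpha> = 0 then 1 else 0) * b \<alpha> $ i) = b 0 $ i" for i
      by (simp add: if_distrib[of "\<lambda>x. x * _"] cong: if_cong)
    then show ?thesis using gram[of "\<lambda>\<alpha>. if \<alpha> = 0 then 1 else 0"] b0
        hform_single[OF finite_index_set zero_in_index_set, of N G' 1]
      by (simp add: vec_norm_sq)
  qed
  moreover have "(vec_norm (mat_poly n p T *\<^sub>v b 0))\<^sup>2 = Re (hform ?I G' ?p)"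
  proof -
    have "(mat_poly n p T *\<^sub>v b 0) $ i = (\<Sum>\<alpha>\<in>?I. ?p \<alpha> * b \<alpha> $ i)" if i: "i < n" for i
    proof -
      have "(mat_poly n p T *\<^sub>v b 0) $ i = (\<Sum>\<alpha>\<in>keys p. ?p \<alpha> * extend_zero N n b \<alpha> $ i)"
        using mat_poly_mult_vec[OF b0 i, of p] mat_monom_shift[of _ 0] ext[of 0] by simp
      also have "\<dots> = (\<Sum>\<alpha>\<in>?I. ?p \<alpha> * b \<alpha> $ i)"
        using deg by (intro sum.mono_neutral_cong_left) (auto simp: deg_le_def in_keys_iff ext)
      finally show ?thesis .
    qed
    moreover have "dim_vec (mat_poly n p T *\<^sub>v b 0) = n" by (simp add: mat_poly_def)
    ultimately show ?thesis by (simp add: vec_norm_sq del: index_mult_mat_vec flip: gram)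
  qed
  \<comment> \<open>The pairing of \<open>G'\<close> with \<open>H\<close>: it is negative by the
    choice of \<open>t\<close>, while contractivity at the vector b_0 has just made it
    nonnegative.\<close>
  moreover have "Re (G' 0 0) - Re (hform ?I G' ?p) = s + t * h"
  proof -
    have "(\<Sum>\<alpha>\<in>?I. \<Sum>\<beta>\<in>?I. G' \<alpha> \<beta> * H \<alpha> \<beta>) = (\<Sum>\<alpha>\<in>?I. \<Sum>\<beta>\<in>?I. G \<alpha> \<beta> * H \<alpha> \<beta>)
        + of_real t * (\<Sum>\<alpha>\<in>?I. \<Sum>\<beta>\<in>?I. (if \<alpha> = \<beta> then 1 else 0) * H \<alpha> \<beta>)"
      by (simp only: G'_def distrib_right sum.distrib sum_distrib_left mult.assoc)
    also have "(\<Sum>\<alpha>\<in>?I. \<Sum>\<beta>\<in>?I. (if \<alpha> = \<beta> then 1 else 0) * H \<alpha> \<beta>) = (\<Sum>\<alpha>\<in>?I. H \<alpha> \<alpha>)"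
      by (intro sum.cong refl diag)
    finally have "Re (\<Sum>\<alpha>\<in>?I. \<Sum>\<beta>\<in>?I. G' \<alpha> \<beta> * H \<alpha> \<beta>) = s + t * h" by (simp add: s_def h_def)
    moreover have "(\<Sum>\<alpha>\<in>?I. \<Sum>\<beta>\<in>?I. G' \<alpha> \<beta> * H \<alpha> \<beta>)
        = (\<Sum>\<alpha>\<in>?I. \<Sum>\<beta>\<in>?I. G' \<alpha> \<beta> * (if \<alpha> = 0 \<and> \<beta> = 0 then 1 else 0)) - hform ?I G' ?p"
      by (simp only: H_def right_diff_distrib sum_subtractf hform_rank_one)
    moreover have "(\<Sum>\<alpha>\<in>?I. \<Sum>\<beta>\<in>?I. G' \<alpha> \<beta> * (if \<alpha> = 0 \<and> \<beta> = 0 then 1 else 0)) = (\<Sum>\<alpha>\<in>?I. if \<alpha> = 0 then G' 0 0 else 0)"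
      by (intro sum.cong refl) (auto simp: if_distrib[of "\<lambda>x. _ * x"] cong: if_cong)
    moreover have "(\<Sum>\<alpha>\<in>?I. if \<alpha> = 0 then G' 0 0 else 0) = G' 0 0" by simp
    ultimately show ?thesis by simp
  qed
  ultimately show False using sth by linarith
qed

subsection \<open>Isometries between finite families with equal Gram matrices\<close>

definition cinner :: "nat \<Rightarrow> complex vec \<Rightarrow> complex vec \<Rightarrow> complex" where
  "cinner n v w = (\<Sum>i<n. cnj (v $ i) * w $ i)"

definition isometry_mat :: "nat \<Rightarrow> complex mat \<Rightarrow> bool" where
  "isometry_mat n V \<longleftrightarrow> V \<in> carrier_mat n n \<and>
    (\<forall>v\<in>carrier_vec n. \<forall>w\<in>carrier_vec n. cinner n (V *\<^sub>v v) (V *\<^sub>v w) = cinner n v w)"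

lemma cinner_self: "cinner n v v = of_real (\<Sum>i<n. (norm (v $ i))\<^sup>2)"
  by (simp only: cinner_def of_real_sum complex_norm_square mult.commute)

lemma cinner_commute: "cinner n w v = cnj (cinner n v w)"
  by (simp add: cinner_def mult.commute)

lemma cinner_diff_left:
  "v \<in> carrier_vec n \<Longrightarrow> w \<in> carrier_vec n \<Longrightarrow> cinner n (v - w) u = cinner n v u - cinner n w u"
  by (auto simp: cinner_def algebra_simps sum_subtractf[symmetric] intro!: sum.cong)

lemma cinner_diff_right:
  "v \<in> carrier_vec n \<Longrightarrow> w \<in> carrier_vec n \<Longrightarrow> cinner n u (v - w) = cinner n u v - cinner n u w"
  by (auto simp: cinner_def algebra_simps sum_subtractf[symmetric] intro!: sum.cong)

lemma cinner_smult_right: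
  "v \<in> carrier_vec n \<Longrightarrow> cinner n u (c \<cdot>\<^sub>v v) = c * cinner n u v"
  by (auto simp: cinner_def sum_distrib_left intro!: sum.cong)

lemma cinner_smult_left:
  "v \<in> carrier_vec n \<Longrightarrow> cinner n (c \<cdot>\<^sub>v v) u = cnj c * cinner n v u"
  by (auto simp: cinner_def sum_distrib_left intro!: sum.cong)

text \<open>With \<open>u = x - y\<close> and \<open>c = 1 / (u\<^sup>* x)\<close> the complex reflection \<open>1 - c u u\<^sup>*\<close> takes \<open>x\<close> to \<open>y\<close>; it is isometric
  because \<open>|u|\<^sup>2 = 2 Re (u\<^sup>* x)\<close>.\<close>

lemma reflection_exists:
  assumes x: "x \<in> carrier_vec n" and y: "y \<in> carrier_vec n" and xy: "cinner n x x = cinner n y y"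
  shows "\<exists>W. isometry_mat n W \<and> W *\<^sub>v x = y \<and> (\<forall>v\<in>carrier_vec n. cinner n (x - y) v = 0 \<longrightarrow> W *\<^sub>v v = v)"
proof (cases "x = y")
  case True
  then show ?thesis using y by (intro exI[of _ "1\<^sub>m n"]) (simp add: isometry_mat_def)
next
  case False
  define u where "u = x - y"
  have u: "u \<in> carrier_vec n" using x y by (simp add: u_def)
  define s where "s = cinner n u x"
  have uu: "cinner n u u = s + cnj s"
  proof -
    have "cinner n u u = cinner n x x - cinner n x y - cinner n y x + cinner n y y"
      unfolding u_def using x y by (simp add: cinner_diff_left cinner_diff_right)
    moreover have "s = cinner n x x - cinner n y x" "cnj s = cinner n x x - cinner n x y"
      unfolding s_def u_def using x y
      by (simp_all add: cinner_diff_left flip: cinner_commute)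
    ultimately show ?thesis using xy by simp
  qed
  have "s \<noteq> 0"
  proof
    assume "s = 0"
    then have "(\<Sum>i<n. (norm (u $ i))\<^sup>2) = 0" using uu cinner_self[of n u] by (metis add_0 complex_cnj_zero of_real_eq_0_iff)
    then have "\<forall>i<n. u $ i = 0" by (simp add: sum_nonneg_eq_0_iff)
    then have "\<forall>i<n. x $ i = y $ i" using x y by (simp add: u_def)
    then show False using False x y by auto
  qed
  define c where "c = 1 / s"
  \<comment> \<open>The condition for \<open>1 - c u u^*\<close> to preserve inner products, once
    |u|^2 is replaced by \<open>s + cnj s\<close>.\<close>
  have c: "cnj c * c * (s + cnj s) = c + cnj c" using \<open>s \<noteq> 0\<close> by (simp add: c_def field_simps)
  define W where "W = mat n n (\<lambda>(i, j). (if i = j then 1 else 0) - c * u $ i * cnj (u $ j))"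
  have W: "W \<in> carrier_mat n n" by (simp add: W_def)
  have Wv: "W *\<^sub>v v = v - (c * cinner n u v) \<cdot>\<^sub>v u" if v: "v \<in> carrier_vec n" for v
  proof (rule eq_vecI)
    show "dim_vec (W *\<^sub>v v) = dim_vec (v - (c * cinner n u v) \<cdot>\<^sub>v u)" using v u W by simp
    fix i assume "i < dim_vec (v - (c * cinner n u v) \<cdot>\<^sub>v u)"
    then have i: "i < n" using v u by simp
    have "(W *\<^sub>v v) $ i = (\<Sum>k<n. (if i = k then 1 else 0) * v $ k - c * u $ i * (cnj (u $ k) * v $ k))"
      unfolding mult_mat_vec_index[OF W v i] using i by (intro sum.cong) (simp_all add: W_def algebra_simps)
    also have "\<dots> = v $ i - c * u $ i * cinner n u v"
      using i by (simp add: sum_subtractf sum_distrib_left cinner_def if_distrib[of "\<lambda>x. x * _"] cong: if_cong)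
    finally show "(W *\<^sub>v v) $ i = (v - (c * cinner n u v) \<cdot>\<^sub>v u) $ i" using i v u by (simp add: mult_ac)
  qed
  have "isometry_mat n W"
    unfolding isometry_mat_def
  proof (intro conjI W ballI)
    fix v w :: "complex vec" assume v: "v \<in> carrier_vec n" and w: "w \<in> carrier_vec n"
    let ?a = "cinner n u v" and ?b = "cinner n u w"
    have "cinner n (W *\<^sub>v v) (W *\<^sub>v w)
      = cinner n v w - c * ?b * cinner n v u - (cnj (c * ?a) * ?b - cnj (c * ?a) * (c * ?b * cinner n u u))"
      unfolding Wv[OF v] Wv[OF w] using u v w
      by (simp add: cinner_diff_left cinner_diff_right cinner_smult_left cinner_smult_right algebra_simps)
    also have "cinner n v u = cnj ?a" by (rule cinner_commute)
    also have "cinner n v w - c * ?b * cnj ?a - (cnj (c * ?a) * ?b - cnj (c * ?a) * (c * ?b * cinner n u u))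
      = cinner n v w + cnj ?a * ?b * (cnj c * c * (s + cnj s) - (c + cnj c))"
      unfolding uu by (simp add: algebra_simps)
    also have "\<dots> = cinner n v w" unfolding c by simp
    finally show "cinner n (W *\<^sub>v v) (W *\<^sub>v w) = cinner n v w" .
  qed
  moreover have "W *\<^sub>v x = y"
  proof -
    have "W *\<^sub>v x = x - 1 \<cdot>\<^sub>v u" using \<open>s \<noteq> 0\<close> by (simp add: Wv[OF x] c_def flip: s_def)
    then show ?thesis using x y by (auto simp: u_def)
  qed
  moreover have "W *\<^sub>v v = v" if "v \<in> carrier_vec n" "cinner n (x - y) v = 0" for v
    using that u by (auto simp: Wv[OF that(1)] u_def[symmetric])
  ultimately show ?thesis by blast
qed

lemma isometry_mat_mult:
  assumes "isometry_mat n V" "isometry_mat n W"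
  shows "isometry_mat n (W * V)"
  using assms unfolding isometry_mat_def
  by (auto simp: assoc_mult_mat_vec[of _ n n _ n] intro: mult_mat_vec_carrier[of _ n n] mult_carrier_mat[of _ n n])

text \<open>When \<open>V\<close> already carries the earlier vectors, a reflection takes
  \<open>V *\<^sub>v X a\<close> to \<open>Y a\<close>. It does not disturb the earlier ones:
  equality of the Gram entries makes \<open>V *\<^sub>v X a - Y a\<close> orthogonal to every
  \<open>Y b\<close> already placed. The result is unitary on the whole space, even for linearly
  dependent families.\<close>

lemma isometry_of_equal_gram:
  assumes "finite I"
    and "\<And>a. a \<in> I \<Longrightarrow> X a \<in> carrier_vec n" "\<And>a. a \<in> I \<Longrightarrow> Y a \<in> carrier_vec n"
    and "\<And>a b. a \<in> I \<Longrightarrow> b \<in> I \<Longrightarrow> cinner n (X a) (X b) = cinner n (Y a) (Y b)"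
  shows "\<exists>V. isometry_mat n V \<and> (\<forall>a\<in>I. V *\<^sub>v X a = Y a)"
  using assms
proof (induction I rule: finite_induct)
  case empty
  then show ?case by (intro exI[of _ "1\<^sub>m n"]) (simp add: isometry_mat_def)
next
  case (insert a I)
  have "\<exists>V. isometry_mat n V \<and> (\<forall>a\<in>I. V *\<^sub>v X a = Y a)"
    using insert.prems by (intro insert.IH) auto
  then obtain V where V: "isometry_mat n V" "\<And>b. b \<in> I \<Longrightarrow> V *\<^sub>v X b = Y b" by blast
  have Vc: "V \<in> carrier_mat n n" using V by (simp add: isometry_mat_def)
  have Xa: "X a \<in> carrier_vec n" and Ya: "Y a \<in> carrier_vec n" using insert.prems by auto
  have Vx: "V *\<^sub>v X a \<in> carrier_vec n" using Vc Xa by simp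
  have "cinner n (V *\<^sub>v X a) (V *\<^sub>v X a) = cinner n (Y a) (Y a)"
    using V(1) Xa insert.prems(3) by (simp add: isometry_mat_def)
  from reflection_exists[OF Vx Ya this] obtain W where W: "isometry_mat n W" "W *\<^sub>v (V *\<^sub>v X a) = Y a"
    "\<And>v. v \<in> carrier_vec n \<Longrightarrow> cinner n (V *\<^sub>v X a - Y a) v = 0 \<Longrightarrow> W *\<^sub>v v = v" by blast
  have Wc: "W \<in> carrier_mat n n" using W by (simp add: isometry_mat_def)
  have "(W * V) *\<^sub>v X b = Y b" if b: "b \<in> insert a I" for b
  proof -
    have Xb: "X b \<in> carrier_vec n" "Y b \<in> carrier_vec n" using insert.prems b by auto
    have WV: "(W * V) *\<^sub>v X b = W *\<^sub>v (V *\<^sub>v X b)" by (rule assoc_mult_mat_vec[OF Wc Vc Xb(1)])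
    show ?thesis
    proof (cases "b = a")
      case True
      then show ?thesis using WV W(2) by simp
    next
      case False
      then have Yb: "V *\<^sub>v X b = Y b" using b V(2) by simp
      have "cinner n (V *\<^sub>v X a - Y a) (Y b) = cinner n (V *\<^sub>v X a) (V *\<^sub>v X b) - cinner n (Y a) (Y b)"
        using Vx Ya by (simp only: cinner_diff_left Yb)
      also have "\<dots> = 0" using V(1) Xa Xb insert.prems(3)[of a b] b by (simp add: isometry_mat_def)
      finally show ?thesis using W(3)[OF Xb(2)] WV Yb by simp
    qed
  qed
  then show ?case using isometry_mat_mult[OF V(1) W(1)] by blast
qed

subsection \<open>Polynomial evaluation\<close>

lemma eval_poly_superset:
  assumes "finite S" "keys p \<subseteq> S"
  shows "eval_poly p z = (\<Sum>\<alpha>\<in>S. lookup p \<alpha> * monom_at z \<alpha>)"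
  unfolding subst_poly_def using assms by (intro sum.mono_neutral_left) (auto simp: in_keys_iff)

lemma monom_at_add: "monom_at z (\<alpha> + \<beta>) = monom_at z \<alpha> * monom_at z \<beta>"
  by (simp add: monom_at_def lookup_add power_add prod.distrib)

lemma monom_at_zero [simp]: "monom_at z 0 = 1"
  by (simp add: monom_at_def)

lemma monom_at_unit_index [simp]: "monom_at z (unit_index j) = z j"
  by (simp add: monom_at_def lookup_unit_index if_distrib[of "\<lambda>n. _ ^ n"] cong: if_cong)

lemma eval_poly_add: "eval_poly (p + q) z = eval_poly p z + eval_poly q z"
proof -
  let ?S = "keys p \<union> keys q"
  have "keys (p + q) \<subseteq> ?S" by (rule Poly_Mapping.keys_add)
  then show ?thesis
    using eval_poly_superset[of ?S p z] eval_poly_superset[of ?S q z] eval_poly_superset[of ?S "p + q" z]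
    by (simp add: lookup_add distrib_right sum.distrib)
qed

lemma eval_poly_single: "eval_poly (single k c) z = c * monom_at z k"
  by (cases "c = 0") (simp_all add: subst_poly_def)

lemma eval_poly_zero [simp]: "eval_poly 0 z = 0"
  by (simp add: subst_poly_def)

lemma eval_poly_sum: "eval_poly (\<Sum>i\<in>S. f i) z = (\<Sum>i\<in>S. eval_poly (f i) z)"
  by (induction S rule: infinite_finite_induct) (simp_all add: eval_poly_add)

lemma eval_poly_mult: "eval_poly (p * q) z = eval_poly p z * eval_poly q z"
proof -
  have "p * q = (\<Sum>k\<in>keys p. single k (lookup p k))
      * (\<Sum>l\<in>keys q. single l (lookup q l))"
    by (simp flip: poly_mapping_sum_single)
  also have "\<dots> = (\<Sum>k\<in>keys p. \<Sum>l\<in>keys q.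
      single (k + l) (lookup p k * lookup q l))"
    by (simp add: sum_product mult_single)
  finally have "eval_poly (p * q) z = (\<Sum>k\<in>keys p. \<Sum>l\<in>keys q.
      (lookup p k * monom_at z k) * (lookup q l * monom_at z l))"
    by (simp add: eval_poly_sum eval_poly_single monom_at_add mult_ac)
  then show ?thesis by (simp add: subst_poly_def sum_product)
qed

lemma eval_poly_Const [simp]: "eval_poly (Const c) z = c"
  by (simp add: Const_def eval_poly_single)

lemma eval_poly_Var [simp]: "eval_poly (Var v) z = z v"
  by (simp add: Var_def eval_poly_single)

lemma eval_poly_one [simp]: "eval_poly 1 z = 1"
  using eval_poly_single[where k = 0 and c = 1 and z = z] by (simp add: single_one)

text \<open>Ring homomorphisms commute with determinants, so determinants over the polynomial ring
  can be evaluated entry by entry.\<close>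

lemma eval_poly_hom: "comm_ring_hom (\<lambda>p. eval_poly p z)"
  by unfold_locales (simp_all add: eval_poly_add eval_poly_mult)

subsection \<open>Transfer functions of isometries\<close>

text \<open>Coordinate \<open>0\<close> carries the scalar part; every other coordinate \<open>i\<close> is multiplied by the variable \<open>g i\<close>.\<close>

definition var_diag :: "(nat \<Rightarrow> 'd) \<Rightarrow> ('d \<Rightarrow> 'a::one) \<Rightarrow> nat \<Rightarrow> 'a" where
  "var_diag g z i = (if i = 0 then 1 else z (g i))"

text \<open>The matrix \<open>1 - E V D\<close>, with \<open>D\<close> the diagonal matrix of
  \<open>d\<close> and \<open>E\<close> the projection that kills coordinate 0. The entry ring is
  left open so that both polynomials and their values can be inserted.\<close>

definition denom_mat :: "nat \<Rightarrow> (nat \<Rightarrow> nat \<Rightarrow> 'a) \<Rightarrow> (nat \<Rightarrow> 'a) \<Rightarrow> 'a::comm_ring_1 mat" where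
  "denom_mat n V d = mat n n (\<lambda>(i, j). (if i = j then 1 else 0) - (if i = 0 then 0 else V i j * d j))"

text \<open>\<open>denom_mat\<close> with row 0 replaced by row 0 of \<open>V D\<close>. Applied to
  a solution of \<open>(1 - E V D) h = e_0\<close> it returns the scalar output in coordinate 0 and
  zeros elsewhere, which makes it the numerator in Cramer's rule.\<close>

definition numer_mat :: "nat \<Rightarrow> (nat \<Rightarrow> nat \<Rightarrow> 'a) \<Rightarrow> (nat \<Rightarrow> 'a) \<Rightarrow> 'a::comm_ring_1 mat" where
  "numer_mat n V d = mat n n (\<lambda>(i, j). if i = 0 then V i j * d j else (if i = j then 1 else 0) - V i j * d j)"

lemma denom_mat_carrier [simp]: "denom_mat n V d \<in> carrier_mat n n"
  by (simp add: denom_mat_def)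

lemma numer_mat_carrier [simp]: "numer_mat n V d \<in> carrier_mat n n"
  by (simp add: numer_mat_def)

lemma (in comm_ring_hom) hom_det_denom_mat:
  "hom (det (denom_mat n V d)) = det (denom_mat n (\<lambda>i j. hom (V i j)) (\<lambda>i. hom (d i)))"
proof -
  have "map_mat hom (denom_mat n V d) = denom_mat n (\<lambda>i j. hom (V i j)) (\<lambda>i. hom (d i))"
    by (rule eq_matI) (auto simp: denom_mat_def hom_distribs)
  then show ?thesis by (metis hom_det)
qed

lemma (in comm_ring_hom) hom_det_numer_mat:
  "hom (det (numer_mat n V d)) = det (numer_mat n (\<lambda>i j. hom (V i j)) (\<lambda>i. hom (d i)))"
proof -
  have "map_mat hom (numer_mat n V d) = numer_mat n (\<lambda>i j. hom (V i j)) (\<lambda>i. hom (d i))"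
    by (rule eq_matI) (auto simp: numer_mat_def hom_distribs)
  then show ?thesis by (metis hom_det)
qed

text \<open>Cramer's rule: the adjugate is applied to both sides of \<open>A h = c e_0\<close>, and
  only the cofactor at (0, 0) survives.\<close>

lemma det_times_component_0:
  fixes A :: "complex mat"
  assumes A: "A \<in> carrier_mat n n" and h: "h \<in> carrier_vec n" and n: "0 < n"
    and Ah: "\<And>i. i < n \<Longrightarrow> (A *\<^sub>v h) $ i = (if i = 0 then c else 0)"
  shows "det A * h $ 0 = c * det (mat_delete A 0 0)"
proof -
  have adj: "adj_mat A \<in> carrier_mat n n" "adj_mat A * A = det A \<cdot>\<^sub>m 1\<^sub>m n"
    using adj_mat[OF A] by auto
  have "(adj_mat A * A) *\<^sub>v h = adj_mat A *\<^sub>v (A *\<^sub>v h)"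
    by (rule assoc_mult_mat_vec[OF adj(1) A h])
  moreover have "((det A \<cdot>\<^sub>m 1\<^sub>m n) *\<^sub>v h) $ 0 = det A * h $ 0"
    using h n by (subst mult_mat_vec_index[of _ n n]) (simp_all add: if_distrib[of "\<lambda>x. _ * x"] if_distrib[of "\<lambda>x. x * _"] cong: if_cong)
  moreover have "(adj_mat A *\<^sub>v (A *\<^sub>v h)) $ 0 = (\<Sum>k<n. adj_mat A $$ (0, k) * (if k = 0 then c else 0))"
    using Ah mult_mat_vec_index[OF adj(1) mult_mat_vec_carrier[OF A h] n] by simp
  moreover have "\<dots> = c * det (mat_delete A 0 0)"
    using n A by (simp add: if_distrib[of "\<lambda>x. _ * x"] adj_mat_def cofactor_def carrier_matD cong: if_cong)
  ultimately show ?thesis by (simp add: adj(2))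
qed

text \<open>The two matrices differ in row \<open>0\<close> only, so they share the cofactor at \<open>(0, 0)\<close>.\<close>

lemma det_numer_eq:
  fixes V :: "nat \<Rightarrow> nat \<Rightarrow> complex"
  assumes n: "0 < n" and h: "h \<in> carrier_vec n" and Dh: "denom_mat n V d *\<^sub>v h = unit_vec n 0"
  shows "det (numer_mat n V d) = (\<Sum>k<n. V 0 k * (d k * h $ k)) * det (denom_mat n V d)"
proof -
  let ?A = "denom_mat n V d" and ?B = "numer_mat n V d"
  define c where "c = (\<Sum>k<n. V 0 k * (d k * h $ k))"
  have A: "(?A *\<^sub>v h) $ i = (if i = 0 then 1 else 0)" if "i < n" for i
    unfolding Dh using that by simp
  have h0: "h $ 0 = 1"
    using A[OF n] h n unfolding mult_mat_vec_index[OF denom_mat_carrier h n]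
    by (simp add: denom_mat_def if_distrib[of "\<lambda>x. x * _"] cong: if_cong)
  have B: "(?B *\<^sub>v h) $ i = (if i = 0 then c else 0)" if i: "i < n" for i
  proof (cases "i = 0")
    case True
    then show ?thesis using n unfolding mult_mat_vec_index[OF numer_mat_carrier h i]
      by (simp add: numer_mat_def c_def mult.assoc)
  next
    case False
    then have "(?B *\<^sub>v h) $ i = (?A *\<^sub>v h) $ i"
      using i unfolding mult_mat_vec_index[OF numer_mat_carrier h i] mult_mat_vec_index[OF denom_mat_carrier h i]
      by (simp add: numer_mat_def denom_mat_def)
    then show ?thesis using A[OF i] False by simp
  qed
  have "mat_delete ?A 0 0 = mat_delete ?B 0 0"
    by (rule eq_matI) (auto simp: mat_delete_def denom_mat_def numer_mat_def)
  then show ?thesis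
    using det_times_component_0[OF denom_mat_carrier h n A] det_times_component_0[OF numer_mat_carrier h n B] h0
    by (simp add: c_def)
qed

section \<open>Unitary matrices and equal moduli on the torus\<close>

definition dagger :: "complex mat \<Rightarrow> complex mat" where
  "dagger A = transpose_mat (map_mat cnj A)"

lemma det_dagger: "A \<in> carrier_mat n n \<Longrightarrow> det (dagger A) = cnj (det A)"
proof -
  interpret comm_ring_hom cnj by unfold_locales auto
  assume "A \<in> carrier_mat n n"
  then have "det (dagger A) = det (map_mat cnj A)"
    unfolding dagger_def by (intro det_transpose[of _ n]) simp
  then show ?thesis by simp
qed

lemma mult_mat_index:
  "A \<in> carrier_mat n m \<Longrightarrow> B \<in> carrier_mat m l \<Longrightarrow> i < n \<Longrightarrow> j < l \<Longrightarrow> (A * B) $$ (i, j) = (\<Sum>k<m. A $$ (i, k) * B $$ (k, j))"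
  by (auto simp: scalar_prod_def atLeast0LessThan)

lemma dagger_carrier: "A \<in> carrier_mat n n \<Longrightarrow> dagger A \<in> carrier_mat n n"
  by (simp add: dagger_def)

lemma dagger_index: "A \<in> carrier_mat n n \<Longrightarrow> i < n \<Longrightarrow> j < n \<Longrightarrow> dagger A $$ (i, j) = cnj (A $$ (j, i))"
  by (simp add: dagger_def)

lemma isometry_mat_dagger:
  assumes "isometry_mat n U"
  shows "dagger U * U = 1\<^sub>m n"
proof (rule eq_matI)
  have U: "U \<in> carrier_mat n n" using assms by (simp add: isometry_mat_def)
  fix i j assume "i < dim_row (1\<^sub>m n)" "j < dim_col (1\<^sub>m n)"
  then have ij: "i < n" "j < n" by auto
  have col: "(U *\<^sub>v unit_vec n j) $ k = U $$ (k, j)" if "k < n" "j < n" for k j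
    using that unfolding mult_mat_vec_index[OF U unit_vec_carrier that(1)]
    by (simp add: if_distrib[of "\<lambda>x. _ * x"] cong: if_cong)
  have "(dagger U * U) $$ (i, j) = (\<Sum>k<n. cnj (U $$ (k, i)) * U $$ (k, j))"
    using ij U by (simp add: mult_mat_index[OF dagger_carrier[OF U] U ij] dagger_index del: index_mult_mat)
  also have "\<dots> = cinner n (U *\<^sub>v unit_vec n i) (U *\<^sub>v unit_vec n j)"
    using ij by (simp add: cinner_def col del: index_mult_mat_vec)
  also have "\<dots> = cinner n (unit_vec n i) (unit_vec n j)"
    using assms by (simp add: isometry_mat_def)
  also have "\<dots> = (\<Sum>k<n. if k = i then (if i = j then 1 else 0) else 0)"
    unfolding cinner_def using ij by (intro sum.cong) auto
  finally show "(dagger U * U) $$ (i, j) = 1\<^sub>m n $$ (i, j)" using ij by simp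
qed (use assms in \<open>auto simp: isometry_mat_def dagger_def\<close>)

lemma norm_eq_1_of_sq: "(z::complex) * w = 1 \<Longrightarrow> norm w = norm z \<Longrightarrow> norm z = 1"
proof -
  assume "z * w = 1" "norm w = norm z"
  then have "(norm z)\<^sup>2 = 1" by (metis norm_mult norm_one power2_eq_square)
  then show "norm z = 1" using norm_ge_zero[of z] by (auto simp: power2_eq_1_iff)
qed

text \<open>Write \<open>E = diag (0, 1, \<dots>, 1)\<close> and \<open>J = diag (1, -1, \<dots>, -1)\<close>. The numerator matrix is \<open>J (U - E)\<close>, the
  denominator matrix is \<open>1 - E U\<close>, and \<open>U\<^sup>* (U - E) = (1 - E U)\<^sup>*\<close> when \<open>U\<close> is unitary. This covers the points
  of the torus where both determinants vanish.\<close>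

lemma norm_det_numer_eq_denom:
  fixes V :: "nat \<Rightarrow> nat \<Rightarrow> complex"
  assumes U: "isometry_mat n (mat n n (\<lambda>(i, j). V i j * d j))"
  shows "norm (det (denom_mat n V d)) = norm (det (numer_mat n V d))"
proof -
  define W where "W = mat n n (\<lambda>(i, j). V i j * d j)"
  have W: "W \<in> carrier_mat n n" by (simp add: W_def)
  define X where "X = mat n n (\<lambda>(i, j). V i j * d j - (if i = j \<and> i \<noteq> 0 then 1 else 0))"
  have X: "X \<in> carrier_mat n n" by (simp add: X_def)
  define J :: "complex mat" where "J = mat n n (\<lambda>(i, j). if i = j then (if i = 0 then 1 else -1) else 0)"
  have J: "J \<in> carrier_mat n n" by (simp add: J_def)
  have JJ: "J * J = 1\<^sub>m n"
  proof (rule eq_matI)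
    fix i j assume "i < dim_row (1\<^sub>m n)" "j < dim_col (1\<^sub>m n)"
    then have ij: "i < n" "j < n" by auto
    have "(J * J) $$ (i, j) = (\<Sum>k<n. if k = i then (if i = j then 1 else 0) else 0)"
      unfolding mult_mat_index[OF J J ij] using ij by (intro sum.cong) (auto simp: J_def)
    then show "(J * J) $$ (i, j) = 1\<^sub>m n $$ (i, j)" using ij by simp
  qed (use J in auto)
  have JX: "J * X = numer_mat n V d"
  proof (rule eq_matI)
    fix i j assume "i < dim_row (numer_mat n V d)" "j < dim_col (numer_mat n V d)"
    then have ij: "i < n" "j < n" by (auto simp: numer_mat_def)
    have "(J * X) $$ (i, j) = (\<Sum>k<n. if k = i then (if i = 0 then 1 else -1) * X $$ (i, j) else 0)"
      unfolding mult_mat_index[OF J X ij] using ij by (intro sum.cong) (auto simp: J_def)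
    then show "(J * X) $$ (i, j) = numer_mat n V d $$ (i, j)" using ij by (simp add: X_def numer_mat_def)
  qed (use J X in \<open>auto simp: numer_mat_def\<close>)
  have dW: "dagger W * W = 1\<^sub>m n" using isometry_mat_dagger U by (simp add: W_def)
  have WX: "dagger W * X = dagger (denom_mat n V d)"
  proof (rule eq_matI)
    fix i j assume "i < dim_row (dagger (denom_mat n V d))" "j < dim_col (dagger (denom_mat n V d))"
    then have ij: "i < n" "j < n" by (auto simp: denom_mat_def dagger_def)
    have "(dagger W * X) $$ (i, j) = (\<Sum>k<n. dagger W $$ (i, k) * X $$ (k, j))"
      by (rule mult_mat_index[OF dagger_carrier[OF W] X ij])
    also have "\<dots> = (\<Sum>k<n. dagger W $$ (i, k) * W $$ (k, j) - (if k = j then (if j = 0 then 0 else cnj (V j i * d i)) else 0))"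
    proof (intro sum.cong refl)
      fix k assume "k \<in> {..<n}"
      then have k: "k < n" by simp
      have "dagger W $$ (i, k) = cnj (V k i * d i)"
        using ij k by (simp add: dagger_index[OF W]) (simp add: W_def)
      then show "dagger W $$ (i, k) * X $$ (k, j) = dagger W $$ (i, k) * W $$ (k, j)
          - (if k = j then (if j = 0 then 0 else cnj (V j i * d i)) else 0)"
        using ij k by (auto simp: X_def W_def algebra_simps)
    qed
    also have "\<dots> = (dagger W * W) $$ (i, j) - (if j = 0 then 0 else cnj (V j i * d i))"
      using ij by (simp add: sum_subtractf mult_mat_index[OF dagger_carrier[OF W] W ij])
    finally show "(dagger W * X) $$ (i, j) = dagger (denom_mat n V d) $$ (i, j)"
      using ij by (simp add: dW dagger_index[OF denom_mat_carrier]) (auto simp: denom_mat_def)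
  qed (use W X in \<open>auto simp: denom_mat_def dagger_def\<close>)
  have "det J * det J = 1" using det_mult[OF J J] by (simp add: JJ)
  then have "norm (det J) = 1" by (rule norm_eq_1_of_sq) simp
  moreover have "cnj (det W) * det W = 1"
    using det_mult[OF dagger_carrier[OF W] W] by (simp add: dW det_dagger[OF W])
  then have "norm (cnj (det W)) = 1" by (rule norm_eq_1_of_sq) simp
  moreover have "cnj (det W) * det X = cnj (det (denom_mat n V d))"
    using det_mult[OF dagger_carrier[OF W] X] by (simp add: WX det_dagger[OF W] det_dagger[OF denom_mat_carrier])
  then have "norm (cnj (det W)) * norm (det X) = norm (det (denom_mat n V d))"
    by (metis complex_mod_cnj norm_mult)
  moreover have "norm (det J) * norm (det X) = norm (det (numer_mat n V d))"
    using det_mult[OF J X] by (simp add: JX norm_mult)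
  ultimately show ?thesis by simp
qed

lemma isometry_mat_scale_columns:
  assumes V: "isometry_mat n (mat n n (\<lambda>(i, j). V i j))" and d: "\<And>i. i < n \<Longrightarrow> norm (d i) = 1"
  shows "isometry_mat n (mat n n (\<lambda>(i, j). V i j * d j))"
  unfolding isometry_mat_def
proof (intro conjI ballI)
  let ?V = "mat n n (\<lambda>(i, j). V i j)" and ?U = "mat n n (\<lambda>(i, j). V i j * d j)"
  let ?D = "\<lambda>v. vec n (\<lambda>i. d i * v $ i)"
  show "?U \<in> carrier_mat n n" by simp
  fix v w :: "complex vec" assume v: "v \<in> carrier_vec n" and w: "w \<in> carrier_vec n"
  have U: "?U *\<^sub>v u = ?V *\<^sub>v ?D u" if "u \<in> carrier_vec n" for u
    using that by (intro eq_vecI) (auto simp: scalar_prod_def mult.assoc intro!: sum.cong)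
  have "cinner n (?U *\<^sub>v v) (?U *\<^sub>v w) = cinner n (?D v) (?D w)"
    unfolding U[OF v] U[OF w] using V by (simp add: isometry_mat_def)
  also have "\<dots> = cinner n v w"
    unfolding cinner_def
  proof (intro sum.cong refl)
    fix i assume "i \<in> {..<n}"
    then have i: "i < n" by simp
    have "cnj (d i) * d i = 1" using d[OF i] complex_norm_square[of "d i"] by (simp add: mult.commute)
    then have "cnj (d i * v $ i) * (d i * w $ i) = 1 * (cnj (v $ i) * w $ i)"
      by (metis complex_cnj_mult mult.assoc mult.left_commute)
    then show "cnj (?D v $ i) * ?D w $ i = cnj (v $ i) * w $ i" using i by simp
  qed
  finally show "cinner n (?U *\<^sub>v v) (?U *\<^sub>v w) = cinner n v w" .
qed

lemma denom_mat_mult_vec: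
  assumes "h \<in> carrier_vec n" "i < n"
  shows "(denom_mat n V d *\<^sub>v h) $ i = h $ i - (if i = 0 then 0 else \<Sum>k<n. V i k * (d k * h $ k))"
proof -
  have "(denom_mat n V d *\<^sub>v h) $ i = (\<Sum>k<n. (if k = i then h $ i else 0) - (if i = 0 then 0 else V i k * (d k * h $ k)))"
    unfolding mult_mat_vec_index[OF denom_mat_carrier assms] using assms
    by (intro sum.cong) (auto simp: denom_mat_def algebra_simps)
  then show ?thesis using assms by (simp add: sum_subtractf)
qed

text \<open>A kernel vector satisfies \<open>v = E V D v\<close>, whence |v| \<le> |V D v| = |D v|.
  Coordinate 0 of \<open>v\<close> is zero because of \<open>E\<close>, and \<open>D\<close>
  strictly shrinks every other nonzero coordinate.\<close>

lemma denom_mat_injective: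
  assumes V: "isometry_mat n (mat n n (\<lambda>(i, j). V i j))" and d: "\<And>i. i < n \<Longrightarrow> i \<noteq> 0 \<Longrightarrow> norm (d i) < 1"
    and v: "v \<in> carrier_vec n" and 0: "denom_mat n V d *\<^sub>v v = 0\<^sub>v n"
  shows "v = 0\<^sub>v n"
proof -
  let ?V = "mat n n (\<lambda>(i, j). V i j)" and ?w = "vec n (\<lambda>i. d i * v $ i)"
  have row: "v $ i = (if i = 0 then 0 else (?V *\<^sub>v ?w) $ i)" if i: "i < n" for i
    using denom_mat_mult_vec[OF v i, of V d] 0 i
    by (subst mult_mat_vec_index[of _ n n]) auto
  have "(\<Sum>i<n. (norm (v $ i))\<^sup>2) \<le> (\<Sum>i<n. (norm ((?V *\<^sub>v ?w) $ i))\<^sup>2)"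
    by (intro sum_mono) (use row in \<open>auto simp del: index_mult_mat_vec\<close>)
  also have "(\<Sum>i<n. (norm ((?V *\<^sub>v ?w) $ i))\<^sup>2) = (\<Sum>i<n. (norm (?w $ i))\<^sup>2)"
  proof -
    have "cinner n (?V *\<^sub>v ?w) (?V *\<^sub>v ?w) = cinner n ?w ?w" using V unfolding isometry_mat_def by simp
    then show ?thesis unfolding cinner_self by (simp only: of_real_eq_iff)
  qed
  finally have le: "(\<Sum>i<n. (norm (v $ i))\<^sup>2 - (norm (d i * v $ i))\<^sup>2) \<le> 0"
    by (simp add: sum_subtractf)
  have term_nonneg: "0 \<le> (norm (v $ i))\<^sup>2 - (norm (d i * v $ i))\<^sup>2" if i: "i < n" for i
  proof (cases "i = 0")
    case True
    then show ?thesis using row[of 0] i by simp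
  next
    case False
    then have "norm (d i * v $ i) \<le> norm (v $ i)" using d[OF i False] by (simp add: norm_mult mult_left_le_one_le)
    then show ?thesis by (simp add: power_mono)
  qed
  have "(\<Sum>i<n. (norm (v $ i))\<^sup>2 - (norm (d i * v $ i))\<^sup>2) = 0"
    using le term_nonneg sum_nonneg[of "{..<n}" "\<lambda>i. (norm (v $ i))\<^sup>2 - (norm (d i * v $ i))\<^sup>2"] by force
  then have z: "(norm (v $ i))\<^sup>2 - (norm (d i * v $ i))\<^sup>2 = 0" if "i < n" for i
    using that term_nonneg by (subst (asm) sum_nonneg_eq_0_iff) auto
  have "v $ i = 0" if i: "i < n" for i
  proof (cases "i = 0")
    case True
    then show ?thesis using row[OF i] by simp
  next
    case False
    show ?thesis
    proof (rule ccontr)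
      assume "v $ i \<noteq> 0"
      then have "norm (d i * v $ i) < norm (v $ i)" using d[OF i False] by (simp add: norm_mult)
      then have "(norm (d i * v $ i))\<^sup>2 < (norm (v $ i))\<^sup>2" by (intro power_strict_mono) auto
      then show False using z[OF i] by simp
    qed
  qed
  then show ?thesis using v by auto
qed

section \<open>The transfer function and its kernels\<close>

locale transfer_function =
  fixes n :: nat and V :: "nat \<Rightarrow> nat \<Rightarrow> complex" and g :: "nat \<Rightarrow> 'd::finite"
  assumes n: "0 < n" and V: "isometry_mat n (mat n n (\<lambda>(i, j). V i j))"
begin

text \<open>The solution of \<open>(1 - E V D) h = e_0\<close>; injectivity of the matrix on the
  polydisk gives existence and uniqueness there.\<close>

definition state :: "('d \<Rightarrow> complex) \<Rightarrow> complex vec" where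
  "state z = (SOME h. h \<in> carrier_vec n \<and> denom_mat n V (var_diag g z) *\<^sub>v h = unit_vec n 0)"

text \<open>Coordinate 0 of \<open>V D h\<close>. For \<open>V\<close> in blocks a, b, c, d with
  scalar corner a, and D' the part of \<open>D\<close> carrying the variables, this is the
  realization formula a + b D' (1 - d D')^(-1) c.\<close>

definition transfer :: "('d \<Rightarrow> complex) \<Rightarrow> complex" where
  "transfer z = (\<Sum>k<n. V 0 k * (var_diag g z k * state z $ k))"

lemma sum_split_0: "(\<Sum>i<n. f i) = f 0 + (\<Sum>i\<in>{1..<n}. f i)" for f :: "nat \<Rightarrow> 'b::comm_monoid_add"
proof -
  have "{..<n} = insert 0 {1..<n}" using n by auto
  then show ?thesis by simp
qed

lemma denom_injective:
  assumes "z \<in> polydisk" "v \<in> carrier_vec n" "denom_mat n V (var_diag g z) *\<^sub>v v = 0\<^sub>v n"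
  shows "v = 0\<^sub>v n"
  by (rule denom_mat_injective[OF V _ assms(2,3)]) (use assms(1) in \<open>auto simp: polydisk_def var_diag_def\<close>)

lemma state:
  assumes z: "z \<in> polydisk"
  shows "state z \<in> carrier_vec n" "denom_mat n V (var_diag g z) *\<^sub>v state z = unit_vec n 0"
proof -
  let ?A = "denom_mat n V (var_diag g z)"
  obtain B where B: "B \<in> carrier_mat n n" "?A * B = 1\<^sub>m n"
    using invertible_of_injective[OF denom_mat_carrier denom_injective[OF z]] by blast
  have "?A *\<^sub>v (B *\<^sub>v unit_vec n 0) = unit_vec n 0"
    using assoc_mult_mat_vec[OF denom_mat_carrier[of n V "var_diag g z"] B(1), of "unit_vec n 0"] B(2) by simp
  moreover have "B *\<^sub>v unit_vec n 0 \<in> carrier_vec n" using B(1) by simp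
  ultimately have "\<exists>h. h \<in> carrier_vec n \<and> ?A *\<^sub>v h = unit_vec n 0" by blast
  from someI_ex[OF this] show "state z \<in> carrier_vec n" "?A *\<^sub>v state z = unit_vec n 0"
    unfolding state_def by auto
qed

lemma state_unique:
  assumes z: "z \<in> polydisk" and h: "h \<in> carrier_vec n" "denom_mat n V (var_diag g z) *\<^sub>v h = unit_vec n 0"
  shows "h = state z"
proof -
  have "denom_mat n V (var_diag g z) *\<^sub>v (h - state z) = unit_vec n 0 - unit_vec n 0"
    using mult_minus_distrib_mat_vec[OF denom_mat_carrier h(1) state(1)[OF z]] h(2) state(2)[OF z] by simp
  also have "\<dots> = 0\<^sub>v n" by (rule eq_vecI) auto
  finally have "h - state z = 0\<^sub>v n"
    by (rule denom_injective[OF z minus_carrier_vec[OF h(1) state(1)[OF z]]])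
  then have "(h - state z) $ i = 0" if "i < n" for i using that by simp
  then have "h $ i = state z $ i" if "i < n" for i
    using h(1) state(1)[OF z] that by simp
  then show ?thesis using h(1) state(1)[OF z] by auto
qed

lemma state_index:
  assumes z: "z \<in> polydisk" and i: "i < n"
  shows "state z $ i = (if i = 0 then 1 else \<Sum>k<n. V i k * (var_diag g z k * state z $ k))"
  using denom_mat_mult_vec[OF state(1)[OF z] i, of V "var_diag g z"] i unfolding state(2)[OF z]
  by (auto simp: algebra_simps split: if_splits)

text \<open>\<open>V\<close> takes the vector formed by 1 and the remaining state multiplied by the
  variables to the vector formed by \<open>transfer z\<close> and the same remaining state.
  Preservation of inner products at \<open>w\<close> and \<open>z\<close>, rearranged, is the
  claim.\<close>

lemma transfer_identity:
  assumes z: "z \<in> polydisk" and w: "w \<in> polydisk"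
  shows "1 - cnj (transfer w) * transfer z
    = (\<Sum>i\<in>{1..<n}. (1 - cnj (w (g i)) * z (g i)) * (cnj (state w $ i) * state z $ i))"
proof -
  let ?V = "mat n n (\<lambda>(i, j). V i j)"
  define x where "x = (\<lambda>z. vec n (\<lambda>k. var_diag g z k * state z $ k))"
  have x: "x z \<in> carrier_vec n" for z by (simp add: x_def)
  have Vx: "(?V *\<^sub>v x z) $ i = (if i = 0 then transfer z else state z $ i)" if "z \<in> polydisk" "i < n" for z i
  proof -
    have "(?V *\<^sub>v x z) $ i = (\<Sum>k<n. V i k * (var_diag g z k * state z $ k))"
      using that by (subst mult_mat_vec_index[of _ n n]) (auto simp: x_def)
    then show ?thesis using state_index[OF that] by (simp add: transfer_def del: index_mult_mat_vec)
  qed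
  have "cinner n (?V *\<^sub>v x w) (?V *\<^sub>v x z) = cinner n (x w) (x z)"
    using V x by (simp add: isometry_mat_def)
  moreover have "cinner n (?V *\<^sub>v x w) (?V *\<^sub>v x z)
      = cnj (transfer w) * transfer z + (\<Sum>i\<in>{1..<n}. cnj (state w $ i) * state z $ i)"
    unfolding cinner_def sum_split_0 using n by (simp add: Vx z w del: index_mult_mat_vec)
  moreover have "cinner n (x w) (x z)
      = 1 + (\<Sum>i\<in>{1..<n}. cnj (w (g i)) * z (g i) * (cnj (state w $ i) * state z $ i))"
    unfolding cinner_def sum_split_0 using n state_index[OF z n] state_index[OF w n]
    by (simp add: x_def var_diag_def mult_ac)
  ultimately show ?thesis by (simp add: algebra_simps sum_subtractf)
qed

definition transfer_kernel :: "'d \<Rightarrow> ('d \<Rightarrow> complex) \<Rightarrow> ('d \<Rightarrow> complex) \<Rightarrow> complex" where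
  "transfer_kernel j z w = (\<Sum>i\<in>{i\<in>{1..<n}. g i = j}. cnj (state w $ i) * state z $ i)"

lemma psd_transfer_kernel: "psd_kernel D (transfer_kernel j)"
  unfolding psd_kernel_def
proof (intro allI impI)
  fix F :: "('d \<Rightarrow> complex) set"
  assume "finite F \<and> F \<subseteq> D"
  then show "psd_matrix F (transfer_kernel j)"
    by (intro psd_matrix_gram[where K = "{i\<in>{1..<n}. g i = j}" and q = "\<lambda>i z. cnj (state z $ i)"])
      (simp_all add: transfer_kernel_def mult.commute)
qed

lemma transfer_kernel_identity:
  assumes "z \<in> polydisk" "w \<in> polydisk"
  shows "1 - cnj (transfer w) * transfer z = (\<Sum>j\<in>UNIV. (1 - cnj (w j) * z j) * transfer_kernel j z w)"
proof -
  have "(\<Sum>j\<in>UNIV. (1 - cnj (w j) * z j) * transfer_kernel j z w)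
    = (\<Sum>j\<in>UNIV. \<Sum>i\<in>{i\<in>{1..<n}. g i = j}. (1 - cnj (w (g i)) * z (g i)) * (cnj (state w $ i) * state z $ i))"
    by (simp add: transfer_kernel_def sum_distrib_left)
  also have "\<dots> = (\<Sum>i\<in>{1..<n}. (1 - cnj (w (g i)) * z (g i)) * (cnj (state w $ i) * state z $ i))"
    by (rule sum.group) auto
  finally show ?thesis using transfer_identity[OF assms] by simp
qed

lemma rational_inner_transfer: "rational_inner transfer"
proof -
  define Q where "Q = det (numer_mat n (\<lambda>i j. Const (V i j)) (var_diag g Var) :: 'd cpoly mat)"
  define R where "R = det (denom_mat n (\<lambda>i j. Const (V i j)) (var_diag g Var) :: 'd cpoly mat)"
  have d: "eval_poly (var_diag g Var i) z = var_diag g z i" for i and z :: "'d \<Rightarrow> complex"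
    by (simp add: var_diag_def)
  have Q: "eval_poly Q z = det (numer_mat n V (var_diag g z))" for z
  proof -
    interpret comm_ring_hom "\<lambda>p. eval_poly p z" by (rule eval_poly_hom)
    show ?thesis unfolding Q_def hom_det_numer_mat by (simp add: d)
  qed
  have R: "eval_poly R z = det (denom_mat n V (var_diag g z))" for z
  proof -
    interpret comm_ring_hom "\<lambda>p. eval_poly p z" by (rule eval_poly_hom)
    show ?thesis unfolding R_def hom_det_denom_mat by (simp add: d)
  qed
  have "eval_poly R z \<noteq> 0 \<and> transfer z = eval_poly Q z / eval_poly R z" if z: "z \<in> polydisk" for z
  proof -
    have "eval_poly R z \<noteq> 0"
      unfolding R using det_0_iff_vec_prod_zero_field[OF denom_mat_carrier] denom_injective[OF z] by blast
    moreover have "eval_poly Q z = transfer z * eval_poly R z"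
      unfolding Q R transfer_def by (rule det_numer_eq[OF n state[OF z]])
    ultimately show ?thesis by simp
  qed
  moreover have "norm (eval_poly R z) = norm (eval_poly Q z)" if z: "z \<in> polytorus" for z
    unfolding Q R
    by (intro norm_det_numer_eq_denom isometry_mat_scale_columns V) (use z in \<open>auto simp: polytorus_def var_diag_def\<close>)
  ultimately show ?thesis unfolding rational_inner_def by blast
qed

text \<open>If \<open>|transfer z| = 1\<close> at one point, all states vanish there, and the kernel identity makes the function
  constant.\<close>

lemma transfer_ball_or_constant:
  "transfer ` polydisk \<subseteq> ball 0 1 \<or> (\<exists>u. norm u = 1 \<and> (\<forall>z\<in>polydisk. transfer z = u))"
proof (cases "\<exists>a\<in>polydisk. norm (transfer a) \<ge> 1")
  case False
  then show ?thesis by (auto simp: not_le)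
next
  case True
  then obtain a where a: "a \<in> polydisk" "norm (transfer a) \<ge> 1" by blast
  have lt: "(norm (a (g i)))\<^sup>2 < 1" for i
    using a(1) by (simp add: polydisk_def power_less_one_iff)
  have eq: "1 - (norm (transfer a))\<^sup>2 = (\<Sum>i\<in>{1..<n}. (1 - (norm (a (g i)))\<^sup>2) * (norm (state a $ i))\<^sup>2)"
  proof -
    have nsq: "cnj x * x = of_real ((norm x)\<^sup>2)" for x by (simp only: complex_norm_square mult.commute)
    have "complex_of_real (1 - (norm (transfer a))\<^sup>2) = of_real (\<Sum>i\<in>{1..<n}. (1 - (norm (a (g i)))\<^sup>2) * (norm (state a $ i))\<^sup>2)"
      using transfer_identity[OF a(1) a(1)] unfolding nsq
      by (simp only: of_real_sum of_real_mult of_real_diff of_real_1)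
    then show ?thesis by (simp only: of_real_eq_iff)
  qed
  have nonneg: "0 \<le> (1 - (norm (a (g i)))\<^sup>2) * (norm (state a $ i))\<^sup>2" for i
    using lt[of i] by simp
  have "(norm (transfer a))\<^sup>2 \<ge> 1" using a(2) by (simp add: power_mono[of 1, simplified])
  then have "(\<Sum>i\<in>{1..<n}. (1 - (norm (a (g i)))\<^sup>2) * (norm (state a $ i))\<^sup>2) = 0"
    using eq sum_nonneg[of "{1..<n}" "\<lambda>i. (1 - (norm (a (g i)))\<^sup>2) * (norm (state a $ i))\<^sup>2"] nonneg by simp
  then have "\<forall>i\<in>{1..<n}. (1 - (norm (a (g i)))\<^sup>2) * (norm (state a $ i))\<^sup>2 = 0"
    using nonneg by (subst (asm) sum_nonneg_eq_0_iff) auto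
  then have zero: "state a $ i = 0" if "i \<in> {1..<n}" for i
    using that lt[of i] by fastforce
  have "cnj (transfer a) * transfer z = 1" if "z \<in> polydisk" for z
    using transfer_identity[OF that a(1)] zero by simp
  then have const: "transfer z = 1 / cnj (transfer a)" if "z \<in> polydisk" for z
    using that by (metis mult_zero_left nonzero_eq_divide_eq zero_neq_one mult.commute)
  have "cnj (transfer a) * transfer a = 1" using transfer_identity[OF a(1) a(1)] zero by simp
  then have "norm (transfer a) = 1" using norm_eq_1_of_sq[of "transfer a" "cnj (transfer a)"] by (simp add: mult.commute)
  then have "norm (1 / cnj (transfer a)) = 1" by (simp add: norm_divide)
  then show ?thesis using const by blast
qed

subsection \<open>The power series of a transfer function\<close>

text \<open>The equation \<open>h = e_0 + E V D h\<close> solved degree by degree: each variable in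
  \<open>D\<close> raises the degree by one, so level \<open>Suc m\<close> depends on level
  \<open>m\<close> alone. The level is a separate argument to make the recursion primitive, and
  \<open>state_coeff\<close> reads it off at \<open>msize \<beta>\<close>.\<close>

primrec state_coeff_level :: "nat \<Rightarrow> nat \<Rightarrow> 'd mindex \<Rightarrow> complex" where
  "state_coeff_level 0 i \<beta> = (if i = 0 then 1 else V i 0)"
| "state_coeff_level (Suc m) i \<beta> = (if i = 0 then 0 else
     \<Sum>k\<in>{1..<n}. V i k * (if lookup \<beta> (g k) > 0 then state_coeff_level m k (\<beta> - unit_index (g k)) else 0))"

definition state_coeff :: "nat \<Rightarrow> 'd mindex \<Rightarrow> complex" where
  "state_coeff i \<beta> = state_coeff_level (msize \<beta>) i \<beta>"

text \<open>The coefficients of coordinate \<open>k\<close> of \<open>D h\<close>.\<close>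

definition shifted_coeff :: "nat \<Rightarrow> 'd mindex \<Rightarrow> complex" where
  "shifted_coeff k \<beta> = (if k = 0 then (if \<beta> = 0 then 1 else 0)
     else if lookup \<beta> (g k) > 0 then state_coeff k (\<beta> - unit_index (g k)) else 0)"

definition transfer_coeff :: "'d mindex \<Rightarrow> complex" where
  "transfer_coeff \<beta> = (\<Sum>k<n. V 0 k * shifted_coeff k \<beta>)"

lemma state_coeff_eq:
  "state_coeff i \<beta> = (if i = 0 then (if \<beta> = 0 then 1 else 0) else \<Sum>k<n. V i k * shifted_coeff k \<beta>)"
proof (cases "msize \<beta>")
  case 0
  then have "\<beta> = 0" by simp
  then show ?thesis by (simp add: state_coeff_def sum_split_0 shifted_coeff_def)
next
  case (Suc m)
  then have ne: "\<beta> \<noteq> 0" by auto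
  have "shifted_coeff k \<beta> = (if lookup \<beta> (g k) > 0 then state_coeff_level m k (\<beta> - unit_index (g k)) else 0)"
    if "k \<in> {1..<n}" for k
    using that msize_minus_unit_index[of \<beta> "g k"] Suc by (simp add: shifted_coeff_def state_coeff_def)
  moreover have "shifted_coeff 0 \<beta> = 0" using ne by (simp add: shifted_coeff_def)
  ultimately show ?thesis using ne by (simp add: state_coeff_def Suc sum_split_0)
qed

text \<open>The degree recursion has only one solution. If \<open>V\<close> maps the shifted data
  built from \<open>q\<close> to \<open>p\<close> in coordinate 0 and to \<open>q\<close> elsewhere,
  at every exponent in the index set, then the state has the coefficients \<open>q\<close> there and
  the transfer function has the coefficients \<open>p\<close>.\<close>

lemma coeff_agreement:
  assumes eq: "\<And>\<beta> i. \<beta> \<in> index_set N \<Longrightarrow> i < n \<Longrightarrow>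
      (\<Sum>k<n. V i k * (if k = 0 then (if \<beta> = 0 then 1 else 0)
        else if lookup \<beta> (g k) > 0 then q k (\<beta> - unit_index (g k)) else 0))
      = (if i = 0 then p \<beta> else q i \<beta>)"
    and "\<beta> \<in> index_set N"
  shows "transfer_coeff \<beta> = p \<beta> \<and> (\<forall>i\<in>{1..<n}. state_coeff i \<beta> = q i \<beta>)"
  using assms(2)
proof (induction "msize \<beta>" arbitrary: \<beta> rule: less_induct)
  case less
  have "shifted_coeff k \<beta> = (if k = 0 then (if \<beta> = 0 then 1 else 0)
        else if lookup \<beta> (g k) > 0 then q k (\<beta> - unit_index (g k)) else 0)" if "k < n" for k
  proof (cases "k \<noteq> 0 \<and> lookup \<beta> (g k) > 0")
    case True
    then have "state_coeff k (\<beta> - unit_index (g k)) = q k (\<beta> - unit_index (g k))"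
      using less.hyps[of "\<beta> - unit_index (g k)"] msize_minus_less[of \<beta> "g k"]
        minus_unit_in_index_set[OF less.prems, of "g k"] that by simp
    then show ?thesis using True by (simp add: shifted_coeff_def)
  next
    case False
    then show ?thesis by (auto simp: shifted_coeff_def)
  qed
  then have "(\<Sum>k<n. V i k * shifted_coeff k \<beta>) = (if i = 0 then p \<beta> else q i \<beta>)" if "i < n" for i
    using eq[OF less.prems that] by simp
  then show ?case using n by (simp add: transfer_coeff_def state_coeff_eq)
qed

text \<open>Dominates both 1 and all absolute row sums of \<open>V\<close>, so one level of the
  recursion costs at most this factor.\<close>

definition growth :: real where
  "growth = 1 + (\<Sum>i<n. \<Sum>k<n. norm (V i k))"

lemma growth_ge_1: "1 \<le> growth"
  by (simp add: growth_def sum_nonneg)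

lemma row_le_growth: "i < n \<Longrightarrow> (\<Sum>k<n. norm (V i k)) \<le> growth"
  using member_le_sum[of i "{..<n}" "\<lambda>i. \<Sum>k<n. norm (V i k)"] by (force simp: growth_def sum_nonneg)

text \<open>One factor per recursion step; the extra factor in \<open>Suc (msize \<beta>)\<close>
  accounts for level 0, where the coefficients are already entries of \<open>V\<close>.\<close>

lemma norm_state_coeff_le:
  assumes "i < n"
  shows "norm (state_coeff i \<beta>) \<le> growth ^ Suc (msize \<beta>)"
  using assms
proof (induction "msize \<beta>" arbitrary: \<beta> i rule: less_induct)
  case less
  have pow: "1 \<le> growth ^ m" for m using growth_ge_1 by (rule one_le_power)
  have shifted: "norm (shifted_coeff k \<beta>) \<le> growth ^ msize \<beta>" if "k < n" for k
  proof (cases "k \<noteq> 0 \<and> lookup \<beta> (g k) > 0")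
    case True
    then show ?thesis
      using less.hyps[of "\<beta> - unit_index (g k)" k] msize_minus_less[of \<beta> "g k"] msize_minus_unit_index[of \<beta> "g k"] that
      by (simp add: shifted_coeff_def)
  next
    case False
    then show ?thesis using pow[of "msize \<beta>"] order_trans[OF zero_le_one pow[of "msize \<beta>"]] by (auto simp: shifted_coeff_def)
  qed
  show ?case
  proof (cases "i = 0")
    case True
    then show ?thesis using pow[of "Suc (msize \<beta>)"] order_trans[OF zero_le_one pow[of "Suc (msize \<beta>)"]]
      by (auto simp: state_coeff_eq simp del: power_Suc)
  next
    case False
    have "norm (\<Sum>k<n. V i k * shifted_coeff k \<beta>) \<le> (\<Sum>k<n. norm (V i k) * growth ^ msize \<beta>)"
      using shifted by (intro sum_norm_le) (simp add: norm_mult mult_left_mono)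
    also have "\<dots> = (\<Sum>k<n. norm (V i k)) * growth ^ msize \<beta>" by (simp add: sum_distrib_right)
    also have "\<dots> \<le> growth * growth ^ msize \<beta>"
      using row_le_growth[OF less.prems] growth_ge_1 by (intro mult_right_mono) auto
    finally show ?thesis using False by (simp add: state_coeff_eq)
  qed
qed

end

lemma norm_monom_at_le:
  fixes z :: "'d::finite \<Rightarrow> complex"
  assumes "\<And>j. norm (z j) \<le> r"
  shows "norm (monom_at z \<beta>) \<le> r ^ msize \<beta>"
proof -
  have "norm (monom_at z \<beta>) = (\<Prod>j\<in>UNIV. norm (z j) ^ lookup \<beta> j)"
    by (simp add: monom_at_def prod_norm[symmetric] norm_power)
  also have "\<dots> \<le> (\<Prod>j\<in>UNIV. r ^ lookup \<beta> j)"
    using assms by (intro prod_mono) (auto intro!: power_mono)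
  also have "\<dots> = r ^ msize \<beta>" by (simp add: msize_def power_sum)
  finally show ?thesis .
qed

text \<open>A finite set of exponents lies in a cube, and the sum over a cube factors into geometric
  sums, one for each variable.\<close>

lemma summable_power_msize:
  fixes r :: real
  assumes "0 \<le> r" "r < 1"
  shows "(\<lambda>\<beta> :: 'd::finite mindex. r ^ msize \<beta>) summable_on UNIV"
proof (rule nonneg_bdd_above_summable_on)
  show "bdd_above (sum (\<lambda>\<beta> :: 'd mindex. r ^ msize \<beta>) ` {F. F \<subseteq> UNIV \<and> finite F})"
  proof (rule bdd_aboveI2)
    fix F :: "'d mindex set" assume "F \<in> {F. F \<subseteq> UNIV \<and> finite F}"
    then have F: "finite F" by simp
    define M where "M = Suc (\<Sum>\<beta>\<in>F. msize \<beta>)"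
    have inj: "inj_on lookup F" by (simp add: inj_on_def poly_mapping.lookup_inject)
    have lt: "lookup \<beta> j < M" if "\<beta> \<in> F" for \<beta> j
      using lookup_le_msize[of \<beta> j] member_le_sum[of \<beta> F msize] F that by (auto simp: M_def)
    have "(\<Sum>\<beta>\<in>F. r ^ msize \<beta>) = (\<Sum>f\<in>lookup ` F. \<Prod>j\<in>UNIV. r ^ f j)"
      by (simp add: sum.reindex[OF inj] msize_def power_sum)
    also have "\<dots> \<le> (\<Sum>f\<in>PiE (UNIV :: 'd set) (\<lambda>_. {..<M}). \<Prod>j\<in>UNIV. r ^ f j)"
      using lt assms by (intro sum_mono2) (auto simp: finite_PiE intro!: prod_nonneg)
    also have "\<dots> = (\<Prod>j\<in>(UNIV :: 'd set). \<Sum>k<M. r ^ k)"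
      by (rule prod_sum_PiE[symmetric]) auto
    also have "\<dots> \<le> (\<Prod>j\<in>(UNIV :: 'd set). 1 / (1 - r))"
    proof (intro prod_mono conjI)
      have "(1 - r) * (\<Sum>k<M. r ^ k) = 1 - r ^ M" using one_diff_power_eq[of r M] by simp
      also have "\<dots> \<le> 1" using assms by simp
      finally show "(\<Sum>k<M. r ^ k) \<le> 1 / (1 - r)" using assms by (simp add: field_simps)
      show "0 \<le> (\<Sum>k<M. r ^ k)" using assms by (intro sum_nonneg) simp
    qed
    finally show "(\<Sum>\<beta>\<in>F. r ^ msize \<beta>) \<le> (\<Prod>j\<in>(UNIV :: 'd set). 1 / (1 - r))" .
  qed
qed (use assms in simp)

lemma has_sum_finite_sum:
  fixes f :: "'i \<Rightarrow> 'a \<Rightarrow> complex"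
  assumes "finite I" "\<And>i. i \<in> I \<Longrightarrow> (f i has_sum s i) A"
  shows "((\<lambda>x. \<Sum>i\<in>I. f i x) has_sum (\<Sum>i\<in>I. s i)) A"
  using assms by (induction I rule: finite_induct) (auto intro: has_sum_add)

lemma has_sum_supported:
  fixes f :: "'a \<Rightarrow> complex"
  assumes "finite S" "\<And>x. x \<notin> S \<Longrightarrow> f x = 0"
  shows "(f has_sum (\<Sum>x\<in>S. f x)) UNIV"
proof -
  have "(f has_sum (\<Sum>x\<in>S. f x)) S" using assms(1) by simp
  then show ?thesis using assms(2) by (subst has_sum_cong_neutral[of S UNIV f f]) auto
qed

context transfer_function
begin

text \<open>With this radius the \<open>\<beta>\<close>-th term is at most
  \<open>growth * (1/2) ^ msize \<beta>\<close>. The sums of the coefficient series solve the linear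
  system that determines the state, so by uniqueness they are the state.\<close>

lemma transfer_has_sum:
  assumes z: "\<And>j. norm (z j) < 1 / (2 * growth)"
  shows "((\<lambda>\<beta>. transfer_coeff \<beta> * monom_at z \<beta>) has_sum transfer z) UNIV"
proof -
  have half: "growth * (1 / (2 * growth)) = 1 / 2" using growth_ge_1 by simp
  have "1 / (2 * growth) \<le> 1 / 2" using growth_ge_1 by (simp add: field_simps)
  then have disk: "z \<in> polydisk" unfolding polydisk_def using z by (smt (verit) mem_Collect_eq field_sum_of_halves)
  have abs: "(\<lambda>\<beta>. state_coeff i \<beta> * monom_at z \<beta>) summable_on UNIV" if i: "i < n" for i
  proof (rule Infinite_Sum.abs_summable_summable, rule Infinite_Sum.abs_summable_on_comparison_test)
    have "(\<lambda>\<beta> :: 'd mindex. growth * (1 / 2) ^ msize \<beta>) summable_on UNIV"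
      by (intro summable_on_cmult_right summable_power_msize) auto
    then show "(\<lambda>\<beta> :: 'd mindex. norm (growth * (1 / 2) ^ msize \<beta>)) summable_on UNIV"
      using growth_ge_1 by (simp add: norm_mult norm_power)
    fix \<beta> :: "'d mindex"
    have "norm (state_coeff i \<beta> * monom_at z \<beta>) \<le> growth ^ Suc (msize \<beta>) * (1 / (2 * growth)) ^ msize \<beta>"
      unfolding norm_mult using norm_state_coeff_le[OF i] norm_monom_at_le[of z "1 / (2 * growth)" \<beta>] z growth_ge_1
      by (intro mult_mono) (auto simp: less_imp_le)
    also have "\<dots> = growth * (growth * (1 / (2 * growth))) ^ msize \<beta>" by (simp only: power_mult_distrib power_Suc mult.assoc)
    also have "\<dots> = norm (growth * (1 / 2) ^ msize \<beta>)" unfolding half using growth_ge_1 by (simp add: norm_mult norm_power)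
    finally show "norm (state_coeff i \<beta> * monom_at z \<beta>) \<le> norm (growth * (1 / 2) ^ msize \<beta>)" .
  qed
  define s where "s = (\<lambda>i. infsum (\<lambda>\<beta>. state_coeff i \<beta> * monom_at z \<beta>) UNIV)"
  have s: "((\<lambda>\<beta>. state_coeff i \<beta> * monom_at z \<beta>) has_sum s i) UNIV" if "i < n" for i
    unfolding s_def using abs[OF that] by (rule has_sum_infsum)
  have delta: "((\<lambda>\<beta>. (if \<beta> = 0 then 1 else 0) * monom_at z \<beta>) has_sum 1) UNIV"
    using has_sum_supported[of "{0}" "\<lambda>\<beta>. (if \<beta> = 0 then 1 else 0) * monom_at z \<beta>"] by simp
  have s0: "s 0 = 1"
    using has_sum_unique[OF s[OF n]] delta by (simp add: state_coeff_eq)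
  have shifted: "((\<lambda>\<beta>. shifted_coeff k \<beta> * monom_at z \<beta>) has_sum (var_diag g z k * s k)) UNIV" if k: "k < n" for k
  proof (cases "k = 0")
    case True
    then show ?thesis using delta by (simp add: shifted_coeff_def var_diag_def s0)
  next
    case False
    let ?e = "unit_index (g k)"
    have inj: "inj_on (\<lambda>\<beta>. \<beta> + ?e) UNIV" by (simp add: inj_on_def)
    have "((\<lambda>\<beta>. z (g k) * (state_coeff k \<beta> * monom_at z \<beta>)) has_sum (z (g k) * s k)) UNIV"
      by (rule has_sum_cmult_right[OF s[OF k]])
    also have "(\<lambda>\<beta>. z (g k) * (state_coeff k \<beta> * monom_at z \<beta>)) = (\<lambda>\<beta>. shifted_coeff k \<beta> * monom_at z \<beta>) \<circ> (\<lambda>\<beta>. \<beta> + ?e)"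
      using False by (auto simp: shifted_coeff_def monom_at_add lookup_add lookup_unit_index)
    finally have "((\<lambda>\<beta>. shifted_coeff k \<beta> * monom_at z \<beta>) has_sum (z (g k) * s k)) (range (\<lambda>\<beta>. \<beta> + ?e))"
      by (simp only: has_sum_reindex[OF inj])
    moreover have "shifted_coeff k \<beta> = 0" if "\<beta> \<notin> range (\<lambda>\<beta>. \<beta> + ?e)" for \<beta>
      using that minus_unit_index_add[of \<beta> "g k"] False by (auto simp: shifted_coeff_def) (metis rangeI)
    ultimately have "((\<lambda>\<beta>. shifted_coeff k \<beta> * monom_at z \<beta>) has_sum (z (g k) * s k)) UNIV"
      by (subst has_sum_cong_neutral[where T = "range (\<lambda>\<beta>. \<beta> + ?e)" and g = "\<lambda>\<beta>. shifted_coeff k \<beta> * monom_at z \<beta>"]) auto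
    then show ?thesis using False by (simp add: var_diag_def)
  qed
  have row: "((\<lambda>\<beta>. (\<Sum>k<n. V i k * shifted_coeff k \<beta>) * monom_at z \<beta>) has_sum (\<Sum>k<n. V i k * (var_diag g z k * s k))) UNIV" for i
  proof -
    have "((\<lambda>\<beta>. \<Sum>k<n. V i k * (shifted_coeff k \<beta> * monom_at z \<beta>)) has_sum (\<Sum>k<n. V i k * (var_diag g z k * s k))) UNIV"
      by (intro has_sum_finite_sum has_sum_cmult_right shifted) auto
    then show ?thesis by (simp add: sum_distrib_right mult.assoc)
  qed
  have "denom_mat n V (var_diag g z) *\<^sub>v vec n s = unit_vec n 0"
  proof (rule eq_vecI)
    fix i assume "i < dim_vec (unit_vec n 0 :: complex vec)"
    then have i: "i < n" by simp
    have "s i = (\<Sum>k<n. V i k * (var_diag g z k * s k))" if "i \<noteq> 0"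
      using has_sum_unique[OF s[OF i]] row[of i] that by (simp add: state_coeff_eq)
    then show "(denom_mat n V (var_diag g z) *\<^sub>v vec n s) $ i = unit_vec n 0 $ i"
      using i n s0 by (subst denom_mat_mult_vec) auto
  qed (simp add: denom_mat_def)
  from state_unique[OF disk _ this] have "state z = vec n s" by simp
  then have "transfer z = (\<Sum>k<n. V 0 k * (var_diag g z k * s k))" by (simp add: transfer_def)
  then show ?thesis using row[of 0] by (simp add: transfer_coeff_def)
qed

end

section \<open>From (2) to (4)\<close>

lemma eval_poly_has_sum: "((\<lambda>\<beta>. lookup p \<beta> * monom_at z \<beta>) has_sum eval_poly p z) UNIV"
  unfolding subst_poly_def by (rule has_sum_supported) (auto simp: in_keys_iff)

text \<open>With the negative terms of (2) moved across and \<open>A j\<close> factored, both sides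
  are Gram matrices: one of vectors consisting of the indicator of \<beta> = 0 and the entries
  q(\<beta> - e_j), the other of vectors consisting of p_\<beta> and the entries q(\<beta>). A
  unitary matrix between them satisfies the coefficient recursion of its own transfer function with
  the coefficients of \<open>p\<close> as output.\<close>

lemma matrix_decomposition_imp_inner_interpolation:
  fixes p :: "'d::finite cpoly"
  assumes "matrix_decomposition N p"
  shows "inner_interpolation N p"
proof -
  let ?I = "index_set N :: 'd mindex set" and ?p = "lookup p"
  obtain A where A: "\<And>j. psd_matrix ?I (A j)" "\<And>\<alpha> \<beta>. \<alpha> \<in> ?I \<Longrightarrow> \<beta> \<in> ?I \<Longrightarrow>
    (if \<alpha> = 0 \<and> \<beta> = 0 then 1 else 0) - cnj (?p \<alpha>) * ?p \<beta> = (\<Sum>j\<in>UNIV. A j \<alpha> \<beta> - shifted_entry j (A j) \<alpha> \<beta>)"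
    using assms unfolding matrix_decomposition_def by blast
  obtain q0 where q0: "\<And>j x y. x \<in> ?I \<Longrightarrow> y \<in> ?I \<Longrightarrow> A j x y = (\<Sum>k\<in>?I. cnj (q0 j k x) * q0 j k y)"
    using psd_matrix_factor[OF finite_index_set A(1)] by metis
  define m where "m = card ((UNIV :: 'd set) \<times> ?I)"
  obtain e where e: "bij_betw e {0..<m} ((UNIV :: 'd set) \<times> ?I)"
    using ex_bij_betw_nat_finite[of "(UNIV :: 'd set) \<times> ?I"] by (auto simp: m_def)
  define n where "n = Suc m"
  \<comment> \<open>Coordinate \<open>i \<ge> 1\<close> stands for the pair \<open>e (i - 1)\<close>
    of a variable and a Gram vector; coordinate 0 is kept for the scalar part.\<close>
  define g where "g = (\<lambda>i. fst (e (i - 1)))"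
  define q where "q = (\<lambda>i. q0 (fst (e (i - 1))) (snd (e (i - 1))))"
  have sum_e: "(\<Sum>i\<in>{1..<n}. F (fst (e (i - 1))) (snd (e (i - 1)))) = (\<Sum>j\<in>UNIV. \<Sum>k\<in>?I. F j k)" for F :: "'d \<Rightarrow> _ \<Rightarrow> complex"
  proof -
    have "(\<Sum>i\<in>{1..<n}. F (fst (e (i - 1))) (snd (e (i - 1)))) = (\<Sum>i\<in>{0..<m}. F (fst (e i)) (snd (e i)))"
      by (rule sum.reindex_bij_witness[of _ Suc "\<lambda>i. i - 1"]) (auto simp: n_def)
    also have "\<dots> = (\<Sum>(j,k)\<in>UNIV \<times> ?I. F j k)"
      using sum.reindex_bij_betw[OF e, of "\<lambda>(j, k). F j k"] by (simp add: case_prod_unfold)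
    finally show ?thesis by (simp add: sum.cartesian_product)
  qed
  define x where "x = (\<lambda>\<beta> k. if k = 0 then (if \<beta> = 0 then 1 else 0)
    else if lookup \<beta> (g k) > 0 then q k (\<beta> - unit_index (g k)) else 0)"
  define y where "y = (\<lambda>\<beta> k. if k = 0 then ?p \<beta> else q k \<beta>)"
  have split: "(\<Sum>i<n. f i) = f 0 + (\<Sum>i\<in>{1..<n}. f i)" for f :: "nat \<Rightarrow> complex"
  proof -
    have "{..<n} = insert 0 {1..<n}" by (auto simp: n_def)
    then show ?thesis by simp
  qed
  have gram: "cinner n (vec n (x \<alpha>)) (vec n (x \<beta>)) = cinner n (vec n (y \<alpha>)) (vec n (y \<beta>))"
    if ab: "\<alpha> \<in> ?I" "\<beta> \<in> ?I" for \<alpha> \<beta>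
  proof -
    have "cinner n (vec n (x \<alpha>)) (vec n (x \<beta>)) = (\<Sum>i<n. cnj (x \<alpha> i) * x \<beta> i)" by (simp add: cinner_def)
    also have "\<dots> = (if \<alpha> = 0 \<and> \<beta> = 0 then 1 else 0) + (\<Sum>i\<in>{1..<n}. cnj (x \<alpha> i) * x \<beta> i)"
      unfolding split by (simp add: x_def)
    also have "(\<Sum>i\<in>{1..<n}. cnj (x \<alpha> i) * x \<beta> i) = (\<Sum>i\<in>{1..<n}. (\<lambda>j k. if lookup \<alpha> j > 0 \<and> lookup \<beta> j > 0
        then cnj (q0 j k (\<alpha> - unit_index j)) * q0 j k (\<beta> - unit_index j) else 0) (fst (e (i - 1))) (snd (e (i - 1))))"
      by (intro sum.cong) (auto simp: x_def g_def q_def)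
    also have "\<dots> = (\<Sum>j\<in>UNIV. \<Sum>k\<in>?I. if lookup \<alpha> j > 0 \<and> lookup \<beta> j > 0
        then cnj (q0 j k (\<alpha> - unit_index j)) * q0 j k (\<beta> - unit_index j) else 0)"
      by (rule sum_e)
    also have "\<dots> = (\<Sum>j\<in>UNIV. shifted_entry j (A j) \<alpha> \<beta>)"
      using ab by (intro sum.cong refl) (auto simp: shifted_entry_def q0 minus_unit_in_index_set)
    finally have X: "cinner n (vec n (x \<alpha>)) (vec n (x \<beta>))
      = (if \<alpha> = 0 \<and> \<beta> = 0 then 1 else 0) + (\<Sum>j\<in>UNIV. shifted_entry j (A j) \<alpha> \<beta>)" .
    have "cinner n (vec n (y \<alpha>)) (vec n (y \<beta>)) = (\<Sum>i<n. cnj (y \<alpha> i) * y \<beta> i)" by (simp add: cinner_def)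
    also have "\<dots> = cnj (?p \<alpha>) * ?p \<beta> + (\<Sum>i\<in>{1..<n}. cnj (y \<alpha> i) * y \<beta> i)"
      unfolding split by (simp add: y_def)
    also have "(\<Sum>i\<in>{1..<n}. cnj (y \<alpha> i) * y \<beta> i)
        = (\<Sum>i\<in>{1..<n}. (\<lambda>j k. cnj (q0 j k \<alpha>) * q0 j k \<beta>) (fst (e (i - 1))) (snd (e (i - 1))))"
      by (intro sum.cong) (auto simp: y_def q_def)
    also have "\<dots> = (\<Sum>j\<in>UNIV. \<Sum>k\<in>?I. cnj (q0 j k \<alpha>) * q0 j k \<beta>)" by (rule sum_e)
    also have "\<dots> = (\<Sum>j\<in>UNIV. A j \<alpha> \<beta>)" using ab by (simp add: q0)
    finally show ?thesis using X A(2)[OF ab] by (simp add: sum_subtractf algebra_simps)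
  qed
  obtain V0 where V0: "isometry_mat n V0" "\<And>\<beta>. \<beta> \<in> ?I \<Longrightarrow> V0 *\<^sub>v vec n (x \<beta>) = vec n (y \<beta>)"
    using isometry_of_equal_gram[OF finite_index_set, of N "\<lambda>\<beta>. vec n (x \<beta>)" n "\<lambda>\<beta>. vec n (y \<beta>)"] gram by auto
  define V where "V = (\<lambda>i j. V0 $$ (i, j))"
  have V0c: "V0 \<in> carrier_mat n n" using V0 by (simp add: isometry_mat_def)
  have "mat n n (\<lambda>(i, j). V i j) = V0" using V0c by (intro eq_matI) (auto simp: V_def)
  then interpret transfer_function n V g using V0(1) by unfold_locales (simp_all add: n_def)
  have agree: "transfer_coeff \<beta> = ?p \<beta>" if b: "\<beta> \<in> ?I" for \<beta>
  proof -
    have "(\<Sum>k<n. V i k * x \<beta> k) = y \<beta> i" if "\<beta> \<in> ?I" "i < n" for \<beta> i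
    proof -
      have "(V0 *\<^sub>v vec n (x \<beta>)) $ i = (\<Sum>k<n. V i k * x \<beta> k)"
        using that by (subst mult_mat_vec_index[OF V0c]) (simp_all add: V_def)
      then show ?thesis using that by (simp add: V0(2) del: index_mult_mat_vec)
    qed
    from coeff_agreement[where p = ?p and q = q and N = N, OF this[unfolded x_def y_def] b] show ?thesis by simp
  qed
  have "taylor_coeffs (\<lambda>z. eval_poly p z - transfer z) (\<lambda>\<beta>. ?p \<beta> - transfer_coeff \<beta>)"
    unfolding taylor_coeffs_def
  proof (intro exI conjI allI impI)
    show "0 < 1 / (2 * growth)" using growth_ge_1 by simp
    fix z :: "'d \<Rightarrow> complex" assume "\<forall>j. norm (z j) < 1 / (2 * growth)"
    then have "((\<lambda>\<beta>. transfer_coeff \<beta> * monom_at z \<beta>) has_sum transfer z) UNIV" using transfer_has_sum by blast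
    from has_sum_add[OF eval_poly_has_sum[of p z] has_sum_cmult_right[OF this, of "-1"]]
    show "((\<lambda>\<beta>. (?p \<beta> - transfer_coeff \<beta>) * monom_at z \<beta>) has_sum (eval_poly p z - transfer z)) UNIV"
      by (simp add: algebra_simps)
  qed
  moreover have "\<forall>\<beta>. msize \<beta> < N + 1 \<longrightarrow> ?p \<beta> - transfer_coeff \<beta> = 0"
    using agree by (simp add: index_set_def)
  ultimately have "vanishes_to_order (\<lambda>z. eval_poly p z - transfer z) (N + 1)"
    unfolding vanishes_to_order_def by blast
  then show ?thesis
    unfolding inner_interpolation_def
    using rational_inner_transfer transfer_ball_or_constant psd_transfer_kernel transfer_kernel_identity
    by blast
qed

subsection \<open>Discrete Fourier analysis on a grid in the polydisk\<close>

text \<open>\<open>psd_kernel\<close> speaks of sets of points. For a family with possible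
  repetitions, the coefficients of equal points are added up.\<close>

lemma psd_kernel_family:
  assumes K: "psd_kernel D K" and I: "finite I" "f ` I \<subseteq> D"
  shows "psd_matrix I (\<lambda>x y. K (f x) (f y))"
  unfolding psd_matrix_iff
proof
  fix c :: "_ \<Rightarrow> complex"
  define s where "s = (\<lambda>u. \<Sum>x\<in>{x\<in>I. f x = u}. c x)"
  have group: "(\<Sum>u\<in>f ` I. \<Sum>x\<in>{x\<in>I. f x = u}. F x) = (\<Sum>x\<in>I. F x)" for F :: "_ \<Rightarrow> complex"
    using I(1) by (intro sum.group) auto
  have "hform (f ` I) K s = (\<Sum>u\<in>f ` I. \<Sum>v\<in>f ` I. \<Sum>x\<in>{x\<in>I. f x = u}. \<Sum>y\<in>{y\<in>I. f y = v}. cnj (c x) * K (f x) (f y) * c y)"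
    unfolding hform_def
  proof (rule sum.cong[OF refl], rule sum.cong[OF refl])
    fix u v
    have "cnj (s u) * K u v = (\<Sum>x\<in>{x\<in>I. f x = u}. cnj (c x) * K u v)"
      by (simp only: s_def cnj_sum sum_distrib_right)
    then have "cnj (s u) * K u v * s v = (\<Sum>x\<in>{x\<in>I. f x = u}. \<Sum>y\<in>{y\<in>I. f y = v}. cnj (c x) * K u v * c y)"
      by (simp only: s_def sum_product)
    also have "\<dots> = (\<Sum>x\<in>{x\<in>I. f x = u}. \<Sum>y\<in>{y\<in>I. f y = v}. cnj (c x) * K (f x) (f y) * c y)"
      by (intro sum.cong refl) auto
    finally show "cnj (s u) * K u v * s v = (\<Sum>x\<in>{x\<in>I. f x = u}. \<Sum>y\<in>{y\<in>I. f y = v}. cnj (c x) * K (f x) (f y) * c y)" .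
  qed
  also have "\<dots> = (\<Sum>u\<in>f ` I. \<Sum>x\<in>{x\<in>I. f x = u}. \<Sum>v\<in>f ` I. \<Sum>y\<in>{y\<in>I. f y = v}. cnj (c x) * K (f x) (f y) * c y)"
    by (intro sum.cong refl sum.swap)
  also have "\<dots> = hform I (\<lambda>x y. K (f x) (f y)) c"
    unfolding group hform_def ..
  finally have eq: "hform (f ` I) K s = hform I (\<lambda>x y. K (f x) (f y)) c" .
  show "hform I (\<lambda>x y. K (f x) (f y)) c \<in> \<real>\<^sub>\<ge>\<^sub>0"
  proof -
    have "psd_matrix (f ` I) K" using K I by (simp add: psd_kernel_def)
    then have "hform (f ` I) K s \<in> \<real>\<^sub>\<ge>\<^sub>0" by (simp add: psd_matrix_iff)
    with eq show ?thesis by simp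
  qed
qed

text \<open>Sample points are \<open>r\<close> times the roots of unity of order
  \<open>Suc L\<close> in each coordinate. Frequencies run from 0 to \<open>L\<close>, so the
  modulus is never zero.\<close>

locale grid =
  fixes L :: nat and r :: real
  assumes r: "0 < r" "r < 1"
begin

definition om :: complex where
  "om = exp (2 * of_real pi * \<i> * of_nat 1 / of_nat (Suc L))"

definition box :: "('d::finite \<Rightarrow> nat) set" where
  "box = PiE UNIV (\<lambda>_. {..<Suc L})"

text \<open>The characters of the product of cyclic groups of order \<open>Suc L\<close>.\<close>

definition chi :: "('d::finite \<Rightarrow> nat) \<Rightarrow> ('d \<Rightarrow> nat) \<Rightarrow> complex" where
  "chi a k = (\<Prod>j\<in>UNIV. om ^ (a j * k j))"

definition point :: "('d::finite \<Rightarrow> nat) \<Rightarrow> 'd \<Rightarrow> complex" where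
  "point k j = of_real r * om ^ k j"

text \<open>Cyclic subtraction of 1 in coordinate \<open>j\<close>, written as addition of
  \<open>L\<close> because of the truncated subtraction on natural numbers.\<close>

definition pred :: "'d::finite \<Rightarrow> ('d \<Rightarrow> nat) \<Rightarrow> 'd \<Rightarrow> nat" where
  "pred j a = a(j := (a j + L) mod Suc L)"

definition succ :: "'d::finite \<Rightarrow> ('d \<Rightarrow> nat) \<Rightarrow> 'd \<Rightarrow> nat" where
  "succ j a = a(j := Suc (a j) mod Suc L)"

text \<open>The discrete Fourier coefficient of the samples of \<open>f\<close>. For a power series
  it approximates the Taylor coefficient times \<open>r\<close> to the power of the degree.\<close>

definition hat :: "(('d::finite \<Rightarrow> complex) \<Rightarrow> complex) \<Rightarrow> ('d \<Rightarrow> nat) \<Rightarrow> complex" where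
  "hat f b = (\<Sum>k\<in>box. f (point k) * cnj (chi b k)) / of_nat (card (box :: ('d \<Rightarrow> nat) set))"

text \<open>Frequency \<open>b\<close> in the first argument and conjugate frequency
  \<open>a\<close> in the second; this order of indices matches \<open>cnj (p a) * p b\<close> in
  (2).\<close>

definition khat :: "(('d::finite \<Rightarrow> complex) \<Rightarrow> ('d \<Rightarrow> complex) \<Rightarrow> complex) \<Rightarrow> ('d \<Rightarrow> nat) \<Rightarrow> ('d \<Rightarrow> nat) \<Rightarrow> complex" where
  "khat K a b = (\<Sum>k\<in>box. \<Sum>l\<in>box. chi a l * K (point k) (point l) * cnj (chi b k)) / (of_nat (card (box :: ('d \<Rightarrow> nat) set)))\<^sup>2"

lemma om_power: "om ^ m = exp (2 * of_real pi * \<i> * of_nat m / of_nat (Suc L))"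
  unfolding om_def exp_of_nat_mult[symmetric] by (simp add: mult_ac)

lemma om_power_period: "om ^ Suc L = 1"
proof -
  have "complex_of_nat (Suc L) \<noteq> 0" by (simp del: of_nat_Suc)
  then show ?thesis unfolding om_power using exp_two_pi_i by (simp del: of_nat_Suc)
qed

lemma norm_om [simp]: "norm om = 1"
proof -
  have "om = cis (2 * pi / real (Suc L))" by (simp add: om_def cis_conv_exp mult_ac)
  then show ?thesis by simp
qed

lemma cnj_om_mult [simp]: "cnj om * om = 1" "om * cnj om = 1"
  using complex_norm_square[of om] by (simp_all add: mult.commute)

lemma om_power_mod: "om ^ (m mod Suc L) = om ^ m"
proof -
  have "om ^ m = om ^ (Suc L * (m div Suc L) + m mod Suc L)" by (simp only: mult_div_mod_eq)
  also have "\<dots> = om ^ (m mod Suc L)" by (simp only: power_add power_mult om_power_period power_one mult_1)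
  finally show ?thesis by simp
qed

lemma norm_chi [simp]: "norm (chi a k) = 1"
  by (simp add: chi_def prod_norm[symmetric] norm_power)

lemma finite_box [simp]: "finite (box :: ('d::finite \<Rightarrow> nat) set)"
  by (simp add: box_def finite_PiE)

lemma box_iff: "a \<in> box \<longleftrightarrow> (\<forall>j. a j < Suc L)"
  by (auto simp: box_def PiE_iff)

lemma card_box: "card (box :: ('d::finite \<Rightarrow> nat) set) = Suc L ^ CARD('d)"
  by (simp add: box_def card_PiE)

lemma card_box_pos: "0 < card (box :: ('d::finite \<Rightarrow> nat) set)"
  by (simp add: card_box)

lemma sum_om_powers:
  assumes "x < Suc L" "y < Suc L"
  shows "(\<Sum>k<Suc L. (om ^ x * cnj (om ^ y)) ^ k) = (if x = y then of_nat (Suc L) else 0)"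
proof (cases "x = y")
  case True
  have "om ^ y * cnj (om ^ y) = 1" by (simp flip: power_mult_distrib)
  then show ?thesis using True by simp
next
  case False
  let ?q = "om ^ x * cnj (om ^ y)"
  have "?q \<noteq> 1"
  proof
    assume "?q = 1"
    moreover have "cnj (om ^ y) * om ^ y = 1" by (simp flip: power_mult_distrib)
    ultimately have "om ^ x = om ^ y"
    proof -
      assume q1: "?q = 1" and y1: "cnj (om ^ y) * om ^ y = 1"
      have "om ^ x = ?q * om ^ y" unfolding mult.assoc y1 by simp
      then show ?thesis unfolding q1 by simp
    qed
    then have "x mod Suc L = y mod Suc L"
      unfolding om_power by (subst (asm) complex_root_unity_eq) auto
    then show False using assms False by simp
  qed
  moreover have "?q ^ Suc L = 1"
  proof -
    have "?q ^ Suc L = (om ^ Suc L) ^ x * cnj ((om ^ Suc L) ^ y)"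
      by (simp only: power_mult_distrib complex_cnj_power power_mult[symmetric] mult.commute)
    then show ?thesis by (simp only: om_power_period) simp
  qed
  ultimately have "(\<Sum>k<Suc L. ?q ^ k) = 0" using geometric_sum[of ?q "Suc L"] by simp
  then show ?thesis using False by simp
qed

lemma chi_orthogonal:
  assumes "a \<in> box" "b \<in> (box :: ('d::finite \<Rightarrow> nat) set)"
  shows "(\<Sum>k\<in>box. chi a k * cnj (chi b k)) = (if a = b then of_nat (card (box :: ('d \<Rightarrow> nat) set)) else 0)"
proof -
  have "(\<Sum>k\<in>box. chi a k * cnj (chi b k)) = (\<Sum>k\<in>box. \<Prod>j\<in>UNIV. (om ^ a j * cnj (om ^ b j)) ^ k j)"
    by (simp add: chi_def power_mult power_mult_distrib prod.distrib)
  also have "\<dots> = (\<Prod>j\<in>UNIV. \<Sum>k<Suc L. (om ^ a j * cnj (om ^ b j)) ^ k)"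
    unfolding box_def by (rule prod_sum_PiE[symmetric]) auto
  also have "\<dots> = (\<Prod>j\<in>UNIV. if a j = b j then of_nat (Suc L) else 0)"
    using assms by (intro prod.cong refl sum_om_powers) (auto simp: box_iff)
  also have "\<dots> = (if a = b then of_nat (card (box :: ('d \<Rightarrow> nat) set)) else 0)"
  proof (cases "a = b")
    case True
    then show ?thesis by (simp add: card_box)
  next
    case False
    then obtain j where "a j \<noteq> b j" by auto
    then have "(\<Prod>j\<in>UNIV. if a j = b j then of_nat (Suc L) else (0 :: complex)) = 0"
      by (intro prod_zero) auto
    then show ?thesis using False by simp
  qed
  finally show ?thesis .
qed

lemma pred_box: "a \<in> box \<Longrightarrow> pred j a \<in> box"
  by (auto simp: pred_def box_iff)

lemma succ_box: "a \<in> box \<Longrightarrow> succ j a \<in> box"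
  by (auto simp: succ_def box_iff)

lemma succ_pred: "a \<in> box \<Longrightarrow> succ j (pred j a) = a"
proof
  fix i assume "a \<in> box"
  then have "a j < Suc L" by (simp add: box_iff)
  then have "Suc ((a j + L) mod Suc L) mod Suc L = a j"
    by (simp add: mod_Suc_eq flip: add_Suc_right)
  then show "succ j (pred j a) i = a i" by (simp add: succ_def pred_def)
qed

lemma pred_succ: "a \<in> box \<Longrightarrow> pred j (succ j a) = a"
proof
  fix i assume "a \<in> box"
  then have "a j < Suc L" by (simp add: box_iff)
  then have "(Suc (a j) mod Suc L + L) mod Suc L = a j"
    by (simp add: mod_add_left_eq flip: add_Suc_right)
  then show "pred j (succ j a) i = a i" by (simp add: succ_def pred_def)
qed

lemma chi_pred: "chi (pred j a) k = chi a k * cnj (om ^ k j)"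
proof -
  have 1: "om ^ (((a j + L) mod Suc L) * k j) = om ^ (a j * k j) * cnj (om ^ k j)"
  proof -
    have "om ^ (((a j + L) mod Suc L) * k j) = (om ^ (a j + L)) ^ k j"
      by (simp only: power_mult om_power_mod)
    also have "om ^ (a j + L) = om ^ (a j + L) * (om * cnj om)" by simp
    also have "\<dots> = om ^ a j * om ^ Suc L * cnj om" by (simp add: power_add mult_ac)
    finally show ?thesis by (simp only: om_power_period) (simp add: power_mult_distrib power_mult)
  qed
  have "chi (pred j a) k = om ^ (pred j a j * k j) * (\<Prod>i\<in>UNIV - {j}. om ^ (pred j a i * k i))"
    unfolding chi_def by (rule prod.remove) auto
  also have "\<dots> = cnj (om ^ k j) * (om ^ (a j * k j) * (\<Prod>i\<in>UNIV - {j}. om ^ (a i * k i)))"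
    using 1 by (simp add: pred_def mult_ac)
  also have "om ^ (a j * k j) * (\<Prod>i\<in>UNIV - {j}. om ^ (a i * k i)) = chi a k"
    unfolding chi_def by (rule prod.remove[symmetric]) auto
  finally show ?thesis by (simp add: mult.commute)
qed

lemma point_polydisk: "point k \<in> polydisk"
  using r by (simp add: polydisk_def point_def norm_mult norm_power)

text \<open>\<open>khat\<close> is a congruence of the matrix of samples: its form at
  \<open>c\<close> is the form of the samples at \<open>u\<close>, up to a positive factor. The row
  index belongs to the second argument of the kernel, hence the conjugate of \<open>c\<close> inside
  \<open>u\<close>.\<close>

lemma psd_khat:
  assumes K: "psd_kernel polydisk K"
  shows "psd_matrix S (khat K)"
  unfolding psd_matrix_iff
proof
  fix c :: "('a \<Rightarrow> nat) \<Rightarrow> complex"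
  let ?C = "of_nat (card (box :: ('a \<Rightarrow> nat) set)) :: complex"
  define u where "u = (\<lambda>l. \<Sum>a\<in>S. chi a l * cnj (c a))"
  have "hform S (khat K) c = (\<Sum>a\<in>S. \<Sum>b\<in>S. \<Sum>k\<in>box. \<Sum>l\<in>box. (chi a l * cnj (c a)) * K (point k) (point l) * cnj (chi b k * cnj (c b)) / ?C\<^sup>2)"
    unfolding hform_def khat_def
    by (simp add: sum_divide_distrib sum_distrib_left sum_distrib_right mult_ac)
  also have "\<dots> = (\<Sum>a\<in>S. \<Sum>k\<in>box. \<Sum>b\<in>S. \<Sum>l\<in>box. (chi a l * cnj (c a)) * K (point k) (point l) * cnj (chi b k * cnj (c b)) / ?C\<^sup>2)"
    by (intro sum.cong refl sum.swap)
  also have "\<dots> = (\<Sum>k\<in>box. \<Sum>a\<in>S. \<Sum>b\<in>S. \<Sum>l\<in>box. (chi a l * cnj (c a)) * K (point k) (point l) * cnj (chi b k * cnj (c b)) / ?C\<^sup>2)"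
    by (rule sum.swap)
  also have "\<dots> = (\<Sum>k\<in>box. \<Sum>l\<in>box. \<Sum>b\<in>S. \<Sum>a\<in>S. (chi a l * cnj (c a)) * K (point k) (point l) * cnj (chi b k * cnj (c b)) / ?C\<^sup>2)"
  proof (rule sum.cong[OF refl])
    fix k :: "'a \<Rightarrow> nat"
    let ?f = "\<lambda>a b l. (chi a l * cnj (c a)) * K (point k) (point l) * cnj (chi b k * cnj (c b)) / ?C\<^sup>2"
    have "(\<Sum>a\<in>S. \<Sum>b\<in>S. \<Sum>l\<in>box. ?f a b l) = (\<Sum>b\<in>S. \<Sum>a\<in>S. \<Sum>l\<in>box. ?f a b l)" by (rule sum.swap)
    also have "\<dots> = (\<Sum>b\<in>S. \<Sum>l\<in>box. \<Sum>a\<in>S. ?f a b l)" by (intro sum.cong refl sum.swap)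
    also have "\<dots> = (\<Sum>l\<in>box. \<Sum>b\<in>S. \<Sum>a\<in>S. ?f a b l)" by (rule sum.swap)
    finally show "(\<Sum>a\<in>S. \<Sum>b\<in>S. \<Sum>l\<in>box. ?f a b l) = (\<Sum>l\<in>box. \<Sum>b\<in>S. \<Sum>a\<in>S. ?f a b l)" .
  qed
  also have "\<dots> = (\<Sum>k\<in>box. \<Sum>l\<in>box. cnj (u k) * K (point k) (point l) * u l / ?C\<^sup>2)"
  proof (rule sum.cong[OF refl], rule sum.cong[OF refl])
    fix k l :: "'a \<Rightarrow> nat"
    have "cnj (u k) * (K (point k) (point l) / ?C\<^sup>2) = (\<Sum>b\<in>S. cnj (chi b k * cnj (c b)) * (K (point k) (point l) / ?C\<^sup>2))"
      by (simp only: u_def cnj_sum sum_distrib_right)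
    then have "(cnj (u k) * (K (point k) (point l) / ?C\<^sup>2)) * u l
        = (\<Sum>b\<in>S. \<Sum>a\<in>S. cnj (chi b k * cnj (c b)) * (K (point k) (point l) / ?C\<^sup>2) * (chi a l * cnj (c a)))"
      by (simp only: u_def sum_product)
    also have "\<dots> = (\<Sum>b\<in>S. \<Sum>a\<in>S. (chi a l * cnj (c a)) * K (point k) (point l) * cnj (chi b k * cnj (c b)) / ?C\<^sup>2)"
      by (intro sum.cong refl) (simp only: times_divide_eq_left times_divide_eq_right mult_ac)
    finally show "(\<Sum>b\<in>S. \<Sum>a\<in>S. (chi a l * cnj (c a)) * K (point k) (point l) * cnj (chi b k * cnj (c b)) / ?C\<^sup>2)
        = cnj (u k) * K (point k) (point l) * u l / ?C\<^sup>2"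
      by (simp only: times_divide_eq_left times_divide_eq_right mult_ac)
  qed
  also have "\<dots> = hform box (\<lambda>k l. K (point k) (point l)) u / ?C\<^sup>2"
    by (simp add: hform_def sum_divide_distrib)
  also have "\<dots> = hform box (\<lambda>k l. K (point k) (point l)) u * of_real (1 / (real (card (box :: ('a \<Rightarrow> nat) set)))\<^sup>2)"
    by simp
  also have "\<dots> \<in> \<real>\<^sub>\<ge>\<^sub>0"
  proof (rule nonneg_Reals_mult_I)
    show "hform box (\<lambda>k l. K (point k) (point l)) u \<in> \<real>\<^sub>\<ge>\<^sub>0"
      using psd_kernel_family[OF K finite_box, of point] point_polydisk by (auto simp: psd_matrix_iff)
  qed (simp only: nonneg_Reals_of_real_iff, simp)
  finally show "hform S (khat K) c \<in> \<real>\<^sub>\<ge>\<^sub>0" .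
qed

lemma khat_cong:
  assumes "\<And>z w. z \<in> polydisk \<Longrightarrow> w \<in> polydisk \<Longrightarrow> K z w = K' z w"
  shows "khat K a b = khat K' a b"
  by (simp add: khat_def assms point_polydisk)

lemma khat_diff: "khat (\<lambda>z w. K z w - K' z w) a b = khat K a b - khat K' a b"
  by (simp add: khat_def algebra_simps sum_subtractf diff_divide_distrib)

lemma khat_sum: "khat (\<lambda>z w. \<Sum>i\<in>I. K i z w) a b = (\<Sum>i\<in>I. khat (K i) a b)"
proof (induction I rule: infinite_finite_induct)
  case (insert i I)
  have "khat (\<lambda>z w. K i z w + K' z w) a b = khat (K i) a b + khat K' a b" for K'
    by (simp add: khat_def algebra_simps sum.distrib add_divide_distrib)
  then show ?case using insert by simp
qed (simp_all add: khat_def)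

text \<open>On the grid \<open>cnj (w j) * z j\<close> is \<open>r\<^sup>2\<close> times a product
  of characters, and multiplication by a character shifts frequencies. All later estimates live on
  this factor \<open>r\<^sup>2\<close>.\<close>

lemma khat_shift: "khat (\<lambda>z w. cnj (w j) * z j * K z w) a b = of_real (r\<^sup>2) * khat K (pred j a) (pred j b)"
  by (simp add: khat_def chi_pred point_def sum_distrib_left power2_eq_square mult_ac)

lemma khat_product: "khat (\<lambda>z w. cnj (f w) * f z) a b = cnj (hat f a) * hat f b"
proof -
  have "khat (\<lambda>z w. cnj (f w) * f z) a b = (\<Sum>k\<in>box. \<Sum>l\<in>box. (f (point k) * cnj (chi b k)) * (cnj (f (point l)) * chi a l))
      / (of_nat (card (box :: ('a \<Rightarrow> nat) set)))\<^sup>2"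
    by (simp add: khat_def mult_ac)
  also have "\<dots> = (\<Sum>k\<in>box. f (point k) * cnj (chi b k)) * (\<Sum>l\<in>box. cnj (f (point l)) * chi a l)
      / (of_nat (card (box :: ('a \<Rightarrow> nat) set)))\<^sup>2"
    by (simp only: sum_product)
  finally show ?thesis by (simp add: hat_def power2_eq_square mult_ac)
qed

lemma hat_one:
  assumes "b \<in> box"
  shows "hat (\<lambda>_. 1) b = (if b = (\<lambda>_. 0) then 1 else 0)"
proof -
  have z: "(\<lambda>_. 0) \<in> box" by (simp add: box_iff)
  have "chi (\<lambda>_. 0) k = 1" for k :: "'a \<Rightarrow> nat" by (simp add: chi_def)
  then have "hat (\<lambda>_. 1) b = (\<Sum>k\<in>box. chi (\<lambda>_. 0) k * cnj (chi b k)) / of_nat (card (box :: ('a \<Rightarrow> nat) set))"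
    by (simp add: hat_def)
  then show ?thesis unfolding chi_orthogonal[OF z assms] using card_box_pos[where 'd = 'a] by auto
qed

lemma sum_pred:
  "(\<Sum>a\<in>box. F a (pred j a)) = (\<Sum>a\<in>box. F (succ j a) a)"
  by (rule sum.reindex_bij_witness[of _ "succ j" "pred j"]) (auto simp: succ_pred pred_succ pred_box succ_box)

end

section \<open>Fourier coefficients of the kernels and wrap-around estimates\<close>

locale agler_grid = grid +
  fixes \<phi> :: "('d::finite \<Rightarrow> complex) \<Rightarrow> complex" and K :: "'d \<Rightarrow> ('d \<Rightarrow> complex) \<Rightarrow> ('d \<Rightarrow> complex) \<Rightarrow> complex"
  assumes psd: "\<And>j. psd_kernel polydisk (K j)"
    and identity: "\<And>z w. z \<in> polydisk \<Longrightarrow> w \<in> polydisk \<Longrightarrow>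
      1 - cnj (\<phi> w) * \<phi> z = (\<Sum>j\<in>UNIV. (1 - cnj (w j) * z j) * K j z w)"
begin

text \<open>An exact discrete counterpart of (2), with the shift cyclic instead of truncated and
  damped by \<open>r\<^sup>2\<close>.\<close>

lemma khat_identity:
  assumes "a \<in> box" "b \<in> box"
  shows "(if a = (\<lambda>_. 0) \<and> b = (\<lambda>_. 0) then 1 else 0) - cnj (hat \<phi> a) * hat \<phi> b
    = (\<Sum>j\<in>UNIV. khat (K j) a b - of_real (r\<^sup>2) * khat (K j) (pred j a) (pred j b))"
proof -
  have "khat (\<lambda>z w. 1 - cnj (\<phi> w) * \<phi> z) a b = khat (\<lambda>z w. cnj ((\<lambda>_. 1) w) * (\<lambda>_. 1) z) a b - cnj (hat \<phi> a) * hat \<phi> b"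
    by (simp only: khat_diff khat_product complex_cnj_one mult_1)
  also have "khat (\<lambda>z w. cnj ((\<lambda>_. 1) w) * (\<lambda>_. 1) z) a b = (if a = (\<lambda>_. 0) \<and> b = (\<lambda>_. 0) then 1 else 0)"
    unfolding khat_product[of "\<lambda>_. 1"] hat_one[OF assms(1)] hat_one[OF assms(2)] by simp
  also have "khat (\<lambda>z w. 1 - cnj (\<phi> w) * \<phi> z) a b = khat (\<lambda>z w. \<Sum>j\<in>UNIV. K j z w - cnj (w j) * z j * K j z w) a b"
    by (rule khat_cong) (simp only: identity left_diff_distrib mult_1)
  also have "\<dots> = (\<Sum>j\<in>UNIV. khat (K j) a b - of_real (r\<^sup>2) * khat (K j) (pred j a) (pred j b))"
    by (simp only: khat_sum khat_diff khat_shift)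
  finally show ?thesis by simp
qed

definition diag :: "'d \<Rightarrow> ('d \<Rightarrow> nat) \<Rightarrow> real" where
  "diag j a = Re (khat (K j) a a)"

lemma diag_nonneg: "0 \<le> diag j a"
proof -
  have "khat (K j) a a \<in> \<real>\<^sub>\<ge>\<^sub>0" by (rule psd_matrix_diag[of "{a}"]) (use psd_khat psd in auto)
  then show ?thesis by (simp add: diag_def complex_nonneg_Reals_iff)
qed

lemma norm_khat_le: "(norm (khat (K j) a b))\<^sup>2 \<le> diag j a * diag j b"
  unfolding diag_def by (rule psd_matrix_Cauchy_Schwarz[of "{a, b}"]) (use psd_khat psd in auto)

text \<open>Summing the diagonal of the identity against a weight in the coordinate \<open>j\<close>: a shift in another coordinate
  is a bijection of the grid that preserves the weight, so those directions contribute nonnegatively.\<close>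

lemma weighted_diag_le:
  assumes w: "\<And>m. 0 \<le> w m"
  shows "(\<Sum>a\<in>box. diag j a * (w (a j) - r\<^sup>2 * w (Suc (a j) mod Suc L))) \<le> w 0"
proof -
  have r2: "0 \<le> 1 - r\<^sup>2" using r by (simp add: power_le_one)
  have pointwise: "(\<Sum>i\<in>UNIV. diag i a - r\<^sup>2 * diag i (pred i a)) \<le> (if a = (\<lambda>_. 0) then 1 else 0)" if "a \<in> box" for a
  proof -
    have "(\<Sum>i\<in>UNIV. diag i a - r\<^sup>2 * diag i (pred i a)) = Re (\<Sum>j\<in>UNIV. khat (K j) a a - of_real (r\<^sup>2) * khat (K j) (pred j a) (pred j a))"
      by (simp add: diag_def del: of_real_power)
    also have "\<dots> = (if a = (\<lambda>_. 0) then 1 else 0) - Re (cnj (hat \<phi> a) * hat \<phi> a)"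
      unfolding khat_identity[OF that that, symmetric] by simp
    also have "\<dots> \<le> (if a = (\<lambda>_. 0) then 1 else 0)" by simp
    finally show ?thesis .
  qed
  have "(\<Sum>a\<in>box. w (a j) * (\<Sum>i\<in>UNIV. diag i a - r\<^sup>2 * diag i (pred i a))) \<le> (\<Sum>a\<in>box. w (a j) * (if a = (\<lambda>_. 0) then 1 else 0))"
    using w pointwise by (intro sum_mono mult_left_mono) auto
  also have "\<dots> = w 0"
  proof -
    have "(\<lambda>_. 0) \<in> (box :: ('d \<Rightarrow> nat) set)" by (simp add: box_iff)
    then show ?thesis by (simp add: if_distrib[of "\<lambda>x. _ * x"] cong: if_cong)
  qed
  finally have le: "(\<Sum>a\<in>box. w (a j) * (\<Sum>i\<in>UNIV. diag i a - r\<^sup>2 * diag i (pred i a))) \<le> w 0" .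
  define D where "D = (\<lambda>i. \<Sum>a\<in>box. diag i a * (w (a j) - r\<^sup>2 * w (succ i a j)))"
  have "(\<Sum>a\<in>box. w (a j) * (\<Sum>i\<in>UNIV. diag i a - r\<^sup>2 * diag i (pred i a)))
      = (\<Sum>i\<in>UNIV. \<Sum>a\<in>box. w (a j) * (diag i a - r\<^sup>2 * diag i (pred i a)))"
    by (simp only: sum_distrib_left) (rule sum.swap)
  also have "\<dots> = (\<Sum>i\<in>UNIV. D i)"
  proof (intro sum.cong refl)
    fix i
    have "(\<Sum>a\<in>box. w (a j) * (diag i a - r\<^sup>2 * diag i (pred i a)))
      = (\<Sum>a\<in>box. w (a j) * diag i a) - (\<Sum>a\<in>box. r\<^sup>2 * (w (a j) * diag i (pred i a)))"
      by (simp add: algebra_simps sum_subtractf)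
    also have "(\<Sum>a\<in>box. r\<^sup>2 * (w (a j) * diag i (pred i a))) = (\<Sum>a\<in>box. r\<^sup>2 * (w (succ i a j) * diag i a))"
      by (rule sum_pred)
    finally show "(\<Sum>a\<in>box. w (a j) * (diag i a - r\<^sup>2 * diag i (pred i a))) = D i"
      by (simp add: D_def algebra_simps sum_subtractf)
  qed
  finally have "(\<Sum>i\<in>UNIV. D i) \<le> w 0" using le by simp
  moreover have "D j \<le> (\<Sum>i\<in>UNIV. D i)"
  proof (rule member_le_sum)
    fix i assume "i \<in> UNIV - {j}"
    then have "succ i a j = a j" for a by (simp add: succ_def)
    then have "D i = (\<Sum>a\<in>box. diag i a * (w (a j) * (1 - r\<^sup>2)))" by (simp add: D_def algebra_simps)
    then show "0 \<le> D i" using diag_nonneg w r2 by (auto intro!: sum_nonneg mult_nonneg_nonneg)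
  qed auto
  moreover have "D j = (\<Sum>a\<in>box. diag j a * (w (a j) - r\<^sup>2 * w (Suc (a j) mod Suc L)))"
    by (simp add: D_def succ_def)
  ultimately show ?thesis by linarith
qed

text \<open>The constant weight 1: even the sum of the diagonal over all frequencies obeys this
  bound.\<close>

lemma diag_le:
  assumes "a \<in> box"
  shows "diag j a \<le> 1 / (1 - r\<^sup>2)"
proof -
  have r2: "0 < 1 - r\<^sup>2" using r by (simp add: power_less_one_iff)
  have "diag j a * (1 - r\<^sup>2) \<le> (\<Sum>a\<in>box. diag j a * (1 - r\<^sup>2))"
    using assms diag_nonneg r2 by (intro member_le_sum) auto
  also have "\<dots> \<le> 1" using weighted_diag_le[of "\<lambda>_. 1" j] by simp
  finally show ?thesis using r2 by (simp add: field_simps)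
qed

text \<open>The weight \<open>r\<^bsup>2(L - m)\<^esup>\<close> is annihilated by the shift except at \<open>m = L\<close>.\<close>

lemma diag_last_le:
  assumes a: "a \<in> box" "a j = L"
  shows "diag j a \<le> (r\<^sup>2) ^ L / (1 - r\<^sup>2)"
proof -
  have r2: "0 < 1 - r\<^sup>2" using r by (simp add: power_less_one_iff)
  have r2': "0 \<le> r\<^sup>2" "r\<^sup>2 \<le> 1" using r by (auto simp: power_le_one)
  define w where "w = (\<lambda>m. (r\<^sup>2) ^ (L - m))"
  \<comment> \<open>At \<open>m = L\<close> the successor wraps to 0, where the weight is
    \<open>(r\<^sup>2) ^ L \<le> 1\<close>; so at least \<open>1 - r\<^sup>2\<close> survives, while
    the total is bounded by the small weight \<open>w 0\<close>.\<close>
  have last: "1 - r\<^sup>2 \<le> w L - r\<^sup>2 * w (Suc L mod Suc L)"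
    using r2' by (simp add: w_def power_le_one mult_left_le)
  have inner: "w m - r\<^sup>2 * w (Suc m mod Suc L) = 0" if "m < L" for m
    using that by (simp add: w_def Suc_diff_Suc flip: power_Suc)
  have nonneg: "0 \<le> diag j b * (w (b j) - r\<^sup>2 * w (Suc (b j) mod Suc L))" if "b \<in> box" for b
  proof (cases "b j = L")
    case True
    then show ?thesis using last r2 diag_nonneg by simp
  next
    case False
    then have "b j < L" using that by (metis box_iff less_Suc_eq)
    then show ?thesis using inner by simp
  qed
  have "diag j a * (1 - r\<^sup>2) \<le> diag j a * (w (a j) - r\<^sup>2 * w (Suc (a j) mod Suc L))"
    using last a(2) diag_nonneg by (intro mult_left_mono) auto
  also have "\<dots> \<le> (\<Sum>b\<in>box. diag j b * (w (b j) - r\<^sup>2 * w (Suc (b j) mod Suc L)))"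
    using a(1) nonneg by (intro member_le_sum[of a box "\<lambda>b. diag j b * (w (b j) - r\<^sup>2 * w (Suc (b j) mod Suc L))"]) auto
  also have "\<dots> \<le> w 0" using r2' by (intro weighted_diag_le) (simp add: w_def)
  finally show ?thesis using r2 by (simp add: w_def field_simps)
qed

text \<open>By Cauchy-Schwarz one small diagonal entry suffices; the square root turns its decay
  \<open>(r\<^sup>2) ^ L\<close> into \<open>r ^ L\<close>.\<close>

lemma norm_khat_wrapped_le:
  assumes "a \<in> box" "b \<in> box" "a j = L \<or> b j = L"
  shows "norm (khat (K j) a b) \<le> r ^ L / (1 - r\<^sup>2)"
proof -
  have r2: "0 < 1 - r\<^sup>2" using r by (simp add: power_less_one_iff)
  have "diag j a * diag j b \<le> ((r\<^sup>2) ^ L / (1 - r\<^sup>2)) * (1 / (1 - r\<^sup>2))"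
    using assms(3)
  proof
    assume "a j = L"
    then show ?thesis using diag_last_le[OF assms(1)] diag_le[OF assms(2), of j] diag_nonneg r2 by (intro mult_mono) auto
  next
    assume "b j = L"
    then have "diag j b * diag j a \<le> ((r\<^sup>2) ^ L / (1 - r\<^sup>2)) * (1 / (1 - r\<^sup>2))"
      using diag_last_le[OF assms(2)] diag_le[OF assms(1), of j] diag_nonneg r2 by (intro mult_mono) auto
    then show ?thesis by (simp only: mult.commute)
  qed
  also have "\<dots> = (r ^ L / (1 - r\<^sup>2))\<^sup>2"
    by (simp add: power_divide power2_eq_square power_mult_distrib)
  finally have "diag j a * diag j b \<le> (r ^ L / (1 - r\<^sup>2))\<^sup>2" .
  from order_trans[OF norm_khat_le this] show ?thesis
    by (rule power2_le_imp_le) (use r r2 in auto)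
qed

text \<open>Fourier coefficients carry powers of \<open>r\<close> where (2) has Taylor coefficients.
  Dividing them out cancels the factor \<open>r\<^sup>2\<close> of the cyclic shift and leaves the
  undamped shift of (2).\<close>

definition grid_matrix :: "'d \<Rightarrow> 'd mindex \<Rightarrow> 'd mindex \<Rightarrow> complex" where
  "grid_matrix j \<alpha> \<beta> = khat (K j) (lookup \<alpha>) (lookup \<beta>) / of_real (r ^ (msize \<alpha> + msize \<beta>))"

lemma psd_grid_matrix: "psd_matrix S (grid_matrix j)"
proof (cases "finite S")
  case True
  have "hform S (grid_matrix j) c \<in> \<real>\<^sub>\<ge>\<^sub>0" for c
  proof -
    let ?d = "\<lambda>\<alpha>. c \<alpha> / of_real (r ^ msize \<alpha>)"
    have inj: "inj_on lookup S" by (simp add: inj_on_def poly_mapping.lookup_inject)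
    define d where "d = (\<lambda>a. ?d (the_inv_into S lookup a))"
    have d: "d (lookup \<alpha>) = ?d \<alpha>" if "\<alpha> \<in> S" for \<alpha>
      using that by (simp add: d_def the_inv_into_f_f[OF inj])
    have "hform S (grid_matrix j) c = hform (lookup ` S) (khat (K j)) d"
      unfolding hform_def sum.reindex[OF inj] o_def
      by (intro sum.cong refl) (simp add: d grid_matrix_def power_add)
    then show ?thesis using psd_khat[OF psd, of "lookup ` S" j] by (simp add: psd_matrix_iff)
  qed
  then show ?thesis by (simp add: psd_matrix_iff)
qed (simp add: psd_matrix_def)

text \<open>\<open>N \<le> L\<close> puts all exponents of the index set inside the grid. There the
  cyclic shift agrees with the truncated one except in directions \<open>j\<close> where a
  coordinate of \<alpha> or \<beta> is zero; in those it wraps to frequency \<open>L\<close> and is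
  exponentially small.\<close>

lemma shift_defect_grid_matrix:
  assumes N: "N \<le> L" and ab: "\<alpha> \<in> index_set N" "\<beta> \<in> index_set N"
  shows "norm (shift_defect grid_matrix \<alpha> \<beta> * of_real (r ^ (msize \<alpha> + msize \<beta>))
      - ((if \<alpha> = 0 \<and> \<beta> = 0 then 1 else 0) - cnj (hat \<phi> (lookup \<alpha>)) * hat \<phi> (lookup \<beta>)))
    \<le> real CARD('d) * (r\<^sup>2 * (r ^ L / (1 - r\<^sup>2)))"
proof -
  let ?a = "lookup \<alpha>" and ?b = "lookup \<beta>"
  let ?R = "complex_of_real (r ^ (msize \<alpha> + msize \<beta>))"
  have R: "?R \<noteq> 0" using r by simp
  have box: "lookup \<gamma> \<in> box" if "\<gamma> \<in> index_set N" for \<gamma> :: "'d mindex"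
  proof -
    have "lookup \<gamma> j < Suc L" for j
      using that lookup_le_msize[of \<gamma> j] N by (simp add: index_set_def)
    then show ?thesis by (simp add: box_iff)
  qed
  have pred_lookup: "pred j (lookup \<gamma>) = lookup (\<gamma> - unit_index j)"
    if "\<gamma> \<in> index_set N" "lookup \<gamma> j > 0" for \<gamma> :: "'d mindex" and j
  proof
    fix i
    have "lookup \<gamma> j < Suc L" using box[OF that(1)] by (simp add: box_iff)
    then have "(lookup \<gamma> j + L) mod Suc L = lookup \<gamma> j - 1"
    proof -
      assume "lookup \<gamma> j < Suc L"
      moreover have "lookup \<gamma> j + L = (lookup \<gamma> j - 1) + Suc L" using that(2) by simp
      ultimately show ?thesis by (metis add.commute less_imp_diff_less mod_add_self1 mod_less)
    qed
    then show "pred j (lookup \<gamma>) i = lookup (\<gamma> - unit_index j) i"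
      by (simp add: pred_def lookup_minus lookup_unit_index)
  qed
  have pred_zero: "pred j a j = L" if "a j = 0" for j and a :: "'d \<Rightarrow> nat" using that by (simp add: pred_def)
  \<comment> \<open>The wrapped terms: the discrete identity subtracts them, whereas
    \<open>shifted_entry\<close> has a zero in their place.\<close>
  define e where "e = (\<lambda>j. if ?a j > 0 \<and> ?b j > 0 then 0 else of_real (r\<^sup>2) * khat (K j) (pred j ?a) (pred j ?b))"
  have entry: "(grid_matrix j \<alpha> \<beta> - shifted_entry j (grid_matrix j) \<alpha> \<beta>) * ?R
      = khat (K j) ?a ?b - of_real (r\<^sup>2) * khat (K j) (pred j ?a) (pred j ?b) + e j" for j
  proof (cases "?a j > 0 \<and> ?b j > 0")
    case True
    let ?S = "complex_of_real (r ^ (msize (\<alpha> - unit_index j) + msize (\<beta> - unit_index j)))"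
    have S: "?S \<noteq> 0" using r by simp
    have "msize \<alpha> + msize \<beta> = 2 + (msize (\<alpha> - unit_index j) + msize (\<beta> - unit_index j))"
      using True msize_minus_unit_index[of \<alpha> j] msize_minus_unit_index[of \<beta> j] by simp
    then have RS: "?R = of_real (r\<^sup>2) * ?S" by (simp only: power_add of_real_mult)
    have g: "grid_matrix j \<alpha> \<beta> * ?R = khat (K j) ?a ?b" using R by (simp add: grid_matrix_def)
    have g': "shifted_entry j (grid_matrix j) \<alpha> \<beta> * ?S = khat (K j) (pred j ?a) (pred j ?b)"
      using True S ab by (simp add: shifted_entry_def grid_matrix_def pred_lookup)
    have g2: "shifted_entry j (grid_matrix j) \<alpha> \<beta> * ?R = of_real (r\<^sup>2) * khat (K j) (pred j ?a) (pred j ?b)"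
      unfolding RS g'[symmetric] by (simp only: mult_ac)
    show ?thesis unfolding left_diff_distrib g g2 using True by (simp add: e_def)
  next
    case False
    then show ?thesis using R by (auto simp: e_def shifted_entry_def grid_matrix_def)
  qed
  have "shift_defect grid_matrix \<alpha> \<beta> * ?R
      = (\<Sum>j\<in>UNIV. khat (K j) ?a ?b - of_real (r\<^sup>2) * khat (K j) (pred j ?a) (pred j ?b)) + (\<Sum>j\<in>UNIV. e j)"
    unfolding shift_defect_def sum_distrib_right entry sum.distrib ..
  also have "(\<Sum>j\<in>UNIV. khat (K j) ?a ?b - of_real (r\<^sup>2) * khat (K j) (pred j ?a) (pred j ?b))
      = (if \<alpha> = 0 \<and> \<beta> = 0 then 1 else 0) - cnj (hat \<phi> ?a) * hat \<phi> ?b"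
  proof -
    have "?a = (\<lambda>_. 0) \<longleftrightarrow> \<alpha> = 0" "?b = (\<lambda>_. 0) \<longleftrightarrow> \<beta> = 0" by (auto simp: poly_mapping_eq_iff fun_eq_iff)
    then show ?thesis unfolding khat_identity[OF box[OF ab(1)] box[OF ab(2)], symmetric] by simp
  qed
  finally have eq: "shift_defect grid_matrix \<alpha> \<beta> * ?R
      - ((if \<alpha> = 0 \<and> \<beta> = 0 then 1 else 0) - cnj (hat \<phi> ?a) * hat \<phi> ?b) = (\<Sum>j\<in>UNIV. e j)" by simp
  have "norm (e j) \<le> r\<^sup>2 * (r ^ L / (1 - r\<^sup>2))" for j
  proof (cases "?a j > 0 \<and> ?b j > 0")
    case True
    then show ?thesis using r by (simp add: e_def power_le_one)
  next
    case False
    then have "pred j ?a j = L \<or> pred j ?b j = L" using pred_zero by blast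
    then have "norm (khat (K j) (pred j ?a) (pred j ?b)) \<le> r ^ L / (1 - r\<^sup>2)"
      using ab by (intro norm_khat_wrapped_le pred_box box)
    then have "r\<^sup>2 * norm (khat (K j) (pred j ?a) (pred j ?b)) \<le> r\<^sup>2 * (r ^ L / (1 - r\<^sup>2))"
      by (rule mult_left_mono) simp
    moreover have "norm (e j) = r\<^sup>2 * norm (khat (K j) (pred j ?a) (pred j ?b))"
      using False by (auto simp: e_def norm_mult norm_power)
    ultimately show ?thesis by simp
  qed
  then have "norm (\<Sum>j\<in>UNIV. e j) \<le> (\<Sum>j\<in>(UNIV :: 'd set). r\<^sup>2 * (r ^ L / (1 - r\<^sup>2)))"
    by (intro sum_norm_le) auto
  then show ?thesis unfolding eq by simp
qed

end

section \<open>Aliasing, and the limit of fine grids: from (4) to (2)\<close>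

context grid
begin

lemma monom_at_point: "monom_at (point k) \<beta> = of_real (r ^ msize \<beta>) * chi (lookup \<beta>) k"
proof -
  have "monom_at (point k) \<beta> = (\<Prod>j\<in>UNIV. of_real r ^ lookup \<beta> j) * chi (lookup \<beta>) k"
    by (simp add: monom_at_def point_def chi_def power_mult_distrib prod.distrib power_mult[symmetric] mult.commute)
  then show ?thesis by (simp add: msize_def power_sum)
qed

text \<open>Aliasing: the discrete Fourier coefficient differs from the Taylor coefficient by a sum over exponents
  outside the grid.\<close>

lemma norm_hat_minus_coeff_le:
  fixes c :: "'d::finite mindex \<Rightarrow> complex"
  assumes summable: "(\<lambda>\<beta>. norm (c \<beta>) * r ^ msize \<beta>) summable_on UNIV"
    and series: "\<And>k. ((\<lambda>\<beta>. c \<beta> * monom_at (point k) \<beta>) has_sum f (point k)) UNIV"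
    and F: "\<And>\<beta>. \<beta> \<in> F \<Longrightarrow> lookup \<beta> \<in> box" and \<alpha>: "\<alpha> \<in> F"
  shows "norm (hat f (lookup \<alpha>) - c \<alpha> * of_real (r ^ msize \<alpha>))
    \<le> infsum (\<lambda>\<beta>. norm (c \<beta>) * r ^ msize \<beta>) (- F)"
proof -
  let ?C = "of_nat (card (box :: ('d \<Rightarrow> nat) set)) :: complex"
  define t where "t = (\<lambda>\<beta>. c \<beta> * of_real (r ^ msize \<beta>))"
  \<comment> \<open>The contribution of the monomial with exponent \<beta> to the frequency
    \<alpha>: by orthogonality it is 0 or 1 inside the grid, and by the triangle inequality at most
    1 in modulus elsewhere.\<close>
  define e where "e = (\<lambda>\<beta>. (\<Sum>k\<in>box. chi (lookup \<beta>) k * cnj (chi (lookup \<alpha>) k)) / ?C)"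
  have C: "?C \<noteq> 0" using card_box_pos[where 'd = 'd] by auto
  have nt: "norm (t \<beta>) = norm (c \<beta>) * r ^ msize \<beta>" for \<beta>
    using r by (simp add: t_def norm_mult norm_power)
  have e_F: "e \<beta> = (if \<beta> = \<alpha> then 1 else 0)" if "\<beta> \<in> F" for \<beta>
    unfolding e_def chi_orthogonal[OF F[OF that] F[OF \<alpha>]] using C by (simp add: poly_mapping.lookup_inject)
  have e_le: "norm (e \<beta>) \<le> 1" for \<beta>
  proof -
    have "norm (\<Sum>k\<in>box. chi (lookup \<beta>) k * cnj (chi (lookup \<alpha>) k)) \<le> (\<Sum>k\<in>(box :: ('d \<Rightarrow> nat) set). 1)"
      by (rule sum_norm_le) (simp add: norm_mult)
    then show ?thesis using card_box_pos[where 'd = 'd] by (simp add: e_def norm_divide)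
  qed
  have "((\<lambda>\<beta>. \<Sum>k\<in>box. (c \<beta> * monom_at (point k) \<beta>) * (cnj (chi (lookup \<alpha>) k) / ?C)) has_sum
      (\<Sum>k\<in>box. f (point k) * (cnj (chi (lookup \<alpha>) k) / ?C))) UNIV"
    by (intro has_sum_finite_sum finite_box has_sum_cmult_left series)
  moreover have "(\<Sum>k\<in>box. f (point k) * (cnj (chi (lookup \<alpha>) k) / ?C)) = hat f (lookup \<alpha>)"
    by (simp add: hat_def sum_divide_distrib)
  moreover have "(\<Sum>k\<in>box. (c \<beta> * monom_at (point k) \<beta>) * (cnj (chi (lookup \<alpha>) k) / ?C)) = t \<beta> * e \<beta>" for \<beta>
    by (simp add: monom_at_point t_def e_def sum_divide_distrib sum_distrib_left mult_ac)
  ultimately have 1: "((\<lambda>\<beta>. t \<beta> * e \<beta>) has_sum hat f (lookup \<alpha>)) UNIV" by simp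
  have 2: "((\<lambda>\<beta>. if \<beta> = \<alpha> then - t \<alpha> else 0) has_sum (- t \<alpha>)) UNIV"
    using has_sum_supported[of "{\<alpha>}" "\<lambda>\<beta>. if \<beta> = \<alpha> then - t \<alpha> else 0"] by simp
  have "((\<lambda>\<beta>. t \<beta> * e \<beta> + (if \<beta> = \<alpha> then - t \<alpha> else 0)) has_sum (hat f (lookup \<alpha>) + - t \<alpha>)) UNIV"
    by (rule has_sum_add[OF 1 2])
  also have "?this \<longleftrightarrow> ((\<lambda>\<beta>. t \<beta> * e \<beta>) has_sum (hat f (lookup \<alpha>) + - t \<alpha>)) (- F)"
    using e_F \<alpha> by (intro has_sum_cong_neutral) auto
  finally have D: "((\<lambda>\<beta>. t \<beta> * e \<beta>) has_sum (hat f (lookup \<alpha>) + - t \<alpha>)) (- F)" .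
  have sF: "(\<lambda>\<beta>. norm (c \<beta>) * r ^ msize \<beta>) summable_on (- F)"
    using summable by (rule summable_on_subset_banach) simp
  have le: "norm (t \<beta> * e \<beta>) \<le> norm (c \<beta>) * r ^ msize \<beta>" for \<beta>
  proof -
    have "norm (t \<beta>) * norm (e \<beta>) \<le> norm (t \<beta>) * 1" by (intro mult_left_mono e_le norm_ge_zero)
    then show ?thesis by (simp only: norm_mult nt mult_1_right)
  qed
  have abs: "(\<lambda>\<beta>. norm (t \<beta> * e \<beta>)) summable_on (- F)"
  proof (rule Infinite_Sum.abs_summable_on_comparison_test)
    show "(\<lambda>\<beta>. norm (norm (c \<beta>) * r ^ msize \<beta>)) summable_on (- F)" using sF r by (simp add: norm_mult norm_power)
    show "norm (t \<beta> * e \<beta>) \<le> norm (norm (c \<beta>) * r ^ msize \<beta>)" for \<beta> using le[of \<beta>] r by (simp add: norm_mult norm_power)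
  qed
  have "norm (hat f (lookup \<alpha>) + - t \<alpha>) \<le> infsum (\<lambda>\<beta>. norm (t \<beta> * e \<beta>)) (- F)"
    by (rule norm_has_sum_bound[OF has_sum_infsum[OF abs] D])
  also have "\<dots> \<le> infsum (\<lambda>\<beta>. norm (c \<beta>) * r ^ msize \<beta>) (- F)"
    by (rule infsum_mono[OF abs sF le])
  finally show ?thesis by (simp add: t_def)
qed

end

lemma infsum_tail_small:
  fixes h :: "'a \<Rightarrow> real"
  assumes "h summable_on UNIV" "0 < \<epsilon>"
  shows "\<exists>X. finite X \<and> (\<forall>Y. finite Y \<and> X \<subseteq> Y \<longrightarrow> infsum h (- Y) < \<epsilon>)"
proof -
  have "\<forall>\<^sub>F Y in finite_subsets_at_top UNIV. dist (sum h Y) (infsum h UNIV) < \<epsilon>"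
    using infsum_tendsto[OF assms(1)] assms(2) by (rule tendstoD)
  then obtain X where X: "finite X" "\<And>Y. finite Y \<Longrightarrow> X \<subseteq> Y \<Longrightarrow> dist (sum h Y) (infsum h UNIV) < \<epsilon>"
    unfolding eventually_finite_subsets_at_top by auto
  have "infsum h (- Y) < \<epsilon>" if "finite Y" "X \<subseteq> Y" for Y
  proof -
    have "h summable_on (- Y)" using assms(1) by (rule summable_on_subset_banach) simp
    then have "(h has_sum (sum h Y + infsum h (- Y))) (Y \<union> - Y)"
      using that by (intro has_sum_Un_disjoint has_sum_infsum) auto
    then have "infsum h UNIV = sum h Y + infsum h (- Y)" by (intro infsumI) simp
    then show ?thesis using X(2)[OF that] by (simp add: dist_real_def)
  qed
  then show ?thesis using X(1) by blast
qed

text \<open>Once the grid contains a finite set of exponents that carries all but \<epsilon> of the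
  absolute series, the aliasing error is below \<epsilon>. The offset \<open>N\<close> in the grid
  size makes every grid large enough for the index set.\<close>

lemma hat_tendsto:
  fixes c :: "'d::finite mindex \<Rightarrow> complex"
  assumes r: "0 < r" "r < 1"
    and summable: "(\<lambda>\<beta>. norm (c \<beta>) * r ^ msize \<beta>) summable_on UNIV"
    and series: "\<And>z. (\<And>j. norm (z j) \<le> r) \<Longrightarrow> ((\<lambda>\<beta>. c \<beta> * monom_at z \<beta>) has_sum f z) UNIV"
  shows "(\<lambda>n. grid.hat (N + n) r f (lookup \<alpha>)) \<longlonglongrightarrow> c \<alpha> * of_real (r ^ msize \<alpha>)"
proof (rule LIMSEQ_I)
  fix \<epsilon> :: real assume "0 < \<epsilon>"
  from infsum_tail_small[OF summable this] obtain X where X: "finite X"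
    "\<And>Y. finite Y \<Longrightarrow> X \<subseteq> Y \<Longrightarrow> infsum (\<lambda>\<beta>. norm (c \<beta>) * r ^ msize \<beta>) (- Y) < \<epsilon>" by blast
  define Y where "Y = insert \<alpha> X"
  show "\<exists>no. \<forall>n\<ge>no. norm (grid.hat (N + n) r f (lookup \<alpha>) - c \<alpha> * of_real (r ^ msize \<alpha>)) < \<epsilon>"
  proof (intro exI allI impI)
    fix n assume n: "(\<Sum>\<beta>\<in>Y. msize \<beta>) \<le> n"
    interpret grid "N + n" r by unfold_locales (use r in auto)
    have box: "lookup \<beta> \<in> box" if "\<beta> \<in> Y" for \<beta>
    proof -
      have "lookup \<beta> j < Suc (N + n)" for j
        using lookup_le_msize[of \<beta> j] member_le_sum[of \<beta> Y msize] that n X(1) by (simp add: Y_def)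
      then show ?thesis by (simp add: box_iff)
    qed
    have "((\<lambda>\<beta>. c \<beta> * monom_at (point k) \<beta>) has_sum f (point k)) UNIV" for k
      using r by (intro series) (simp add: point_def norm_mult norm_power)
    from norm_hat_minus_coeff_le[where F = Y and \<alpha> = \<alpha> and c = c and f = f, OF summable this box]
    have "norm (hat f (lookup \<alpha>) - c \<alpha> * of_real (r ^ msize \<alpha>)) \<le> infsum (\<lambda>\<beta>. norm (c \<beta>) * r ^ msize \<beta>) (- Y)"
      by (simp add: Y_def)
    also have "\<dots> < \<epsilon>" using X by (intro X(2)) (auto simp: Y_def)
    finally show "norm (hat f (lookup \<alpha>) - c \<alpha> * of_real (r ^ msize \<alpha>)) < \<epsilon>" .
  qed
qed

lemma inner_interpolation_imp_matrix_decomposition: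
  fixes p :: "'d::finite cpoly"
  assumes "inner_interpolation N p"
  shows "matrix_decomposition N p"
proof -
  let ?I = "index_set N :: 'd mindex set" and ?p = "lookup p"
  obtain \<phi> and K :: "'d \<Rightarrow> ('d \<Rightarrow> complex) \<Rightarrow> ('d \<Rightarrow> complex) \<Rightarrow> complex"
    where van: "vanishes_to_order (\<lambda>z. eval_poly p z - \<phi> z) (N + 1)"
    and psd: "\<And>j. psd_kernel polydisk (K j)"
    and identity: "\<And>z w. z \<in> polydisk \<Longrightarrow> w \<in> polydisk \<Longrightarrow>
      1 - cnj (\<phi> w) * \<phi> z = (\<Sum>j\<in>UNIV. (1 - cnj (w j) * z j) * K j z w)"
    using assms unfolding inner_interpolation_def by blast
  obtain c' \<rho> where \<rho>: "0 < \<rho>"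
    and c': "\<And>z. (\<And>j. norm (z j) < \<rho>) \<Longrightarrow> ((\<lambda>\<alpha>. c' \<alpha> * monom_at z \<alpha>) has_sum (eval_poly p z - \<phi> z)) UNIV"
    and c'0: "\<And>\<alpha>. msize \<alpha> < N + 1 \<Longrightarrow> c' \<alpha> = 0"
    using van unfolding vanishes_to_order_def taylor_coeffs_def by blast
  \<comment> \<open>Below both 1 and the radius of convergence, so that the grid lies in the
    polydisk and all samples are given by the Taylor series; \<open>r\<close> is fixed for all
    grids.\<close>
  define r where "r = min \<rho> 1 / 2"
  have r: "0 < r" "r < 1" "r < \<rho>" using \<rho> by (auto simp: r_def)
  define c where "c = (\<lambda>\<beta>. ?p \<beta> - c' \<beta>)"
  have series: "((\<lambda>\<beta>. c \<beta> * monom_at z \<beta>) has_sum \<phi> z) UNIV" if "\<And>j. norm (z j) \<le> r" for z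
  proof -
    have "((\<lambda>\<alpha>. c' \<alpha> * monom_at z \<alpha>) has_sum (eval_poly p z - \<phi> z)) UNIV"
      by (rule c') (use that r in \<open>auto intro: le_less_trans\<close>)
    from has_sum_add[OF eval_poly_has_sum[of p z] has_sum_cmult_right[OF this, of "-1"]]
    show ?thesis by (simp add: c_def algebra_simps)
  qed
  \<comment> \<open>Unconditional convergence at the single point with all coordinates equal to
    \<open>r\<close> is absolute convergence for complex numbers.\<close>
  have summable: "(\<lambda>\<beta>. norm (c \<beta>) * r ^ msize \<beta>) summable_on UNIV"
  proof -
    have m: "monom_at (\<lambda>_. complex_of_real r) \<beta> = of_real (r ^ msize \<beta>)" for \<beta> :: "'d mindex"
      by (simp add: monom_at_def msize_def power_sum)
    have "(\<lambda>\<beta>. c \<beta> * monom_at (\<lambda>_. complex_of_real r) \<beta>) summable_on UNIV"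
      using series[of "\<lambda>_. of_real r"] r by (auto simp: summable_on_def)
    then have "(\<lambda>\<beta>. norm (c \<beta> * monom_at (\<lambda>_. complex_of_real r) \<beta>)) summable_on UNIV"
      by (simp only: summable_on_iff_abs_summable_on_complex)
    then show ?thesis using r by (simp add: m norm_mult norm_power)
  qed
  have cp: "c \<beta> = ?p \<beta>" if "\<beta> \<in> ?I" for \<beta> using that c'0[of \<beta>] by (simp add: c_def index_set_def)
  have hat: "(\<lambda>n. grid.hat (N + n) r \<phi> (lookup \<beta>)) \<longlonglongrightarrow> ?p \<beta> * of_real (r ^ msize \<beta>)" if "\<beta> \<in> ?I" for \<beta>
    using hat_tendsto[OF r(1,2) summable series, of N \<beta>] cp[OF that] by simp
  have grid: "agler_grid r \<phi> K" by unfold_locales (use r psd identity in auto)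
  define A where "A = (\<lambda>n. agler_grid.grid_matrix (N + n) r K)"
  define H where "H = (\<lambda>\<alpha> \<beta> :: 'd mindex. (if \<alpha> = 0 \<and> \<beta> = 0 then 1 else 0) - cnj (?p \<alpha>) * ?p \<beta>)"
  have "\<exists>B. (\<forall>j. psd_matrix ?I (B j)) \<and> (\<forall>\<alpha>\<in>?I. \<forall>\<beta>\<in>?I. H \<alpha> \<beta> = shift_defect B \<alpha> \<beta>)"
  proof (rule shift_defect_closed[where A = A])
    show "psd_matrix ?I (A n j)" for n j
      unfolding A_def using agler_grid.psd_grid_matrix[OF grid] .
    fix \<alpha> \<beta> :: "'d mindex" assume ab: "\<alpha> \<in> ?I" "\<beta> \<in> ?I"
    let ?R = "complex_of_real (r ^ (msize \<alpha> + msize \<beta>))"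
    have R: "?R \<noteq> 0" using r by simp
    define Q where "Q = (\<lambda>n. (if \<alpha> = 0 \<and> \<beta> = 0 then 1 else 0)
      - cnj (grid.hat (N + n) r \<phi> (lookup \<alpha>)) * grid.hat (N + n) r \<phi> (lookup \<beta>))"
    have "Q \<longlonglongrightarrow> (if \<alpha> = 0 \<and> \<beta> = 0 then 1 else 0) - cnj (?p \<alpha> * of_real (r ^ msize \<alpha>)) * (?p \<beta> * of_real (r ^ msize \<beta>))"
      unfolding Q_def by (intro tendsto_intros hat ab)
    also have "(if \<alpha> = 0 \<and> \<beta> = 0 then 1 else 0) - cnj (?p \<alpha> * of_real (r ^ msize \<alpha>)) * (?p \<beta> * of_real (r ^ msize \<beta>)) = H \<alpha> \<beta> * ?R"
      by (simp add: H_def power_add algebra_simps)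
    finally have Q: "Q \<longlonglongrightarrow> H \<alpha> \<beta> * ?R" .
    have "(\<lambda>n. shift_defect (A n) \<alpha> \<beta> * ?R - Q n) \<longlonglongrightarrow> 0"
    proof (rule Lim_null_comparison)
      show "\<forall>\<^sub>F n in sequentially. norm (shift_defect (A n) \<alpha> \<beta> * ?R - Q n)
          \<le> real CARD('d) * (r\<^sup>2 * (r ^ (N + n) / (1 - r\<^sup>2)))"
        unfolding A_def Q_def using agler_grid.shift_defect_grid_matrix[OF grid _ ab] by (intro always_eventually) simp
      have lim: "(\<lambda>n. r ^ (n + N)) \<longlonglongrightarrow> 0" using r LIMSEQ_ignore_initial_segment[OF LIMSEQ_realpow_zero, of r N] by simp
      have "(\<lambda>n. real CARD('d) * (r\<^sup>2 * (r ^ (N + n) / (1 - r\<^sup>2)))) \<longlonglongrightarrow> real CARD('d) * (r\<^sup>2 * (0 / (1 - r\<^sup>2)))"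
      proof -
        have "r\<^sup>2 < 1" using r by (simp add: power_less_one_iff)
        then show ?thesis using lim by (intro tendsto_intros) (simp_all add: add.commute)
      qed
      then show "(\<lambda>n. real CARD('d) * (r\<^sup>2 * (r ^ (N + n) / (1 - r\<^sup>2)))) \<longlonglongrightarrow> 0" by simp
    qed
    from tendsto_add[OF this Q] have "(\<lambda>n. shift_defect (A n) \<alpha> \<beta> * ?R) \<longlonglongrightarrow> H \<alpha> \<beta> * ?R" by simp
    from tendsto_divide[OF this tendsto_const R] show "(\<lambda>n. shift_defect (A n) \<alpha> \<beta>) \<longlonglongrightarrow> H \<alpha> \<beta>"
      by (simp only: nonzero_mult_div_cancel_right[OF R])
  qed
  then show ?thesis unfolding matrix_decomposition_def shift_defect_def H_def .
qed

theorem theorem1p3: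
  fixes N :: nat and p :: "'d::finite cpoly"
  assumes "deg_le p N"
  shows "(nilpotent_contractive N p \<longleftrightarrow> matrix_decomposition N p)
    \<and> (matrix_decomposition N p \<longleftrightarrow> sos_decomposition N p)
    \<and> (sos_decomposition N p \<longleftrightarrow> inner_interpolation N p)"
  using nilpotent_contractive_imp_matrix_decomposition[OF assms]
    matrix_decomposition_imp_nilpotent_contractive[OF assms] matrix_decomposition_iff_sos[of N p]
    matrix_decomposition_imp_inner_interpolation[of N p] inner_interpolation_imp_matrix_decomposition[of N p]
  by blast

end
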